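(* Let $r,\mu,\rho\in\mathbb{R}$, $\sigma>0$, $\lambda=\frac{\mu-r}{\sigma}$, $\gamma>1$, and assume $\rho>(1-\gamma)\left(r+\frac{\lambda^2}{2\gamma}\right)$. Then the value function $V$ solves, in the classical sense at each $x>0$, the Hamilton-Jacobi-Bellman equation $$\rho\,V(x)=r\,x\,V'(x)-\frac{\lambda^2}{2}\,\frac{V'(x)^2}{V''(x)}+\frac{\gamma}{1-\gamma}\,V'(x)^{\frac{\gamma-1}{\gamma}},\qquad x>0.$$
   Context: $W$ is a standard one-dimensional Brownian motion on a filtered probability space $(\Omega,\mathcal{F},\mathbb{F}=(\mathcal{F}_t)_{t\ge0},\mathbb{P})$ satisfying the usual conditions. $\mathbb{R}^+$ denotes the set of nonnegative reals. $L^{2,\mathbb{F}}_{\mathrm{loc}}(\Omega\times[0,\infty);\mathbb{R})$ is the space of $\mathbb{F}$-adapted real-valued (measurable in $(\omega,t)$) processes $Z$ with $\mathbb{E}\left[\int_0^R|Z_t|^2\mathrm{d}t\right]<\infty$ for every $R>0$; $L^{1,\mathbb{F}}_{\mathrm{loc}}(\Omega\times[0,\infty);\mathbb{R}^+)$ is the space of $\mathbb{F}$-adapted $\mathbb{R}^+$-valued (measurable) processes $Z$ with $\mathbb{E}\left[\int_0^R|Z_t|\mathrm{d}t\right]<\infty$ for every $R>0$. For $x>0$, $c\in L^{1,\mathbb{F}}_{\mathrm{loc}}(\Omega\times[0,\infty);\mathbb{R}^+)$ and $\pi\in L^{2,\mathbb{F}}_{\mathrm{loc}}(\Omega\times[0,\infty);\mathbb{R})$,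 the wealth process $X=X^{x;c,\pi}$ is the unique strong solution of $$\mathrm{d}X_t=(rX_t+\sigma\lambda\pi_t)\,\mathrm{d}t+\sigma\pi_t\,\mathrm{d}W_t-c_t\,\mathrm{d}t,\qquad X_0=x.$$ The set of admissible strategies is $$\mathcal{A}(x)=\{(c,\pi)\in L^{1,\mathbb{F}}_{\mathrm{loc}}(\Omega\times[0,\infty);\mathbb{R}^+)\times L^{2,\mathbb{F}}_{\mathrm{loc}}(\Omega\times[0,\infty);\mathbb{R}):\ X^{x;c,\pi}\ge0\}.$$ The objective functional is $J(c)=\mathbb{E}\left[\int_0^\infty e^{-\rho s}\frac{c_s^{1-\gamma}}{1-\gamma}\,\mathrm{d}s\right]\in[-\infty,0]$ (with the convention that $\frac{0^{1-\gamma}}{1-\gamma}=-\infty$), and the value function is $V(x)=\sup_{(c,\pi)\in\mathcal{A}(x)}J(c)\in[-\infty,0]$. "Classical sense" means that $V$ is finite and twice continuously differentiable on $(0,\infty)$, with $V'>0$ and $V''<0$ (so that the right-hand side is well defined), and the equation holds pointwise. *)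

theory Defs
  imports "HOL-Probability.Probability"
begin

text \<open>
  Processes are functions of type \<open>real \<Rightarrow> 'a \<Rightarrow> real\<close>, and filtrations are functions of type
  \<open>real \<Rightarrow> 'a measure\<close> of which only the \<sigma>-algebras are used. Time is \<open>[0,\<infinity>)\<close>: values at negative
  times are never referred to.
\<close>

definition usual_filtration :: "'a measure \<Rightarrow> (real \<Rightarrow> 'a measure) \<Rightarrow> bool" where
  "usual_filtration M F \<longleftrightarrow>
     prob_space M \<and> complete_measure M \<and>
     (\<forall>t\<ge>0. subalgebra M (F t)) \<and>
     (\<forall>s\<ge>0. \<forall>t\<ge>s. sets (F s) \<subseteq> sets (F t)) \<and>
     null_sets M \<subseteq> sets (F 0) \<and>
     (\<forall>t\<ge>0. sets (F t) = (\<Inter>s\<in>{t<..}. sets (F s)))"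

definition adapted :: "(real \<Rightarrow> 'a measure) \<Rightarrow> (real \<Rightarrow> 'a \<Rightarrow> real) \<Rightarrow> bool" where
  "adapted F Z \<longleftrightarrow> (\<forall>t\<ge>0. Z t \<in> borel_measurable (F t))"

definition brownian_motion ::
  "'a measure \<Rightarrow> (real \<Rightarrow> 'a measure) \<Rightarrow> (real \<Rightarrow> 'a \<Rightarrow> real) \<Rightarrow> bool" where
  "brownian_motion M F W \<longleftrightarrow>
     adapted F W \<and>
     (AE \<omega> in M. W 0 \<omega> = 0) \<and>
     (AE \<omega> in M. continuous_on {0..} (\<lambda>t. W t \<omega>)) \<and>
     (\<forall>s\<ge>0. \<forall>t>s.
        distributed M lborel (\<lambda>\<omega>. W t \<omega> - W s \<omega>) (normal_density 0 (sqrt (t - s))) \<and>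
        prob_space.indep_set M (sets (F s))
          {(\<lambda>\<omega>. W t \<omega> - W s \<omega>) -` B \<inter> space M | B. B \<in> sets borel})"

definition measurable_process :: "'a measure \<Rightarrow> (real \<Rightarrow> 'a \<Rightarrow> real) \<Rightarrow> bool" where
  "measurable_process M Z \<longleftrightarrow>
     (\<lambda>(\<omega>, t). Z t \<omega>) \<in> borel_measurable (M \<Otimes>\<^sub>M restrict_space borel {0..})"

definition L2_loc :: "'a measure \<Rightarrow> (real \<Rightarrow> 'a measure) \<Rightarrow> (real \<Rightarrow> 'a \<Rightarrow> real) set" where
  "L2_loc M F = {Z. adapted F Z \<and> measurable_process M Z \<and>
     (\<forall>R>0. (\<integral>\<^sup>+\<omega>. (\<integral>\<^sup>+t\<in>{0..R}. ennreal (\<bar>Z t \<omega>\<bar>\<^sup>2) \<partial>lborel) \<partial>M) < \<infinity>)}"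

definition L1_loc_nonneg :: "'a measure \<Rightarrow> (real \<Rightarrow> 'a measure) \<Rightarrow> (real \<Rightarrow> 'a \<Rightarrow> real) set" where
  "L1_loc_nonneg M F = {Z. adapted F Z \<and> measurable_process M Z \<and>
     (\<forall>t\<ge>0. \<forall>\<omega>\<in>space M. 0 \<le> Z t \<omega>) \<and>
     (\<forall>R>0. (\<integral>\<^sup>+\<omega>. (\<integral>\<^sup>+t\<in>{0..R}. ennreal \<bar>Z t \<omega>\<bar> \<partial>lborel) \<partial>M) < \<infinity>)}"

text \<open>
  A simple integrand is the data \<open>(n, \<tau>, \<xi>)\<close> of a partition \<open>0 \<le> \<tau> 0 < \<dots> < \<tau> n\<close> and bounded random
  variables \<open>\<xi> i\<close>, each measurable with respect to the \<sigma>-algebra at the left endpoint \<open>\<tau> i\<close>. It stands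
  for the process that equals \<open>\<xi> i\<close> on \<open>(\<tau> i, \<tau> (i+1)]\<close> and vanishes elsewhere.
\<close>

type_synonym 'a simple_data = "nat \<times> (nat \<Rightarrow> real) \<times> (nat \<Rightarrow> 'a \<Rightarrow> real)"

definition simple_integrand :: "'a measure \<Rightarrow> (real \<Rightarrow> 'a measure) \<Rightarrow> 'a simple_data \<Rightarrow> bool" where
  "simple_integrand M F = (\<lambda>(n, \<tau>, \<xi>).
     0 \<le> \<tau> 0 \<and> (\<forall>i<n. \<tau> i < \<tau> (Suc i)) \<and>
     (\<forall>i<n. \<xi> i \<in> borel_measurable (F (\<tau> i)) \<and> (\<exists>B. \<forall>\<omega>\<in>space M. \<bar>\<xi> i \<omega>\<bar> \<le> B)))"

definition simple_process :: "'a simple_data \<Rightarrow> real \<Rightarrow> 'a \<Rightarrow> real" where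
  "simple_process = (\<lambda>(n, \<tau>, \<xi>) t \<omega>. \<Sum>i<n. \<xi> i \<omega> * indicator {\<tau> i<..\<tau> (Suc i)} t)"

definition simple_integral ::
  "(real \<Rightarrow> 'a \<Rightarrow> real) \<Rightarrow> 'a simple_data \<Rightarrow> real \<Rightarrow> 'a \<Rightarrow> real" where
  "simple_integral W = (\<lambda>(n, \<tau>, \<xi>) t \<omega>.
     \<Sum>i<n. \<xi> i \<omega> * (W (min t (\<tau> (Suc i))) \<omega> - W (min t (\<tau> i)) \<omega>))"

text \<open>
  \<open>ito_integral M F W Z I\<close>: the process \<open>I\<close> is (a version of) the It\^o integral process of \<open>Z\<close>
  against \<open>W\<close>, i.e. the continuous adapted process which is the \<open>L\<^sup>2\<close>-limit of the integrals of simple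
  integrands converging to \<open>Z\<close> in \<open>L\<^sup>2(\<Omega> \<times> [0,R])\<close> for every \<open>R\<close>. By the It\^o isometry it is
  determined by \<open>Z\<close> up to indistinguishability and does not depend on the approximating sequence.
\<close>

definition ito_integral ::
  "'a measure \<Rightarrow> (real \<Rightarrow> 'a measure) \<Rightarrow> (real \<Rightarrow> 'a \<Rightarrow> real) \<Rightarrow>
   (real \<Rightarrow> 'a \<Rightarrow> real) \<Rightarrow> (real \<Rightarrow> 'a \<Rightarrow> real) \<Rightarrow> bool" where
  "ito_integral M F W Z I \<longleftrightarrow>
     adapted F I \<and> (AE \<omega> in M. continuous_on {0..} (\<lambda>t. I t \<omega>)) \<and>
     (\<exists>S :: nat \<Rightarrow> 'a simple_data.
        (\<forall>k. simple_integrand M F (S k)) \<and>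
        (\<forall>R>0. (\<lambda>k. \<integral>\<^sup>+\<omega>. (\<integral>\<^sup>+t\<in>{0..R}. ennreal (\<bar>simple_process (S k) t \<omega> - Z t \<omega>\<bar>\<^sup>2) \<partial>lborel) \<partial>M)
                 \<longlonglongrightarrow> 0) \<and>
        (\<forall>t\<ge>0. (\<lambda>k. \<integral>\<^sup>+\<omega>. ennreal (\<bar>simple_integral W (S k) t \<omega> - I t \<omega>\<bar>\<^sup>2) \<partial>M) \<longlonglongrightarrow> 0))"

text \<open>\<open>X\<close> solves \<open>dX\<^sub>t = (r X\<^sub>t + \<sigma> lam \<pi>\<^sub>t) dt + \<sigma> \<pi>\<^sub>t dW\<^sub>t - c\<^sub>t dt\<close>, \<open>X\<^sub>0 = x\<close>.\<close>

definition wealth_process ::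
  "'a measure \<Rightarrow> (real \<Rightarrow> 'a measure) \<Rightarrow> (real \<Rightarrow> 'a \<Rightarrow> real) \<Rightarrow> real \<Rightarrow> real \<Rightarrow> real \<Rightarrow>
   real \<Rightarrow> (real \<Rightarrow> 'a \<Rightarrow> real) \<Rightarrow> (real \<Rightarrow> 'a \<Rightarrow> real) \<Rightarrow> (real \<Rightarrow> 'a \<Rightarrow> real) \<Rightarrow> bool" where
  "wealth_process M F W r \<sigma> lam x c \<pi> X \<longleftrightarrow>
     adapted F X \<and> (AE \<omega> in M. continuous_on {0..} (\<lambda>t. X t \<omega>)) \<and>
     (\<exists>I. ito_integral M F W (\<lambda>t \<omega>. \<sigma> * \<pi> t \<omega>) I \<and>
        (AE \<omega> in M. \<forall>t\<ge>0.
           X t \<omega> = x + (LINT s:{0..t}|lborel. r * X s \<omega> + \<sigma> * lam * \<pi> s \<omega>)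
                     + I t \<omega> - (LINT s:{0..t}|lborel. c s \<omega>)))"

text \<open>
  The wealth process is unique up to indistinguishability, so its nonnegativity is expressed by the
  existence of an almost surely nonnegative solution.
\<close>

definition admissible ::
  "'a measure \<Rightarrow> (real \<Rightarrow> 'a measure) \<Rightarrow> (real \<Rightarrow> 'a \<Rightarrow> real) \<Rightarrow> real \<Rightarrow> real \<Rightarrow> real \<Rightarrow>
   real \<Rightarrow> ((real \<Rightarrow> 'a \<Rightarrow> real) \<times> (real \<Rightarrow> 'a \<Rightarrow> real)) set" where
  "admissible M F W r \<sigma> lam x = {(c, \<pi>). c \<in> L1_loc_nonneg M F \<and> \<pi> \<in> L2_loc M F \<and>
     (\<exists>X. wealth_process M F W r \<sigma> lam x c \<pi> X \<and> (AE \<omega> in M. \<forall>t\<ge>0. 0 \<le> X t \<omega>))}"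

definition crra_utility :: "real \<Rightarrow> real \<Rightarrow> ereal" where
  "crra_utility \<gamma> z = (if z = 0 then -\<infinity> else ereal (z powr (1 - \<gamma>) / (1 - \<gamma>)))"

text \<open>
  For \<open>\<gamma> > 1\<close> the utility is nonpositive, so its expected discounted integral, with values in
  \<open>[-\<infinity>, 0]\<close>, is minus the nonnegative integral of its negation.
\<close>

definition objective :: "'a measure \<Rightarrow> real \<Rightarrow> real \<Rightarrow> (real \<Rightarrow> 'a \<Rightarrow> real) \<Rightarrow> ereal" where
  "objective M \<rho> \<gamma> c =
     - enn2ereal (\<integral>\<^sup>+\<omega>. (\<integral>\<^sup>+s\<in>{0..}.
         e2ennreal (- (ereal (exp (- \<rho> * s)) * crra_utility \<gamma> (c s \<omega>))) \<partial>lborel) \<partial>M)"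

definition value_function ::
  "'a measure \<Rightarrow> (real \<Rightarrow> 'a measure) \<Rightarrow> (real \<Rightarrow> 'a \<Rightarrow> real) \<Rightarrow> real \<Rightarrow> real \<Rightarrow> real \<Rightarrow>
   real \<Rightarrow> real \<Rightarrow> real \<Rightarrow> ereal" where
  "value_function M F W r \<sigma> lam \<rho> \<gamma> x =
     (SUP (c, \<pi>) \<in> admissible M F W r \<sigma> lam x. objective M \<rho> \<gamma> c)"

end

(*
  Put a = (rho - (1 - gamma) (r + lam^2 / (2 gamma))) / gamma > 0. The value function is
  V(x) = a^(-gamma) x^(1 - gamma) / (1 - gamma), for which the equation is elementary.

  Upper bound, by duality: let zeta_t = exp (- lam W_t - lam^2 t / 2) and let N be the Ito integral of
  sigma pi plus lam times its time integral. Independence of increments gives E[zeta_T N_t] = 0 for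
  t <= T when pi is simple, hence for all pi by L^2 limits. Solving the wealth equation pathwise gives
  int_0^T e^(-rs) c_s ds <= x + e^(-rT) N_T + r int_0^T e^(-rs) N_s ds whenever X_T >= 0, so that
  E int_0^T e^(-rs) zeta_s c_s ds <= x. Young's inequality c^(1-gamma) / (gamma-1) + z c >=
  gamma / (gamma-1) z^((gamma-1)/gamma) with z = (a x)^(-gamma) e^((rho-r)s) zeta_s and Gaussian moments
  conclude; neither Ito's formula nor localisation is needed.

  The bound is attained by c = a X and pi = lam / (gamma sigma) X with X a geometric Brownian motion.
  That X solves the wealth equation is checked directly from the definition of the Ito integral: the
  errors of its Riemann sums are orthogonal in L^2 and can be computed.
*)
theory Submission
  imports Defs
begin

text \<open>The rate \<open>a\<close> comes from the ansatz v = K x^(1-\<gamma>) / (1-\<gamma>):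
  every term of the equation is then a multiple of K x^(1-\<gamma>), and what remains to solve is K
  = a^(-\<gamma>). The multiplier z is the one for which Young's inequality is an equality along the
  candidate optimum, because e^(-\<rho> s) (a X_s)^(-\<gamma>) = (a x)^(-\<gamma>) e^(-r s) zeta_s
  for the geometric Brownian motion X; hence the dual bound and the attained value coincide. The
  proof is shaped by the fact that strategies are adapted and jointly measurable, but not
  progressively measurable: a time integral of \<open>\<pi>\<close> or \<open>c\<close> up to t is
  not known to be \<open>F t\<close>-measurable. So nothing built from such integrals is treated as
  a martingale. The weight stays frozen at the horizon T, where it is just a square-integrable
  random variable, and is moved to an earlier time s only for fixed s, where \<open>c s\<close> is
  \<open>F s\<close>-measurable; Tonelli's theorem joins the two views. Square-integrability of the
  weight is also what lets L2 limits of simple integrals suffice. After subtraction of N each wealth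
  path is a time integral, so its equation is an ordinary linear one.\<close>

section \<open>Brownian increments\<close>

text \<open>Completing the square: an exponential weight only shifts the mean of a Gaussian, so
  exponential moments reduce to ordinary moments of a shifted normal density.\<close>

lemma normal_density_exp_tilt:
  assumes "h > 0"
  shows "normal_density 0 (sqrt h) x * exp (p * x) = exp (p\<^sup>2 * h / 2) * normal_density (p * h) (sqrt h) x"
proof -
  have "- (x - 0)\<^sup>2 / (2 * (sqrt h)\<^sup>2) + p * x = p\<^sup>2 * h / 2 + - (x - p * h)\<^sup>2 / (2 * (sqrt h)\<^sup>2)"
    using assms by (simp add: field_simps power2_eq_square)
  then have "exp (- (x - 0)\<^sup>2 / (2 * (sqrt h)\<^sup>2)) * exp (p * x)
      = exp (p\<^sup>2 * h / 2) * exp (- (x - p * h)\<^sup>2 / (2 * (sqrt h)\<^sup>2))"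
    by (metis exp_add)
  then show ?thesis
    unfolding normal_density_def by (simp add: field_simps)
qed

text \<open>Continuity and the start at 0 are required for every \<open>\<omega>\<close>, so that
  joint measurability and pathwise identities need no exceptional set. A general Brownian motion is
  brought to this form at the end by changing it on a null set.\<close>

locale continuous_brownian_motion = prob_space M
  for M :: "'a measure" +
  fixes F :: "real \<Rightarrow> 'a measure" and W :: "real \<Rightarrow> 'a \<Rightarrow> real"
  assumes usual: "usual_filtration M F"
    and brownian: "brownian_motion M F W"
    and W_continuous: "\<And>\<omega>. continuous_on {0..} (\<lambda>t. W t \<omega>)"
    and W_zero: "\<And>\<omega>. W 0 \<omega> = 0"
begin

lemma subalgebra_F: "0 \<le> t \<Longrightarrow> subalgebra M (F t)"
proof -
  have "\<forall>t\<ge>0. subalgebra M (F t)"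
    using usual unfolding usual_filtration_def by (elim conjE)
  then show "0 \<le> t \<Longrightarrow> subalgebra M (F t)" by simp
qed

lemma space_F: "0 \<le> t \<Longrightarrow> space (F t) = space M"
  using subalgebra_F by (auto simp: subalgebra_def)

lemma sets_F_mono: "0 \<le> s \<Longrightarrow> s \<le> t \<Longrightarrow> sets (F s) \<subseteq> sets (F t)"
proof -
  have "\<forall>s\<ge>0. \<forall>t\<ge>s. sets (F s) \<subseteq> sets (F t)"
    using usual unfolding usual_filtration_def by (elim conjE)
  then show "0 \<le> s \<Longrightarrow> s \<le> t \<Longrightarrow> sets (F s) \<subseteq> sets (F t)" by simp
qed

lemma measurable_F_imp_M: "0 \<le> t \<Longrightarrow> f \<in> borel_measurable (F t) \<Longrightarrow> f \<in> borel_measurable M"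
  using measurable_from_subalg[OF subalgebra_F] .

lemma measurable_F_mono:
  assumes "f \<in> borel_measurable (F s)" "0 \<le> s" "s \<le> t"
  shows "f \<in> borel_measurable (F t)"
proof -
  have "subalgebra (F t) (F s)"
    using assms space_F[of s] space_F[of t] sets_F_mono by (auto simp: subalgebra_def)
  then show ?thesis
    using assms(1) by (rule measurable_from_subalg)
qed

lemma W_measurable_F: "0 \<le> t \<Longrightarrow> W t \<in> borel_measurable (F t)"
  using brownian unfolding brownian_motion_def adapted_def by blast

lemma W_measurable [measurable]: "0 \<le> t \<Longrightarrow> W t \<in> borel_measurable M"
  using W_measurable_F measurable_F_imp_M by blast

lemma increment_measurable [measurable]:
  "0 \<le> s \<Longrightarrow> s \<le> t \<Longrightarrow> (\<lambda>\<omega>. W t \<omega> - W s \<omega>) \<in> borel_measurable M"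
  by (intro borel_measurable_diff W_measurable) auto

lemma increment_distributed:
  "0 \<le> s \<Longrightarrow> s < t \<Longrightarrow>
    distributed M lborel (\<lambda>\<omega>. W t \<omega> - W s \<omega>) (normal_density 0 (sqrt (t - s)))"
  using brownian unfolding brownian_motion_def by blast

lemma increment_exp_moment:
  assumes "0 \<le> s" "s \<le> t"
  shows "has_bochner_integral M (\<lambda>\<omega>. exp (p * (W t \<omega> - W s \<omega>))) (exp (p\<^sup>2 * (t - s) / 2))"
\<comment> \<open>The law of an increment is given only for s < t; for s = t the increment is 0 and
  has no density.\<close>
proof (cases "s = t")
  case True
  then show ?thesis
    by (simp add: has_bochner_integral_iff prob_space)
next
  case False
  then have st: "s < t" "0 < t - s" "0 < sqrt (t - s)" using assms by auto
  let ?f = "\<lambda>x. normal_density 0 (sqrt (t - s)) x * exp (p * x)"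
  have f: "?f = (\<lambda>x. exp (p\<^sup>2 * (t - s) / 2) * normal_density (p * (t - s)) (sqrt (t - s)) x)"
    using normal_density_exp_tilt[OF st(2)] by auto
  have "integrable lborel ?f" "(\<integral>x. ?f x \<partial>lborel) = exp (p\<^sup>2 * (t - s) / 2)"
    unfolding f using st by auto
  then show ?thesis
    using distributed_integrable[OF increment_distributed[OF assms(1) st(1)], of "\<lambda>x. exp (p * x)"]
      distributed_integral[OF increment_distributed[OF assms(1) st(1)], of "\<lambda>x. exp (p * x)"]
    by (simp add: has_bochner_integral_iff)
qed

text \<open>The shifted density has mean p (t - s), which is the first factor of the result. The
  case p = 0 supplies the zero mean of the increment.\<close>

lemma increment_exp_first_moment:
  assumes "0 \<le> s" "s \<le> t"
  shows "has_bochner_integral M (\<lambda>\<omega>. exp (p * (W t \<omega> - W s \<omega>)) * (W t \<omega> - W s \<omega>))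
    (p * (t - s) * exp (p\<^sup>2 * (t - s) / 2))"
proof (cases "s = t")
  case True
  then show ?thesis
    by (simp add: has_bochner_integral_iff)
next
  case False
  then have st: "s < t" "0 < t - s" "0 < sqrt (t - s)" using assms by auto
  let ?f = "\<lambda>x. normal_density 0 (sqrt (t - s)) x * (exp (p * x) * x)"
  have f: "?f = (\<lambda>x. exp (p\<^sup>2 * (t - s) / 2) * (normal_density (p * (t - s)) (sqrt (t - s)) x * x))"
    using normal_density_exp_tilt[OF st(2)] by (auto simp flip: mult.assoc)
  have "integrable lborel ?f" "(\<integral>x. ?f x \<partial>lborel) = p * (t - s) * exp (p\<^sup>2 * (t - s) / 2)"
    unfolding f
    using st integrable_normal_moment_nz_1[OF st(3), of "p * (t - s)"]
      integral_normal_moment_nz_1[OF st(3), of "p * (t - s)"] by auto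
  then show ?thesis
    using distributed_integrable[OF increment_distributed[OF assms(1) st(1)], of "\<lambda>x. exp (p * x) * x"]
      distributed_integral[OF increment_distributed[OF assms(1) st(1)], of "\<lambda>x. exp (p * x) * x"]
    by (simp add: has_bochner_integral_iff)
qed

lemma increment_second_moment:
  assumes "0 \<le> s" "s \<le> t"
  shows "has_bochner_integral M (\<lambda>\<omega>. (W t \<omega> - W s \<omega>)\<^sup>2) (t - s)"
proof (cases "s = t")
  case True
  then show ?thesis
    by (simp add: has_bochner_integral_iff)
next
  case False
  then have st: "s < t" "0 < t - s" "0 < sqrt (t - s)" using assms by auto
  let ?f = "\<lambda>x. normal_density 0 (sqrt (t - s)) x * x\<^sup>2"
  have "integrable lborel ?f" "(\<integral>x. ?f x \<partial>lborel) = t - s"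
    using st integrable_normal_moment[OF st(3), of 0 2] integral_normal_moment_even[OF st(3), of 0 1]
    by (auto simp: fact_numeral)
  then show ?thesis
    using distributed_integrable[OF increment_distributed[OF assms(1) st(1)], of "\<lambda>x. x\<^sup>2"]
      distributed_integral[OF increment_distributed[OF assms(1) st(1)], of "\<lambda>x. x\<^sup>2"]
    by (simp add: has_bochner_integral_iff)
qed

text \<open>Independence is given for families of sets; this turns it into a statement about random
  variables. The common codomain is general because both real and \<open>ennreal\<close> factors are
  needed.\<close>

lemma increment_indep:
  assumes st: "0 \<le> s" "s < t"
    and \<xi>: "\<xi> \<in> borel_measurable (F s)"
    and \<phi> [measurable]: "\<phi> \<in> borel_measurable borel"
  shows "indep_var borel \<xi> borel (\<lambda>\<omega>. \<phi> (W t \<omega> - W s \<omega>) :: 'b :: topological_space)"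
proof -
  let ?D = "\<lambda>\<omega>. W t \<omega> - W s \<omega>"
  have D [measurable]: "?D \<in> borel_measurable M" using st by auto
  let ?A = "sigma_sets (space M) {\<xi> -` A \<inter> space M | A. A \<in> sets borel}"
  let ?B = "sigma_sets (space M) {(\<lambda>\<omega>. \<phi> (?D \<omega>)) -` A \<inter> space M | A. A \<in> sets borel}"
  have 1: "indep_set (sets (F s)) {?D -` B \<inter> space M | B. B \<in> sets borel}"
    using brownian st unfolding brownian_motion_def by blast
  have 2: "?A \<subseteq> sets (F s)"
  proof -
    have "\<xi> -` A \<inter> space M \<in> sets (F s)" if "A \<in> sets borel" for A
      using measurable_sets[OF \<xi> that] unfolding space_F[OF st(1)] .
    then have "{\<xi> -` A \<inter> space M | A. A \<in> sets borel} \<subseteq> sets (F s)"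
      by blast
    from sets.sigma_sets_subset[OF this] show ?thesis
      unfolding space_F[OF st(1)] .
  qed
  \<comment> \<open>The preimages of Borel sets under the increment already form a sigma-algebra, so
    it contains the one generated by \<open>\<phi>\<close> of the increment, and independence passes
    to the smaller families.\<close>
  have 3: "?B \<subseteq> {?D -` B \<inter> space M | B. B \<in> sets borel}"
  proof -
    let ?V = "vimage_algebra (space M) ?D borel"
    have V: "sets ?V = {?D -` B \<inter> space M | B. B \<in> sets borel}"
      by (subst sets_vimage_algebra2) auto
    have "{(\<lambda>\<omega>. \<phi> (?D \<omega>)) -` A \<inter> space M | A. A \<in> sets borel} \<subseteq> sets ?V"
    proof clarsimp
      fix A :: "'b set" assume A: "A \<in> sets borel"
      have "(\<lambda>\<omega>. \<phi> (?D \<omega>)) -` A \<inter> space M = ?D -` (\<phi> -` A) \<inter> space M" by auto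
      moreover have "\<phi> -` A \<in> sets borel"
        using measurable_sets[OF \<phi> A] by simp
      ultimately show "(\<lambda>\<omega>. \<phi> (?D \<omega>)) -` A \<inter> space M \<in> sets ?V"
        unfolding V by auto
    qed
    from sets.sigma_sets_subset[OF this] show ?thesis
      unfolding V[symmetric] space_vimage_algebra .
  qed
  have "indep_set ?A ?B"
    using 1 unfolding indep_set_def
    by (rule indep_sets_mono_sets) (use 2 3 in \<open>simp split: bool.split\<close>)
  moreover have "\<xi> \<in> borel_measurable M"
    using measurable_from_subalg[OF subalgebra_F \<xi>] st by simp
  moreover have "(\<lambda>\<omega>. \<phi> (?D \<omega>)) \<in> borel_measurable M" by measurable
  ultimately show ?thesis
    unfolding indep_var_eq by (intro conjI)
qed

text \<open>Together with its \<open>ennreal\<close> version below, this factorization does the work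
  of conditional expectation given \<open>F s\<close>: a factor known at time s is separated from a
  function of the later increment.\<close>

lemma has_bochner_integral_increment_mult:
  assumes st: "0 \<le> s" "s \<le> t"
    and \<xi>: "\<xi> \<in> borel_measurable (F s)" "has_bochner_integral M \<xi> a"
    and \<phi>: "\<phi> \<in> borel_measurable borel" "has_bochner_integral M (\<lambda>\<omega>. \<phi> (W t \<omega> - W s \<omega>)) (b :: real)"
  shows "has_bochner_integral M (\<lambda>\<omega>. \<xi> \<omega> * \<phi> (W t \<omega> - W s \<omega>)) (a * b)"
proof (cases "s = t")
  case True
  then have "b = \<phi> 0"
    using \<phi>(2) by (simp add: has_bochner_integral_iff prob_space)
  then show ?thesis
    using True \<xi>(2) by (auto intro: has_bochner_integral_mult_left)
next
  case False
  then have "s < t" using st by simp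
  note ind = increment_indep[OF st(1) this \<xi>(1) \<phi>(1)]
  show ?thesis
    using indep_var_integrable[OF ind] indep_var_lebesgue_integral[OF ind] \<xi>(2) \<phi>(2)
    by (simp add: has_bochner_integral_iff)
qed

text \<open>The nonnegative version is needed for consumption at a fixed time, whose expectation may
  be infinite: integrability of \<open>c\<close> is only assumed jointly in time and
  \<open>\<omega>\<close>.\<close>

lemma nn_integral_increment_mult:
  fixes \<phi> :: "real \<Rightarrow> ennreal"
  assumes st: "0 \<le> s" "s \<le> t"
    and \<xi>: "\<xi> \<in> borel_measurable (F s)"
    and \<phi>: "\<phi> \<in> borel_measurable borel"
  shows "(\<integral>\<^sup>+\<omega>. \<xi> \<omega> * \<phi> (W t \<omega> - W s \<omega>) \<partial>M) = (\<integral>\<^sup>+\<omega>. \<xi> \<omega> \<partial>M) * (\<integral>\<^sup>+\<omega>. \<phi> (W t \<omega> - W s \<omega>) \<partial>M)"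
proof (cases "s = t")
  case True
  have "\<xi> \<in> borel_measurable M" using measurable_from_subalg[OF subalgebra_F \<xi>] st by simp
  then show ?thesis
    unfolding True by (simp add: nn_integral_multc emeasure_space_1 del: mult_eq_0_iff)
next
  case False
  then have "s < t" using st by simp
  note ind = increment_indep[OF st(1) this \<xi> \<phi>]
  let ?X = "case_bool \<xi> (\<lambda>\<omega>. \<phi> (W t \<omega> - W s \<omega>))"
  have b: "case_bool borel borel = (\<lambda>_. borel :: ennreal measure)"
    by (rule ext) (simp split: bool.split)
  have "indep_vars (\<lambda>_. borel) ?X UNIV"
    using ind unfolding indep_var_def b .
  from indep_vars_nn_integral[OF _ this] show ?thesis
    by (simp add: UNIV_bool mult.commute)
qed

end

section \<open>Partitions, square-integrable functions and continuous processes\<close>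

lemma partition_mono:
  fixes s :: "nat \<Rightarrow> real"
  assumes mono: "\<And>i. i < m \<Longrightarrow> s i \<le> s (Suc i)" and "i \<le> j" "j \<le> m"
  shows "s i \<le> s j"
  using assms(2,3)
proof (induction j rule: dec_induct)
  case (step k)
  then show ?case using mono[of k] by simp
qed simp

lemma partition_locate:
  fixes s :: "nat \<Rightarrow> real"
  assumes "s 0 < u" "u \<le> s m"
  shows "\<exists>i<m. u \<in> {s i<..s (Suc i)}"
  using assms(2)
proof (induction m)
  case 0
  then show ?case using assms(1) by simp
next
  case (Suc m)
  then show ?case
    by (cases "u \<le> s m") (auto simp: less_Suc_eq)
qed

text \<open>Half-open intervals are disjoint even if partition points coincide. Such repetitions are
  allowed because a partition stopped at t repeats the value t.\<close>

lemma partition_sum_indicator: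
  fixes s f :: "nat \<Rightarrow> real"
  assumes mono: "\<And>i. i < m \<Longrightarrow> s i \<le> s (Suc i)" and i: "i < m" "u \<in> {s i<..s (Suc i)}"
  shows "(\<Sum>j<m. f j * indicator {s j<..s (Suc j)} u) = f i"
proof -
  have sle: "s i \<le> s j" if "i \<le> j" "j \<le> m" for i j
    by (rule partition_mono[of m s, OF mono that])
  have "u \<notin> {s j<..s (Suc j)}" if "j < m" "j \<noteq> i" for j
    using that i sle[of "Suc i" j] sle[of "Suc j" i] by (cases "j < i") auto
  then have "(\<Sum>j<m. f j * indicator {s j<..s (Suc j)} u) = (\<Sum>j<m. if j = i then f i else 0)"
    using i by (intro sum.cong) auto
  then show ?thesis using i by simp
qed

lemma integrable_mult_of_squares:
  fixes f g :: "'a \<Rightarrow> real"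
  assumes [measurable]: "f \<in> borel_measurable M" "g \<in> borel_measurable M"
    and "integrable M (\<lambda>x. (f x)\<^sup>2)" "integrable M (\<lambda>x. (g x)\<^sup>2)"
  shows "integrable M (\<lambda>x. f x * g x)"
proof (rule Bochner_Integration.integrable_bound)
  show "integrable M (\<lambda>x. (f x)\<^sup>2 + (g x)\<^sup>2)" using assms by auto
  have "\<bar>a * b\<bar> \<le> a\<^sup>2 + b\<^sup>2" for a b :: real
  proof -
    have "2 * (\<bar>a\<bar> * \<bar>b\<bar>) \<le> \<bar>a\<bar>\<^sup>2 + \<bar>b\<bar>\<^sup>2" using sum_squares_bound[of "\<bar>a\<bar>" "\<bar>b\<bar>"] by simp
    moreover have "0 \<le> \<bar>a\<bar> * \<bar>b\<bar>" by simp
    ultimately have "\<bar>a\<bar> * \<bar>b\<bar> \<le> \<bar>a\<bar>\<^sup>2 + \<bar>b\<bar>\<^sup>2" by linarith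
    then show ?thesis by (simp add: abs_mult)
  qed
  then show "AE x in M. norm (f x * g x) \<le> norm ((f x)\<^sup>2 + (g x)\<^sup>2)" by (auto simp: abs_mult)
qed auto

text \<open>Pythagoras in L2, with the last summand split off in the induction. It serves both the
  second moment of a simple integral and the error of the Riemann sums for the exponential.\<close>

lemma has_bochner_integral_sum_orthogonal_square:
  fixes D :: "nat \<Rightarrow> 'a \<Rightarrow> real"
  assumes meas: "\<And>i. i < n \<Longrightarrow> D i \<in> borel_measurable M"
    and sq: "\<And>i. i < n \<Longrightarrow> has_bochner_integral M (\<lambda>x. (D i x)\<^sup>2) (d i)"
    and orth: "\<And>i j. i < j \<Longrightarrow> j < n \<Longrightarrow> (\<integral>x. D i x * D j x \<partial>M) = 0"
  shows "has_bochner_integral M (\<lambda>x. (\<Sum>i<n. D i x)\<^sup>2) (\<Sum>i<n. d i)"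
  using assms
proof (induction n)
  case 0
  show ?case by (simp add: has_bochner_integral_zero)
next
  case (Suc n)
  have IH: "has_bochner_integral M (\<lambda>x. (\<Sum>i<n. D i x)\<^sup>2) (\<Sum>i<n. d i)"
    using Suc.prems by (intro Suc.IH) auto
  have cross: "has_bochner_integral M (\<lambda>x. D i x * D n x) 0" if "i < n" for i
  proof -
    have "integrable M (\<lambda>x. D i x * D n x)"
      using Suc.prems(1,2)[of i] Suc.prems(1,2)[of n] that
      by (intro integrable_mult_of_squares) (auto simp: has_bochner_integral_iff)
    then show ?thesis using Suc.prems(3)[OF that] by (simp add: has_bochner_integral_iff)
  qed
  have c: "has_bochner_integral M (\<lambda>x. \<Sum>i<n. D i x * D n x) (\<Sum>i<n. 0)"
    using cross by (intro has_bochner_integral_sum) auto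
  have "has_bochner_integral M
     (\<lambda>x. ((\<Sum>i<n. D i x)\<^sup>2 + 2 * (\<Sum>i<n. D i x * D n x)) + (D n x)\<^sup>2) (((\<Sum>i<n. d i) + 2 * (\<Sum>i<n. 0)) + d n)"
    using Suc.prems(2)[of n] by (intro has_bochner_integral_add has_bochner_integral_mult_right IH c) auto
  moreover have "((\<Sum>i<n. D i x)\<^sup>2 + 2 * (\<Sum>i<n. D i x * D n x)) + (D n x)\<^sup>2 = (\<Sum>i<Suc n. D i x)\<^sup>2" for x
    by (simp add: power2_sum sum_distrib_right[symmetric])
  ultimately show ?case by simp
qed

text \<open>Rounding time down to a multiple of 1/(n+1) leaves countably many time values, so each
  approximation is measurable, and continuity of the paths gives the limit. The measure
  \<open>N\<close> is arbitrary because the lemma is applied with \<open>F t\<close> as well as with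
  \<open>M\<close>.\<close>

lemma continuous_process_jointly_measurable:
  fixes X :: "real \<Rightarrow> 'a \<Rightarrow> real"
  assumes X [measurable]: "\<And>t. X t \<in> borel_measurable N"
    and cont: "\<And>\<omega>. \<omega> \<in> space N \<Longrightarrow> continuous_on UNIV (\<lambda>t. X t \<omega>)"
  shows "(\<lambda>z. X (snd z) (fst z)) \<in> borel_measurable (N \<Otimes>\<^sub>M lborel)"
proof (rule borel_measurable_LIMSEQ_real)
  let ?f = "\<lambda>n (z :: 'a \<times> real). X (real_of_int \<lfloor>real (Suc n) * snd z\<rfloor> / real (Suc n)) (fst z)"
  show "?f n \<in> borel_measurable (N \<Otimes>\<^sub>M lborel)" for n
    by (rule measurable_compose_countable[where f="\<lambda>i z. X (real_of_int i / real (Suc n)) (fst z)"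
          and g="\<lambda>z. \<lfloor>real (Suc n) * snd z\<rfloor>"]) measurable
  fix z :: "'a \<times> real" assume "z \<in> space (N \<Otimes>\<^sub>M lborel)"
  then have "fst z \<in> space N" by (auto simp: space_pair_measure)
  then have "isCont (\<lambda>t. X t (fst z)) (snd z)"
    using cont by (simp add: continuous_on_eq_continuous_at)
  moreover have "(\<lambda>n. real_of_int \<lfloor>real (Suc n) * snd z\<rfloor> / real (Suc n)) \<longlonglongrightarrow> snd z"
  proof (rule tendsto_sandwich)
    show "\<forall>\<^sub>F n in sequentially. snd z - 1 / real (Suc n) \<le> real_of_int \<lfloor>real (Suc n) * snd z\<rfloor> / real (Suc n)"
    proof (intro always_eventually allI)
      fix n
      have "real (Suc n) * snd z - 1 \<le> real_of_int \<lfloor>real (Suc n) * snd z\<rfloor>" by linarith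
      then have "(real (Suc n) * snd z - 1) / real (Suc n) \<le> real_of_int \<lfloor>real (Suc n) * snd z\<rfloor> / real (Suc n)"
        by (intro divide_right_mono) auto
      then show "snd z - 1 / real (Suc n) \<le> real_of_int \<lfloor>real (Suc n) * snd z\<rfloor> / real (Suc n)"
        by (simp add: diff_divide_distrib del: of_nat_Suc)
    qed
    show "\<forall>\<^sub>F n in sequentially. real_of_int \<lfloor>real (Suc n) * snd z\<rfloor> / real (Suc n) \<le> snd z"
      by (intro always_eventually allI) (simp add: divide_le_eq mult.commute del: of_nat_Suc)
    show "(\<lambda>n. snd z - 1 / real (Suc n)) \<longlonglongrightarrow> snd z"
      using tendsto_diff[OF tendsto_const LIMSEQ_inverse_real_of_nat, of "snd z"] by (simp add: inverse_eq_divide)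
  qed simp
  ultimately show "(\<lambda>n. ?f n z) \<longlonglongrightarrow> X (snd z) (fst z)"
    by (rule isCont_tendsto_compose)
qed

lemma nn_integral_Icc_square_le:
  fixes f :: "real \<Rightarrow> real"
  assumes [measurable]: "f \<in> borel_measurable borel" and "0 \<le> t"
  shows "(\<integral>\<^sup>+s\<in>{0..t}. ennreal \<bar>f s\<bar> \<partial>lborel)\<^sup>2 \<le> ennreal t * (\<integral>\<^sup>+s\<in>{0..t}. ennreal ((f s)\<^sup>2) \<partial>lborel)"
proof -
  have "(\<integral>\<^sup>+s. (ennreal \<bar>f s\<bar> * indicator {0..t} s) * indicator {0..t} s \<partial>lborel)\<^sup>2
    \<le> (\<integral>\<^sup>+s. (ennreal \<bar>f s\<bar> * indicator {0..t} s)\<^sup>2 \<partial>lborel) * (\<integral>\<^sup>+s. (indicator {0..t} s)\<^sup>2 \<partial>lborel)"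
    by (rule Cauchy_Schwarz_nn_integral) auto
  also have "(\<integral>\<^sup>+s. (indicator {0..t} s)\<^sup>2 \<partial>lborel) = (\<integral>\<^sup>+s. indicator {0..t} s \<partial>lborel)"
    by (intro nn_integral_cong) (auto simp: indicator_def)
  also have "\<dots> = ennreal t" using assms by simp
  also have "(\<integral>\<^sup>+s. (ennreal \<bar>f s\<bar> * indicator {0..t} s)\<^sup>2 \<partial>lborel) = (\<integral>\<^sup>+s\<in>{0..t}. ennreal ((f s)\<^sup>2) \<partial>lborel)"
    by (intro nn_integral_cong) (auto simp: indicator_def ennreal_power)
  also have "(\<integral>\<^sup>+s. (ennreal \<bar>f s\<bar> * indicator {0..t} s) * indicator {0..t} s \<partial>lborel) = (\<integral>\<^sup>+s\<in>{0..t}. ennreal \<bar>f s\<bar> \<partial>lborel)"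
    by (intro nn_integral_cong) (auto simp: indicator_def)
  finally show ?thesis by (simp add: mult.commute)
qed

text \<open>Cauchy-Schwarz against the constant 1. Integrability need not be assumed: for a
  nonintegrable \<open>f\<close> the Bochner integral is 0 by convention and the bound is
  trivial.\<close>

lemma abs_set_integral_square_le:
  fixes f :: "real \<Rightarrow> real"
  assumes [measurable]: "f \<in> borel_measurable borel" and t: "0 \<le> t"
  shows "ennreal ((LINT s:{0..t}|lborel. f s)\<^sup>2) \<le> ennreal t * (\<integral>\<^sup>+s\<in>{0..t}. ennreal ((f s)\<^sup>2) \<partial>lborel)"
proof -
  have "ennreal \<bar>LINT s:{0..t}|lborel. f s\<bar> \<le> (\<integral>\<^sup>+s\<in>{0..t}. ennreal \<bar>f s\<bar> \<partial>lborel)"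
  proof (cases "set_integrable lborel {0..t} f")
    case True
    then have "ennreal \<bar>LINT s:{0..t}|lborel. f s\<bar> \<le> (\<integral>\<^sup>+s. ennreal \<bar>indicator {0..t} s * f s\<bar> \<partial>lborel)"
      unfolding set_lebesgue_integral_def set_integrable_def
      using integral_norm_bound_ennreal[of lborel "\<lambda>s. indicator {0..t} s *\<^sub>R f s"] by simp
    also have "\<dots> = (\<integral>\<^sup>+s\<in>{0..t}. ennreal \<bar>f s\<bar> \<partial>lborel)"
      by (intro nn_integral_cong) (auto simp: indicator_def)
    finally show ?thesis .
  next
    case False
    then show ?thesis
      by (simp add: set_lebesgue_integral_def set_integrable_def not_integrable_integral_eq)
  qed
  then have "(ennreal \<bar>LINT s:{0..t}|lborel. f s\<bar>)\<^sup>2 \<le> (\<integral>\<^sup>+s\<in>{0..t}. ennreal \<bar>f s\<bar> \<partial>lborel)\<^sup>2"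
    by (intro power_mono) auto
  also have "\<dots> \<le> ennreal t * (\<integral>\<^sup>+s\<in>{0..t}. ennreal ((f s)\<^sup>2) \<partial>lborel)"
    by (rule nn_integral_Icc_square_le) (auto simp: t)
  finally show ?thesis by (simp add: ennreal_power)
qed

lemma abs_integral_mult_square_le:
  fixes f g :: "'a \<Rightarrow> real"
  assumes [measurable]: "f \<in> borel_measurable M" "g \<in> borel_measurable M"
  shows "ennreal ((\<integral>x. f x * g x \<partial>M)\<^sup>2) \<le> (\<integral>\<^sup>+x. ennreal ((f x)\<^sup>2) \<partial>M) * (\<integral>\<^sup>+x. ennreal ((g x)\<^sup>2) \<partial>M)"
proof -
  have "ennreal \<bar>\<integral>x. f x * g x \<partial>M\<bar> \<le> (\<integral>\<^sup>+x. ennreal \<bar>f x\<bar> * ennreal \<bar>g x\<bar> \<partial>M)"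
  proof (cases "integrable M (\<lambda>x. f x * g x)")
    case True
    from integral_norm_bound_ennreal[OF this] show ?thesis by (simp add: abs_mult ennreal_mult)
  qed (simp add: not_integrable_integral_eq)
  then have "(ennreal \<bar>\<integral>x. f x * g x \<partial>M\<bar>)\<^sup>2 \<le> (\<integral>\<^sup>+x. ennreal \<bar>f x\<bar> * ennreal \<bar>g x\<bar> \<partial>M)\<^sup>2"
    by (intro power_mono) auto
  also have "\<dots> \<le> (\<integral>\<^sup>+x. (ennreal \<bar>f x\<bar>)\<^sup>2 \<partial>M) * (\<integral>\<^sup>+x. (ennreal \<bar>g x\<bar>)\<^sup>2 \<partial>M)"
    by (rule Cauchy_Schwarz_nn_integral) auto
  finally show ?thesis by (simp add: ennreal_power)
qed

text \<open>Continuity of the L2 pairing by Cauchy-Schwarz. Since L2 convergence is given through an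
  \<open>ennreal\<close> integral of squares, the limit is first shown for the square of the
  difference and then a root is taken.\<close>

lemma integral_mult_tendsto_L2:
  fixes f :: "'a \<Rightarrow> real" and g :: "nat \<Rightarrow> 'a \<Rightarrow> real"
  assumes [measurable]: "f \<in> borel_measurable M" "\<And>k. g k \<in> borel_measurable M" "h \<in> borel_measurable M"
    and f: "integrable M (\<lambda>x. (f x)\<^sup>2)"
    and g: "\<And>k. integrable M (\<lambda>x. f x * g k x)" and h: "integrable M (\<lambda>x. f x * h x)"
    and lim: "(\<lambda>k. \<integral>\<^sup>+x. ennreal ((g k x - h x)\<^sup>2) \<partial>M) \<longlonglongrightarrow> 0"
  shows "(\<lambda>k. \<integral>x. f x * g k x \<partial>M) \<longlonglongrightarrow> (\<integral>x. f x * h x \<partial>M)"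
proof -
  let ?d = "\<lambda>k. (\<integral>x. f x * g k x \<partial>M) - (\<integral>x. f x * h x \<partial>M)"
  have d: "?d k = (\<integral>x. f x * (g k x - h x) \<partial>M)" for k
    using g h by (simp add: right_diff_distrib)
  have "(\<integral>\<^sup>+x. ennreal ((f x)\<^sup>2) \<partial>M) < \<infinity>"
    using f by (simp add: integrable_iff_bounded)
  then have "(\<lambda>k. (\<integral>\<^sup>+x. ennreal ((f x)\<^sup>2) \<partial>M) * (\<integral>\<^sup>+x. ennreal ((g k x - h x)\<^sup>2) \<partial>M))
      \<longlonglongrightarrow> (\<integral>\<^sup>+x. ennreal ((f x)\<^sup>2) \<partial>M) * 0"
    by (intro ennreal_tendsto_cmult lim) (auto simp: less_top)
  then have "(\<lambda>k. (\<integral>\<^sup>+x. ennreal ((f x)\<^sup>2) \<partial>M) * (\<integral>\<^sup>+x. ennreal ((g k x - h x)\<^sup>2) \<partial>M)) \<longlonglongrightarrow> 0" by simp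
  then have "(\<lambda>k. ennreal ((?d k)\<^sup>2)) \<longlonglongrightarrow> 0"
    by (rule tendsto_sandwich[rotated -1])
       (use abs_integral_mult_square_le[of f M] in \<open>auto simp: d\<close>)
  then have "(\<lambda>k. (?d k)\<^sup>2) \<longlonglongrightarrow> 0"
    by (subst (asm) ennreal_tendsto_0_iff) auto
  then have "(\<lambda>k. sqrt ((?d k)\<^sup>2)) \<longlonglongrightarrow> sqrt 0"
    by (rule tendsto_real_sqrt)
  then have "?d \<longlonglongrightarrow> 0"
    by (simp only: real_sqrt_abs real_sqrt_zero) (rule tendsto_rabs_zero_cancel)
  then show ?thesis by (rule LIM_zero_cancel)
qed

lemma AE_obtain_null:
  assumes "AE x in M. P x"
  obtains A where "A \<in> null_sets M" "\<And>x. x \<in> space M \<Longrightarrow> x \<notin> A \<Longrightarrow> P x"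
  using assms by (auto simp: eventually_ae_filter)

section \<open>Exponential martingales and simple integrals\<close>

context continuous_brownian_motion
begin

text \<open>The stochastic exponential of p W. With p = - lam it is the density of the risk-neutral
  measure on finite horizons; with p = lam / \<gamma> it drives the optimal wealth.\<close>

definition exp_mart :: "real \<Rightarrow> real \<Rightarrow> 'a \<Rightarrow> real" where
  "exp_mart p t \<omega> = exp (p * W t \<omega> - p\<^sup>2 * t / 2)"

lemma exp_mart_pos: "0 < exp_mart p t \<omega>"
  by (simp add: exp_mart_def)

lemma exp_mart_measurable_F: "0 \<le> t \<Longrightarrow> exp_mart p t \<in> borel_measurable (F t)"
  unfolding exp_mart_def[abs_def] using W_measurable_F[of t] by measurable

lemma exp_mart_measurable [measurable]: "0 \<le> t \<Longrightarrow> exp_mart p t \<in> borel_measurable M"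
  using exp_mart_measurable_F measurable_F_imp_M by blast

text \<open>The value at t is an \<open>F s\<close>-measurable factor times a function of the
  increment, the product form that the factorization of expectations asks for.\<close>

lemma exp_mart_split:
  "exp_mart p t \<omega> = exp_mart p s \<omega> * (exp (p * (W t \<omega> - W s \<omega>)) * exp (- p\<^sup>2 * (t - s) / 2))"
proof -
  have "p * W t \<omega> - p\<^sup>2 * t / 2
      = (p * W s \<omega> - p\<^sup>2 * s / 2) + (p * (W t \<omega> - W s \<omega>) + - p\<^sup>2 * (t - s) / 2)"
    by (simp add: algebra_simps diff_divide_distrib)
  then show ?thesis unfolding exp_mart_def by (simp only: exp_add)
qed

lemma increment_exp_mart_integral:
  assumes "0 \<le> s" "s \<le> t"
  shows "has_bochner_integral M
    (\<lambda>\<omega>. exp (p * (W t \<omega> - W s \<omega>)) * exp (- p\<^sup>2 * (t - s) / 2)) 1"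
proof -
  have "has_bochner_integral M (\<lambda>\<omega>. exp (p * (W t \<omega> - W s \<omega>)) * exp (- p\<^sup>2 * (t - s) / 2))
     (exp (p\<^sup>2 * (t - s) / 2) * exp (- p\<^sup>2 * (t - s) / 2))"
    by (intro has_bochner_integral_mult_left increment_exp_moment assms)
  moreover have "exp (p\<^sup>2 * (t - s) / 2) * exp (- p\<^sup>2 * (t - s) / 2) = 1"
    by (simp flip: exp_add)
  ultimately show ?thesis by simp
qed

text \<open>The power q is an arbitrary real number because the duality bound uses the fractional
  power (\<gamma> - 1) / \<gamma>, the optimal strategy the negative power 1 - \<gamma>, and the L2
  estimates the powers 2 and 4.\<close>

lemma exp_mart_moment:
  assumes "0 \<le> t"
  shows "has_bochner_integral M (\<lambda>\<omega>. exp (q * (p * W t \<omega> - p\<^sup>2 * t / 2))) (exp ((q\<^sup>2 - q) * p\<^sup>2 * t / 2))"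
proof -
  have "has_bochner_integral M (\<lambda>\<omega>. exp ((q * p) * (W t \<omega> - W 0 \<omega>)) * exp (- q * p\<^sup>2 * t / 2))
      (exp ((q * p)\<^sup>2 * (t - 0) / 2) * exp (- q * p\<^sup>2 * t / 2))"
    by (intro has_bochner_integral_mult_left increment_exp_moment) (auto simp: assms)
  moreover have "exp ((q * p) * (W t \<omega> - W 0 \<omega>)) * exp (- q * p\<^sup>2 * t / 2)
      = exp (q * (p * W t \<omega> - p\<^sup>2 * t / 2))" for \<omega>
    by (simp add: W_zero algebra_simps flip: exp_add)
  moreover have "exp ((q * p)\<^sup>2 * (t - 0) / 2) * exp (- q * p\<^sup>2 * t / 2) = exp ((q\<^sup>2 - q) * p\<^sup>2 * t / 2)"
    by (simp add: algebra_simps power2_eq_square diff_divide_distrib flip: exp_add)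
  ultimately show ?thesis by simp
qed

lemma exp_mart_power_moment:
  assumes "0 \<le> t"
  shows "has_bochner_integral M (\<lambda>\<omega>. exp_mart p t \<omega> ^ m) (exp (((real m)\<^sup>2 - real m) * p\<^sup>2 * t / 2))"
  using exp_mart_moment[OF assms, of "real m" p]
  by (simp add: exp_mart_def exp_of_nat_mult)

text \<open>The martingale property tested against an \<open>F s\<close>-measurable factor: the
  ratio of the weights at t and s is a function of the increment with mean 1.\<close>

lemma exp_mart_integral:
  assumes st: "0 \<le> s" "s \<le> t"
    and \<xi>: "\<xi> \<in> borel_measurable (F s)" "has_bochner_integral M (\<lambda>\<omega>. \<xi> \<omega> * exp_mart p s \<omega>) a"
  shows "has_bochner_integral M (\<lambda>\<omega>. \<xi> \<omega> * exp_mart p t \<omega>) a"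
proof -
  have [measurable]: "(\<lambda>\<omega>. \<xi> \<omega> * exp_mart p s \<omega>) \<in> borel_measurable (F s)"
    using \<xi>(1) exp_mart_measurable_F[OF st(1)] by measurable
  have "has_bochner_integral M
      (\<lambda>\<omega>. (\<xi> \<omega> * exp_mart p s \<omega>) *
        (\<lambda>w. exp (p * w) * exp (- p\<^sup>2 * (t - s) / 2)) (W t \<omega> - W s \<omega>)) (a * 1)"
    by (rule has_bochner_integral_increment_mult[OF st])
       (use \<xi>(2) increment_exp_mart_integral[OF st] in auto)
  moreover have "(\<xi> \<omega> * exp_mart p s \<omega>) * (\<lambda>w. exp (p * w) * exp (- p\<^sup>2 * (t - s) / 2)) (W t \<omega> - W s \<omega>)
      = \<xi> \<omega> * exp_mart p t \<omega>" for \<omega>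
    unfolding exp_mart_split[of p t \<omega> s] by (simp only: mult.assoc)
  ultimately show ?thesis by (simp only: mult_1_right)
qed

text \<open>The same shift of the weight for a nonnegative factor without any integrability; it
  later exchanges the weight at time s for the one at T.\<close>

lemma exp_mart_nn_integral:
  assumes st: "0 \<le> s" "s \<le> t"
    and \<xi>: "\<xi> \<in> borel_measurable (F s)"
  shows "(\<integral>\<^sup>+\<omega>. \<xi> \<omega> * ennreal (exp_mart p t \<omega>) \<partial>M) = (\<integral>\<^sup>+\<omega>. \<xi> \<omega> * ennreal (exp_mart p s \<omega>) \<partial>M)"
proof -
  let ?\<phi> = "\<lambda>w. ennreal (exp (p * w) * exp (- p\<^sup>2 * (t - s) / 2))"
  have [measurable]: "(\<lambda>\<omega>. \<xi> \<omega> * ennreal (exp_mart p s \<omega>)) \<in> borel_measurable (F s)"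
    using \<xi> exp_mart_measurable_F[OF st(1)] by measurable
  have "(\<integral>\<^sup>+\<omega>. (\<xi> \<omega> * ennreal (exp_mart p s \<omega>)) * ?\<phi> (W t \<omega> - W s \<omega>) \<partial>M)
     = (\<integral>\<^sup>+\<omega>. \<xi> \<omega> * ennreal (exp_mart p s \<omega>) \<partial>M) * (\<integral>\<^sup>+\<omega>. ?\<phi> (W t \<omega> - W s \<omega>) \<partial>M)"
    by (rule nn_integral_increment_mult[OF st]) auto
  also have "(\<integral>\<^sup>+\<omega>. ?\<phi> (W t \<omega> - W s \<omega>) \<partial>M) = 1"
    using increment_exp_mart_integral[OF st, of p]
    by (subst nn_integral_eq_integral) (auto simp: has_bochner_integral_iff)
  also have "(\<lambda>\<omega>. (\<xi> \<omega> * ennreal (exp_mart p s \<omega>)) * ?\<phi> (W t \<omega> - W s \<omega>))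
      = (\<lambda>\<omega>. \<xi> \<omega> * ennreal (exp_mart p t \<omega>))"
  proof
    fix \<omega>
    show "(\<xi> \<omega> * ennreal (exp_mart p s \<omega>)) * ?\<phi> (W t \<omega> - W s \<omega>) = \<xi> \<omega> * ennreal (exp_mart p t \<omega>)"
      unfolding exp_mart_split[of p t \<omega> s]
      by (subst (2) ennreal_mult) (auto intro: less_imp_le[OF exp_mart_pos] simp: mult.assoc)
  qed
  finally show ?thesis by simp
qed

lemma exp_mart_jointly_measurable:
  "(\<lambda>z. exp_mart p (max 0 (snd z)) (fst z)) \<in> borel_measurable (M \<Otimes>\<^sub>M lborel)"
proof (rule continuous_process_jointly_measurable[where X="\<lambda>t. exp_mart p (max 0 t)"])
  fix \<omega>
  have "continuous_on UNIV (\<lambda>t. W (max 0 t) \<omega>)"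
    by (rule continuous_on_compose2[OF W_continuous[of \<omega>]]) (auto intro!: continuous_intros)
  then show "continuous_on UNIV (\<lambda>t. exp_mart p (max 0 t) \<omega>)"
    unfolding exp_mart_def by (intro continuous_intros) auto
qed auto

text \<open>Girsanov's theorem at the level of one increment: under the weight, W has drift - lam,
  which the added term lam (v - u) compensates.\<close>

lemma exp_mart_tilted_increment:
  assumes uv: "0 \<le> u" "u \<le> v" "v \<le> T"
    and \<xi>: "\<xi> \<in> borel_measurable (F u)" "\<And>\<omega>. \<omega> \<in> space M \<Longrightarrow> \<bar>\<xi> \<omega>\<bar> \<le> B"
  shows "has_bochner_integral M
    (\<lambda>\<omega>. exp_mart (- lam) T \<omega> * (\<xi> \<omega> * (W v \<omega> - W u \<omega> + lam * (v - u)))) 0"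
proof -
  let ?h = "v - u"
  \<comment> \<open>This is w + lam h multiplied by the ratio of the weights at v and u, so that
    only a function of the increment is left beside an \<open>F u\<close>-measurable factor.\<close>
  let ?\<phi> = "\<lambda>w. exp (- lam * w) * w * exp (- lam\<^sup>2 * ?h / 2) + lam * ?h * (exp (- lam * w) * exp (- lam\<^sup>2 * ?h / 2))"
  have [measurable]: "\<xi> \<in> borel_measurable M" using \<xi>(1) uv measurable_F_imp_M by auto
  have "has_bochner_integral M (\<lambda>\<omega>. ?\<phi> (W v \<omega> - W u \<omega>))
     (- lam * ?h * exp ((- lam)\<^sup>2 * ?h / 2) * exp (- lam\<^sup>2 * ?h / 2) + lam * ?h * 1)"
    using increment_exp_mart_integral[OF uv(1,2), of "- lam"]
    by (intro has_bochner_integral_add has_bochner_integral_mult_left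
        has_bochner_integral_mult_right increment_exp_first_moment uv) auto
  moreover have "- lam * ?h * exp ((- lam)\<^sup>2 * ?h / 2) * exp (- lam\<^sup>2 * ?h / 2) + lam * ?h * 1 = 0"
    by (simp add: mult.assoc flip: exp_add)
  ultimately have \<phi>: "has_bochner_integral M (\<lambda>\<omega>. ?\<phi> (W v \<omega> - W u \<omega>)) 0" by (simp only:)
  have int: "integrable M (\<lambda>\<omega>. \<xi> \<omega> * exp_mart (- lam) u \<omega>)"
  proof (rule Bochner_Integration.integrable_bound)
    show "integrable M (\<lambda>\<omega>. B * exp_mart (- lam) u \<omega>)"
      using exp_mart_power_moment[OF uv(1), of "- lam" 1] by (auto simp: has_bochner_integral_iff)
    show "AE \<omega> in M. norm (\<xi> \<omega> * exp_mart (- lam) u \<omega>) \<le> norm (B * exp_mart (- lam) u \<omega>)"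
    proof (rule AE_I2)
      fix \<omega> assume "\<omega> \<in> space M"
      from \<xi>(2)[OF this] have "\<bar>\<xi> \<omega>\<bar> \<le> \<bar>B\<bar>" by linarith
      then show "norm (\<xi> \<omega> * exp_mart (- lam) u \<omega>) \<le> norm (B * exp_mart (- lam) u \<omega>)"
        by (auto simp: abs_mult intro: mult_right_mono)
    qed
  qed (use uv in auto)
  have \<xi>u: "(\<lambda>\<omega>. \<xi> \<omega> * exp_mart (- lam) u \<omega>) \<in> borel_measurable (F u)"
    using \<xi>(1) exp_mart_measurable_F[OF uv(1)] by measurable
  have "has_bochner_integral M (\<lambda>\<omega>. (\<xi> \<omega> * exp_mart (- lam) u \<omega>) * ?\<phi> (W v \<omega> - W u \<omega>))
      ((\<integral>\<omega>. \<xi> \<omega> * exp_mart (- lam) u \<omega> \<partial>M) * 0)"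
    by (rule has_bochner_integral_increment_mult[OF uv(1,2) \<xi>u _ _ \<phi>])
       (use int in \<open>auto simp: has_bochner_integral_iff\<close>)
  moreover have "(\<xi> \<omega> * exp_mart (- lam) u \<omega>) * ?\<phi> (W v \<omega> - W u \<omega>)
      = \<xi> \<omega> * (W v \<omega> - W u \<omega> + lam * ?h) * exp_mart (- lam) v \<omega>" for \<omega>
    unfolding exp_mart_split[of "- lam" v \<omega> u] by (simp add: algebra_simps)
  ultimately have *: "has_bochner_integral M
      (\<lambda>\<omega>. \<xi> \<omega> * (W v \<omega> - W u \<omega> + lam * ?h) * exp_mart (- lam) v \<omega>) 0"
    by (simp only: mult_zero_right)
  have "\<xi> \<in> borel_measurable (F v)" "W v \<in> borel_measurable (F v)" "W u \<in> borel_measurable (F v)"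
    using measurable_F_mono[OF \<xi>(1)] measurable_F_mono[OF W_measurable_F[of u]] W_measurable_F[of v] uv
    by auto
  then have "(\<lambda>\<omega>. \<xi> \<omega> * (W v \<omega> - W u \<omega> + lam * ?h)) \<in> borel_measurable (F v)" by measurable
  \<comment> \<open>Everything beside the weight is known at time v, so the weight can be moved from
    v to T.\<close>
  from exp_mart_integral[OF _ uv(3) this *] uv show ?thesis by (simp add: mult.commute)
qed

end

section \<open>Simple integrands: time integrals, squares, second moments\<close>

lemma simple_integrand_times:
  assumes "simple_integrand M F (n, \<tau>, \<xi>)" "i \<le> j" "j \<le> n"
  shows "0 \<le> \<tau> i" "\<tau> i \<le> \<tau> j"
proof -
  have step: "\<tau> k \<le> \<tau> (Suc k)" if "k < n" for k
    using assms(1) that by (auto simp: simple_integrand_def less_imp_le)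
  show "\<tau> i \<le> \<tau> j" by (rule partition_mono[of n \<tau>, OF step assms(2,3)])
  have "0 \<le> \<tau> 0" using assms(1) by (auto simp: simple_integrand_def)
  also have "\<tau> 0 \<le> \<tau> i" by (rule partition_mono[of n \<tau>, OF step]) (use assms(2,3) in simp_all)
  finally show "0 \<le> \<tau> i" .
qed

lemma simple_integrandD:
  assumes "simple_integrand M F (n, \<tau>, \<xi>)" "i < n"
  shows "0 \<le> \<tau> i" "\<tau> i < \<tau> (Suc i)" "\<xi> i \<in> borel_measurable (F (\<tau> i))"
    "\<exists>B. \<forall>\<omega>\<in>space M. \<bar>\<xi> i \<omega>\<bar> \<le> B"
  using simple_integrand_times[OF assms(1), of i i] assms by (auto simp: simple_integrand_def)

text \<open>Restricting to [0,t] replaces each partition point by its minimum with t, the same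
  truncation as in \<open>simple_integral\<close>; this makes the stochastic and the time integral
  match term by term.\<close>

lemma has_bochner_integral_simple_process:
  assumes S: "simple_integrand M F (n, \<tau>, \<xi>)" and t: "0 \<le> t"
  shows "has_bochner_integral lborel (\<lambda>s. indicator {0..t} s * simple_process (n, \<tau>, \<xi>) s \<omega>)
    (\<Sum>i<n. \<xi> i \<omega> * (min t (\<tau> (Suc i)) - min t (\<tau> i)))"
proof -
  have "has_bochner_integral lborel (\<lambda>s. \<xi> i \<omega> * indicator {min t (\<tau> i)<..min t (\<tau> (Suc i))} s)
      (\<xi> i \<omega> * (min t (\<tau> (Suc i)) - min t (\<tau> i)))" if "i < n" for i
    using simple_integrandD[OF S that]
    by (intro has_bochner_integral_mult_right) (auto simp: has_bochner_integral_iff measure_def)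
  then have "has_bochner_integral lborel
      (\<lambda>s. \<Sum>i<n. \<xi> i \<omega> * indicator {min t (\<tau> i)<..min t (\<tau> (Suc i))} s)
      (\<Sum>i<n. \<xi> i \<omega> * (min t (\<tau> (Suc i)) - min t (\<tau> i)))"
    by (intro has_bochner_integral_sum) auto
  moreover have "(\<Sum>i<n. \<xi> i \<omega> * indicator {min t (\<tau> i)<..min t (\<tau> (Suc i))} s)
      = indicator {0..t} s * simple_process (n, \<tau>, \<xi>) s \<omega>" for s
  proof -
    have "indicator {min t (\<tau> i)<..min t (\<tau> (Suc i))} s
        = (indicator {0..t} s * indicator {\<tau> i<..\<tau> (Suc i)} s :: real)" if "i < n" for i
      using simple_integrandD[OF S that] by (auto simp: indicator_def)
    then have "(\<Sum>i<n. \<xi> i \<omega> * indicator {min t (\<tau> i)<..min t (\<tau> (Suc i))} s)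
        = (\<Sum>i<n. indicator {0..t} s * (\<xi> i \<omega> * indicator {\<tau> i<..\<tau> (Suc i)} s))"
      by (intro sum.cong) auto
    then show ?thesis
      by (simp only: simple_process_def sum_distrib_left prod.case)
  qed
  ultimately show ?thesis by simp
qed

text \<open>At most one summand is nonzero at any time, so squaring acts on the coefficients. The
  square is thus again of simple form and its time integral is known.\<close>

lemma simple_process_square:
  assumes S: "simple_integrand M F (n, \<tau>, \<xi>)"
  shows "(simple_process (n, \<tau>, \<xi>) s \<omega>)\<^sup>2 = simple_process (n, \<tau>, \<lambda>i \<omega>. (\<xi> i \<omega>)\<^sup>2) s \<omega>"
proof (cases "\<exists>i<n. s \<in> {\<tau> i<..\<tau> (Suc i)}")
  case True
  then obtain i where i: "i < n" "s \<in> {\<tau> i<..\<tau> (Suc i)}" by auto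
  have "(\<Sum>j<n. f j * indicator {\<tau> j<..\<tau> (Suc j)} s) = f i" for f :: "nat \<Rightarrow> real"
    by (rule partition_sum_indicator[OF less_imp_le[OF simple_integrandD(2)[OF S]] i])
  then show ?thesis unfolding simple_process_def by simp
next
  case False
  then have "(\<Sum>i<n. \<xi>' i * indicator {\<tau> i<..\<tau> (Suc i)} s) = 0" for \<xi>' :: "nat \<Rightarrow> real"
    by (intro sum.neutral) (auto simp: indicator_def)
  then show ?thesis unfolding simple_process_def by simp
qed

context continuous_brownian_motion
begin

lemma simple_integral_measurable:
  assumes S: "simple_integrand M F (n, \<tau>, \<xi>)" and t: "0 \<le> t"
  shows "simple_integral W (n, \<tau>, \<xi>) t \<in> borel_measurable M"
proof -
  have "(\<lambda>\<omega>. \<Sum>i<n. \<xi> i \<omega> * (W (min t (\<tau> (Suc i))) \<omega> - W (min t (\<tau> i)) \<omega>)) \<in> borel_measurable M"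
  proof (intro borel_measurable_sum borel_measurable_times borel_measurable_diff W_measurable)
    fix i assume "i \<in> {..<n}"
    then have i: "0 \<le> \<tau> i" "\<tau> i < \<tau> (Suc i)" "\<xi> i \<in> borel_measurable (F (\<tau> i))"
      using simple_integrandD[OF S, of i] by auto
    then show "\<xi> i \<in> borel_measurable M" "0 \<le> min t (\<tau> (Suc i))" "0 \<le> min t (\<tau> i)"
      using measurable_F_imp_M t by auto
  qed
  then show ?thesis by (simp add: simple_integral_def[abs_def])
qed

text \<open>The tilted increments are summed over the partition stopped at t. The weight may sit at
  any later time T.\<close>

lemma simple_integral_tilted:
  assumes S: "simple_integrand M F (n, \<tau>, \<xi>)" and t: "0 \<le> t" "t \<le> T"
  shows "has_bochner_integral M (\<lambda>\<omega>. exp_mart (- lam) T \<omega> *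
    (simple_integral W (n, \<tau>, \<xi>) t \<omega> + lam * (LINT s:{0..t}|lborel. simple_process (n, \<tau>, \<xi>) s \<omega>))) 0"
proof -
  let ?u = "\<lambda>i. min t (\<tau> i)"
  have step: "has_bochner_integral M (\<lambda>\<omega>. exp_mart (- lam) T \<omega> *
      (\<xi> i \<omega> * (W (?u (Suc i)) \<omega> - W (?u i) \<omega> + lam * (?u (Suc i) - ?u i)))) 0" if i: "i < n" for i
  proof (cases "\<tau> i \<le> t")
    case True
    note D = simple_integrandD[OF S i]
    obtain B where "\<And>\<omega>. \<omega> \<in> space M \<Longrightarrow> \<bar>\<xi> i \<omega>\<bar> \<le> B" using D(4) by auto
    moreover have "?u i = \<tau> i" using True by simp
    ultimately show ?thesis
      using D t by (intro exp_mart_tilted_increment) auto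
  next
    \<comment> \<open>An interval that starts after t collapses to the point t. It has to be treated
      apart because its coefficient need not be \<open>F t\<close>-measurable.\<close>
    case False
    then have "?u i = t" "?u (Suc i) = t" using simple_integrandD[OF S i] by auto
    then show ?thesis by (simp add: has_bochner_integral_zero)
  qed
  have "has_bochner_integral M (\<lambda>\<omega>. \<Sum>i<n. exp_mart (- lam) T \<omega> *
      (\<xi> i \<omega> * (W (?u (Suc i)) \<omega> - W (?u i) \<omega> + lam * (?u (Suc i) - ?u i)))) (\<Sum>i<n. 0)"
    using step by (intro has_bochner_integral_sum) auto
  moreover have "(LINT s:{0..t}|lborel. simple_process (n, \<tau>, \<xi>) s \<omega>) = (\<Sum>i<n. \<xi> i \<omega> * (?u (Suc i) - ?u i))" for \<omega>
    using has_bochner_integral_simple_process[OF S t(1), of \<omega>]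
    by (simp add: set_lebesgue_integral_def has_bochner_integral_iff)
  moreover have "(\<Sum>i<n. exp_mart (- lam) T \<omega> *
      (\<xi> i \<omega> * (W (?u (Suc i)) \<omega> - W (?u i) \<omega> + lam * (?u (Suc i) - ?u i))))
    = exp_mart (- lam) T \<omega> * (simple_integral W (n, \<tau>, \<xi>) t \<omega> + lam * (\<Sum>i<n. \<xi> i \<omega> * (?u (Suc i) - ?u i)))" for \<omega>
    by (simp add: simple_integral_def sum_distrib_left sum.distrib[symmetric] distrib_left mult.left_commute)
  ultimately show ?thesis by simp
qed

text \<open>The part of the Ito isometry that is needed: distinct increments are orthogonal and each
  has its length as second moment. The right-hand side is taken up to T so that it does not depend
  on t.\<close>

lemma simple_integral_second_moment_le:
  assumes S: "simple_integrand M F (n, \<tau>, \<xi>)" and t: "0 \<le> t" "t \<le> T"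
  shows "(\<integral>\<^sup>+\<omega>. ennreal ((simple_integral W (n, \<tau>, \<xi>) t \<omega>)\<^sup>2) \<partial>M)
    \<le> (\<integral>\<^sup>+\<omega>. (\<integral>\<^sup>+s\<in>{0..T}. ennreal ((simple_process (n, \<tau>, \<xi>) s \<omega>)\<^sup>2) \<partial>lborel) \<partial>M)"
proof -
  let ?u = "\<lambda>i. min t (\<tau> i)"
  let ?D = "\<lambda>i \<omega>. \<xi> i \<omega> * (W (?u (Suc i)) \<omega> - W (?u i) \<omega>)"
  let ?d = "\<lambda>i. (\<integral>\<omega>. (\<xi> i \<omega>)\<^sup>2 \<partial>M) * (?u (Suc i) - ?u i)"
  have u: "0 \<le> ?u i" "?u i \<le> ?u (Suc i)" if "i < n" for i
    using simple_integrandD[OF S that] t by auto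
  have \<xi>M: "\<xi> i \<in> borel_measurable M" if "i < n" for i
    using simple_integrandD[OF S that] measurable_F_imp_M by auto
  have \<xi>int: "integrable M (\<lambda>\<omega>. (\<xi> i \<omega>)\<^sup>2)" if i: "i < n" for i
  proof -
    obtain B where B: "\<And>\<omega>. \<omega> \<in> space M \<Longrightarrow> \<bar>\<xi> i \<omega>\<bar> \<le> B" using simple_integrandD[OF S i] by auto
    have "(\<xi> i \<omega>)\<^sup>2 \<le> B\<^sup>2" if "\<omega> \<in> space M" for \<omega>
      using power_mono[OF B[OF that], of 2] by simp
    then show ?thesis
      using \<xi>M[OF i] by (intro integrable_const_bound[where B="B\<^sup>2"]) auto
  qed
  have sq: "has_bochner_integral M (\<lambda>\<omega>. (?D i \<omega>)\<^sup>2) (?d i)" if i: "i < n" for i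
  proof (cases "\<tau> i \<le> t")
    case True
    then have ui: "?u i = \<tau> i" by simp
    have "has_bochner_integral M (\<lambda>\<omega>. (\<xi> i \<omega>)\<^sup>2 * (\<lambda>w. w\<^sup>2) (W (?u (Suc i)) \<omega> - W (?u i) \<omega>)) (?d i)"
    proof (rule has_bochner_integral_increment_mult)
      show "(\<lambda>\<omega>. (\<xi> i \<omega>)\<^sup>2) \<in> borel_measurable (F (?u i))"
        unfolding ui using simple_integrandD(3)[OF S i] by measurable
    qed (use u[OF i] \<xi>int[OF i] increment_second_moment in \<open>auto simp: has_bochner_integral_iff\<close>)
    then show ?thesis by (simp add: power_mult_distrib)
  next
    case False
    then have "?u i = t" "?u (Suc i) = t" using simple_integrandD[OF S i] by auto
    then show ?thesis by (simp add: has_bochner_integral_zero)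
  qed
  have "has_bochner_integral M (\<lambda>\<omega>. (\<Sum>i<n. ?D i \<omega>)\<^sup>2) (\<Sum>i<n. ?d i)"
  proof (rule has_bochner_integral_sum_orthogonal_square[OF _ sq])
    show DM: "?D i \<in> borel_measurable M" if "i < n" for i
      using u[OF that] \<xi>M[OF that] by (auto intro!: borel_measurable_times increment_measurable)
    fix i j assume ij: "i < j" "j < n"
    \<comment> \<open>The later increment has mean 0 and is independent of everything known at the
      start of its interval, which includes the whole earlier summand.\<close>
    show "(\<integral>\<omega>. ?D i \<omega> * ?D j \<omega> \<partial>M) = 0"
    proof (cases "\<tau> j \<le> t")
      case True
      have le: "\<tau> (Suc i) \<le> \<tau> j" using simple_integrand_times(2)[OF S, of "Suc i" j] ij by auto
      note Di = simple_integrandD[OF S, of i] and Dj = simple_integrandD[OF S, of j]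
      have ui: "?u i = \<tau> i" "?u (Suc i) = \<tau> (Suc i)" "?u j = \<tau> j" using True le Di ij by auto
      have m: "(\<lambda>\<omega>. ?D i \<omega> * \<xi> j \<omega>) \<in> borel_measurable (F (\<tau> j))"
      proof -
        have "\<xi> i \<in> borel_measurable (F (\<tau> j))" "W (\<tau> (Suc i)) \<in> borel_measurable (F (\<tau> j))"
            "W (\<tau> i) \<in> borel_measurable (F (\<tau> j))" "\<xi> j \<in> borel_measurable (F (\<tau> j))"
          using Di Dj ij le measurable_F_mono[of _ "\<tau> i" "\<tau> j"]
            measurable_F_mono[of _ "\<tau> (Suc i)" "\<tau> j"] W_measurable_F[of "\<tau> i"] W_measurable_F[of "\<tau> (Suc i)"]
          by auto
        then show ?thesis unfolding ui by measurable
      qed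
      have "integrable M (\<lambda>\<omega>. ?D i \<omega> * \<xi> j \<omega>)"
        using DM[of i] \<xi>M[of j] sq[of i] \<xi>int[of j] ij
        by (intro integrable_mult_of_squares) (auto simp: has_bochner_integral_iff)
      then have "has_bochner_integral M (\<lambda>\<omega>. ?D i \<omega> * \<xi> j \<omega> * (\<lambda>w. w) (W (?u (Suc j)) \<omega> - W (?u j) \<omega>))
          ((\<integral>\<omega>. ?D i \<omega> * \<xi> j \<omega> \<partial>M) * 0)"
        using increment_exp_first_moment[OF u, of j 0] m ui(3) u[OF ij(2)] ij
        by (intro has_bochner_integral_increment_mult) (auto simp: has_bochner_integral_iff)
      then show ?thesis by (simp add: has_bochner_integral_iff mult.assoc)
    next
      case False
      then have "?u j = t" "?u (Suc j) = t" using simple_integrandD[OF S ij(2)] by auto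
      then show ?thesis by simp
    qed
  qed
  then have "(\<integral>\<^sup>+\<omega>. ennreal ((\<Sum>i<n. ?D i \<omega>)\<^sup>2) \<partial>M) = ennreal (\<Sum>i<n. ?d i)"
    by (subst nn_integral_eq_integral) (auto simp: has_bochner_integral_iff)
  also have "\<dots> = (\<integral>\<^sup>+\<omega>. ennreal (\<Sum>i<n. (\<xi> i \<omega>)\<^sup>2 * (?u (Suc i) - ?u i)) \<partial>M)"
  proof -
    have "has_bochner_integral M (\<lambda>\<omega>. \<Sum>i<n. (\<xi> i \<omega>)\<^sup>2 * (?u (Suc i) - ?u i)) (\<Sum>i<n. ?d i)"
      using \<xi>int by (intro has_bochner_integral_sum has_bochner_integral_mult_left)
        (auto simp: has_bochner_integral_iff)
    then show ?thesis
      using u by (subst nn_integral_eq_integral) (auto simp: has_bochner_integral_iff intro!: sum_nonneg)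
  qed
  also have "\<dots> \<le> (\<integral>\<^sup>+\<omega>. (\<integral>\<^sup>+s\<in>{0..T}. ennreal ((simple_process (n, \<tau>, \<xi>) s \<omega>)\<^sup>2) \<partial>lborel) \<partial>M)"
  proof (rule nn_integral_mono)
    fix \<omega>
    let ?q = "\<lambda>s. indicator {0..t} s * (simple_process (n, \<tau>, \<xi>) s \<omega>)\<^sup>2"
    \<comment> \<open>With \<open>\<omega>\<close> frozen the squared coefficients are constants,
      hence trivially measurable and bounded, and the time integral of a simple process applies to
      the square.\<close>
    have S': "simple_integrand M F (n, \<tau>, \<lambda>i _. (\<xi> i \<omega>)\<^sup>2)"
      using S by (auto simp: simple_integrand_def)
    have "has_bochner_integral lborel ?q (\<Sum>i<n. (\<xi> i \<omega>)\<^sup>2 * (?u (Suc i) - ?u i))"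
      using has_bochner_integral_simple_process[OF S' t(1), of \<omega>]
      unfolding simple_process_square[OF S] by (simp add: simple_process_def)
    then have "ennreal (\<Sum>i<n. (\<xi> i \<omega>)\<^sup>2 * (?u (Suc i) - ?u i)) = (\<integral>\<^sup>+s. ennreal (?q s) \<partial>lborel)"
      by (subst nn_integral_eq_integral) (auto simp: has_bochner_integral_iff)
    also have "\<dots> \<le> (\<integral>\<^sup>+s\<in>{0..T}. ennreal ((simple_process (n, \<tau>, \<xi>) s \<omega>)\<^sup>2) \<partial>lborel)"
      using t by (intro nn_integral_mono) (auto simp: indicator_def)
    finally show "ennreal (\<Sum>i<n. (\<xi> i \<omega>)\<^sup>2 * (?u (Suc i) - ?u i))
      \<le> (\<integral>\<^sup>+s\<in>{0..T}. ennreal ((simple_process (n, \<tau>, \<xi>) s \<omega>)\<^sup>2) \<partial>lborel)" .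
  qed
  finally show ?thesis by (simp add: simple_integral_def)
qed

end

section \<open>Ito integrals under exponential weights\<close>

text \<open>Measurability of a process is only given on \<open>[0,\<infinity>)\<close>; composing with \<open>max 0\<close> extends it to all times.\<close>

lemma measurable_process_max:
  assumes "measurable_process M Z"
  shows "(\<lambda>z. Z (max 0 (snd z)) (fst z)) \<in> borel_measurable (M \<Otimes>\<^sub>M lborel)"
proof -
  have "(\<lambda>z. (fst z, max 0 (snd z))) \<in> M \<Otimes>\<^sub>M lborel \<rightarrow>\<^sub>M M \<Otimes>\<^sub>M restrict_space borel {0 :: real..}"
    by (intro measurable_Pair measurable_restrict_space2) auto
  from measurable_compose[OF this assms[unfolded measurable_process_def]] show ?thesis
    by (simp add: case_prod_beta)
qed

lemma measurable_process_section:
  assumes "measurable_process M Z" "\<omega> \<in> space M"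
  shows "(\<lambda>s. Z (max 0 s) \<omega>) \<in> borel_measurable borel"
  using measurable_compose[OF measurable_Pair1'[OF assms(2)] measurable_process_max[OF assms(1)]] by simp

lemma set_integral_max_0:
  fixes f :: "real \<Rightarrow> real"
  shows "(LINT s:{0..t}|lborel. f s) = (LINT s:{0..t}|lborel. f (max 0 s))"
  unfolding set_lebesgue_integral_def
  by (intro Bochner_Integration.integral_cong) (auto simp: indicator_def)

lemma set_integrable_max_0:
  fixes f :: "real \<Rightarrow> real"
  shows "set_integrable lborel {0..t} f \<longleftrightarrow> set_integrable lborel {0..t} (\<lambda>s. f (max 0 s))"
  unfolding set_integrable_def
  by (intro Bochner_Integration.integrable_cong) (auto simp: indicator_def)

lemma set_nn_integral_max_0:
  fixes f :: "real \<Rightarrow> ennreal"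
  shows "(\<integral>\<^sup>+s\<in>{0..t}. f s \<partial>lborel) = (\<integral>\<^sup>+s\<in>{0..t}. f (max 0 s) \<partial>lborel)"
  by (intro nn_integral_cong) (auto simp: indicator_def)

lemma set_nn_integral_process_measurable:
  assumes "measurable_process M Z" and [measurable]: "f \<in> borel_measurable borel"
  shows "(\<lambda>\<omega>. \<integral>\<^sup>+s\<in>{0..t}. ennreal (f (Z s \<omega>)) \<partial>lborel) \<in> borel_measurable M"
proof -
  note [measurable] = measurable_process_max[OF assms(1)]
  have "(\<lambda>\<omega>. \<integral>\<^sup>+s. ennreal (f (Z (max 0 (snd (\<omega>, s))) (fst (\<omega>, s)))) * indicator {0..t} s \<partial>lborel) \<in> borel_measurable M"
    by measurable
  then show ?thesis by (subst set_nn_integral_max_0) simp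
qed

lemma set_integral_process_measurable:
  assumes "measurable_process M Z"
  shows "(\<lambda>\<omega>. LINT s:{0..t}|lborel. Z s \<omega>) \<in> borel_measurable M"
proof -
  note [measurable] = measurable_process_max[OF assms]
  have "(\<lambda>\<omega>. \<integral>s. indicator {0..t} s *\<^sub>R Z (max 0 (snd (\<omega>, s))) (fst (\<omega>, s)) \<partial>lborel) \<in> borel_measurable M"
    by measurable
  then show ?thesis
    by (subst set_integral_max_0) (simp add: set_lebesgue_integral_def)
qed

lemma set_integrable_of_square:
  fixes f :: "real \<Rightarrow> real"
  assumes [measurable]: "f \<in> borel_measurable borel"
    and "(\<integral>\<^sup>+s\<in>{0..t}. ennreal ((f s)\<^sup>2) \<partial>lborel) < \<infinity>" "0 \<le> t"
  shows "set_integrable lborel {0..t} f"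
proof -
  have "(\<integral>\<^sup>+s\<in>{0..t}. ennreal \<bar>f s\<bar> \<partial>lborel)\<^sup>2 \<le> ennreal t * (\<integral>\<^sup>+s\<in>{0..t}. ennreal ((f s)\<^sup>2) \<partial>lborel)"
    using assms by (intro nn_integral_Icc_square_le) auto
  also have "\<dots> < \<infinity>" using assms by (simp add: ennreal_mult_less_top)
  finally have "(\<integral>\<^sup>+s\<in>{0..t}. ennreal \<bar>f s\<bar> \<partial>lborel) < \<infinity>"
    by (simp add: power_less_top_ennreal)
  also have "(\<integral>\<^sup>+s\<in>{0..t}. ennreal \<bar>f s\<bar> \<partial>lborel) = (\<integral>\<^sup>+s. ennreal (norm (indicator {0..t} s *\<^sub>R f s)) \<partial>lborel)"
    by (intro nn_integral_cong) (auto simp: indicator_def)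
  finally show ?thesis
    unfolding set_integrable_def by (intro integrableI_bounded) auto
qed

lemma ennreal_square_add_le: "ennreal ((a + b)\<^sup>2) \<le> 2 * ennreal (a\<^sup>2) + 2 * ennreal (b\<^sup>2)"
proof -
  have "(a + b)\<^sup>2 \<le> 2 * a\<^sup>2 + 2 * b\<^sup>2"
    using sum_squares_bound[of a b] by (simp add: power2_sum)
  then have "ennreal ((a + b)\<^sup>2) \<le> ennreal (2 * a\<^sup>2 + 2 * b\<^sup>2)" by (rule ennreal_leI)
  then show ?thesis by (simp add: ennreal_plus ennreal_mult)
qed

lemma nn_integral_square_add_le:
  fixes f g :: "'a \<Rightarrow> real"
  assumes [measurable]: "f \<in> borel_measurable M" "g \<in> borel_measurable M"
  shows "(\<integral>\<^sup>+x. ennreal ((f x + g x)\<^sup>2) \<partial>M)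
    \<le> 2 * (\<integral>\<^sup>+x. ennreal ((f x)\<^sup>2) \<partial>M) + 2 * (\<integral>\<^sup>+x. ennreal ((g x)\<^sup>2) \<partial>M)"
proof -
  have "(\<integral>\<^sup>+x. ennreal ((f x + g x)\<^sup>2) \<partial>M) \<le> (\<integral>\<^sup>+x. 2 * ennreal ((f x)\<^sup>2) + 2 * ennreal ((g x)\<^sup>2) \<partial>M)"
    by (intro nn_integral_mono ennreal_square_add_le)
  also have "\<dots> = 2 * (\<integral>\<^sup>+x. ennreal ((f x)\<^sup>2) \<partial>M) + 2 * (\<integral>\<^sup>+x. ennreal ((g x)\<^sup>2) \<partial>M)"
    by (simp add: nn_integral_add nn_integral_cmult)
  finally show ?thesis .
qed

lemma L2_locD:
  assumes "Z \<in> L2_loc M F"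
  shows "measurable_process M Z" "adapted F Z"
    and "0 < R \<Longrightarrow> (\<integral>\<^sup>+\<omega>. (\<integral>\<^sup>+t\<in>{0..R}. ennreal ((Z t \<omega>)\<^sup>2) \<partial>lborel) \<partial>M) < \<infinity>"
  using assms by (auto simp: L2_loc_def)

context continuous_brownian_motion
begin

lemma measurable_process_simple_process:
  assumes "simple_integrand M F S"
  shows "measurable_process M (simple_process S)"
proof (cases S)
  case (fields n \<tau> \<xi>)
  have "\<xi> i \<in> borel_measurable M" if "i < n" for i
    using simple_integrandD[OF assms[unfolded fields] that] measurable_F_imp_M by auto
  then have "(\<lambda>z. \<Sum>i<n. \<xi> i (fst z) * indicator {\<tau> i<..\<tau> (Suc i)} (snd z))
      \<in> borel_measurable (M \<Otimes>\<^sub>M restrict_space borel {0 :: real..})"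
    by (intro borel_measurable_sum borel_measurable_times)
      (auto intro!: measurable_compose[OF measurable_fst] measurable_compose[OF measurable_snd]
        measurable_restrict_space1[of "indicator _" borel])
  then show ?thesis
    unfolding measurable_process_def fields simple_process_def by (simp add: case_prod_beta)
qed

lemma measurable_process_diff:
  assumes "measurable_process M Y" "measurable_process M Z"
  shows "measurable_process M (\<lambda>t \<omega>. Y t \<omega> - Z t \<omega>)"
  using borel_measurable_diff[OF assms[unfolded measurable_process_def]]
  by (simp add: measurable_process_def case_prod_beta)

lemma nn_integral_process_square_add_le:
  assumes "measurable_process M Y" "measurable_process M Z"
  shows "(\<integral>\<^sup>+\<omega>. (\<integral>\<^sup>+s\<in>{0..t}. ennreal ((Y s \<omega> + Z s \<omega>)\<^sup>2) \<partial>lborel) \<partial>M)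
    \<le> 2 * (\<integral>\<^sup>+\<omega>. (\<integral>\<^sup>+s\<in>{0..t}. ennreal ((Y s \<omega>)\<^sup>2) \<partial>lborel) \<partial>M)
      + 2 * (\<integral>\<^sup>+\<omega>. (\<integral>\<^sup>+s\<in>{0..t}. ennreal ((Z s \<omega>)\<^sup>2) \<partial>lborel) \<partial>M)"
proof -
  have "(\<integral>\<^sup>+s\<in>{0..t}. ennreal ((Y s \<omega> + Z s \<omega>)\<^sup>2) \<partial>lborel)
      \<le> 2 * (\<integral>\<^sup>+s\<in>{0..t}. ennreal ((Y s \<omega>)\<^sup>2) \<partial>lborel) + 2 * (\<integral>\<^sup>+s\<in>{0..t}. ennreal ((Z s \<omega>)\<^sup>2) \<partial>lborel)"
    if \<omega>: "\<omega> \<in> space M" for \<omega>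
  proof -
    note [measurable] = measurable_process_section[OF assms(1) \<omega>] measurable_process_section[OF assms(2) \<omega>]
    have "(\<integral>\<^sup>+s. ennreal ((indicator {0..t} s * Y (max 0 s) \<omega> + indicator {0..t} s * Z (max 0 s) \<omega>)\<^sup>2) \<partial>lborel)
        \<le> 2 * (\<integral>\<^sup>+s. ennreal ((indicator {0..t} s * Y (max 0 s) \<omega>)\<^sup>2) \<partial>lborel)
          + 2 * (\<integral>\<^sup>+s. ennreal ((indicator {0..t} s * Z (max 0 s) \<omega>)\<^sup>2) \<partial>lborel)"
      by (intro nn_integral_square_add_le) auto
    moreover have sq: "(\<integral>\<^sup>+s. ennreal ((indicator {0..t} s * f (max 0 s))\<^sup>2) \<partial>lborel)
       = (\<integral>\<^sup>+s\<in>{0..t}. ennreal ((f s)\<^sup>2) \<partial>lborel)" for f :: "real \<Rightarrow> real"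
      by (intro nn_integral_cong) (auto simp: indicator_def)
    ultimately show ?thesis
      using sq[of "\<lambda>s. Y s \<omega> + Z s \<omega>"] sq[of "\<lambda>s. Y s \<omega>"] sq[of "\<lambda>s. Z s \<omega>"]
      by (simp only: distrib_left)
  qed
  then have "(\<integral>\<^sup>+\<omega>. (\<integral>\<^sup>+s\<in>{0..t}. ennreal ((Y s \<omega> + Z s \<omega>)\<^sup>2) \<partial>lborel) \<partial>M)
     \<le> (\<integral>\<^sup>+\<omega>. 2 * (\<integral>\<^sup>+s\<in>{0..t}. ennreal ((Y s \<omega>)\<^sup>2) \<partial>lborel) + 2 * (\<integral>\<^sup>+s\<in>{0..t}. ennreal ((Z s \<omega>)\<^sup>2) \<partial>lborel) \<partial>M)"
    by (intro nn_integral_mono) auto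
  also have "\<dots> = 2 * (\<integral>\<^sup>+\<omega>. (\<integral>\<^sup>+s\<in>{0..t}. ennreal ((Y s \<omega>)\<^sup>2) \<partial>lborel) \<partial>M)
      + 2 * (\<integral>\<^sup>+\<omega>. (\<integral>\<^sup>+s\<in>{0..t}. ennreal ((Z s \<omega>)\<^sup>2) \<partial>lborel) \<partial>M)"
    using set_nn_integral_process_measurable[OF assms(1), of "\<lambda>x. x\<^sup>2" t]
      set_nn_integral_process_measurable[OF assms(2), of "\<lambda>x. x\<^sup>2" t]
    by (simp add: nn_integral_add nn_integral_cmult)
  finally show ?thesis .
qed

text \<open>A single constant for all t up to T is required for the Fubini argument in the budget
  constraint. It comes from a simple integrand within distance 1 of \<open>Z\<close> whose integral
  at t is within distance 1 of \<open>I t\<close>.\<close>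

lemma ito_integral_second_moment_bound:
  assumes ito: "ito_integral M F W Z I" and Z: "Z \<in> L2_loc M F"
  shows "\<exists>C::real. \<forall>t\<in>{0..T}. (\<integral>\<^sup>+\<omega>. ennreal ((I t \<omega>)\<^sup>2) \<partial>M) \<le> ennreal C"
proof (cases "0 \<le> T")
  case True
  \<comment> \<open>T may be 0, whereas convergence of the simple integrands is given only on [0,R]
    with R > 0.\<close>
  let ?R = "T + 1"
  obtain S where S: "\<And>k. simple_integrand M F (S k)"
    and lim: "\<And>R. R > 0 \<Longrightarrow> (\<lambda>k. \<integral>\<^sup>+\<omega>. (\<integral>\<^sup>+t\<in>{0..R}. ennreal (\<bar>simple_process (S k) t \<omega> - Z t \<omega>\<bar>\<^sup>2) \<partial>lborel) \<partial>M) \<longlonglongrightarrow> 0"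
    and limI: "\<And>t. t \<ge> 0 \<Longrightarrow> (\<lambda>k. \<integral>\<^sup>+\<omega>. ennreal (\<bar>simple_integral W (S k) t \<omega> - I t \<omega>\<bar>\<^sup>2) \<partial>M) \<longlonglongrightarrow> 0"
    and I: "adapted F I"
    using ito unfolding ito_integral_def by blast
  let ?E = "\<lambda>Y. \<integral>\<^sup>+\<omega>. (\<integral>\<^sup>+t\<in>{0..?R}. ennreal ((Y t \<omega>)\<^sup>2) \<partial>lborel) \<partial>M"
  note sp = measurable_process_simple_process[OF S]
  have bound: "(\<integral>\<^sup>+\<omega>. ennreal ((I t \<omega>)\<^sup>2) \<partial>M) \<le> 2 * (2 * 1 + 2 * ?E Z) + 2 * 1" if t: "t \<in> {0..T}" for t
  proof -
    \<comment> \<open>The index k found here depends on t, but the resulting bound does not.\<close>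
    have "\<forall>\<^sub>F k in sequentially. ?E (\<lambda>t \<omega>. simple_process (S k) t \<omega> - Z t \<omega>) < 1"
      using order_tendstoD(2)[OF lim, of ?R 1] True by simp
    moreover have "\<forall>\<^sub>F k in sequentially. (\<integral>\<^sup>+\<omega>. ennreal (\<bar>simple_integral W (S k) t \<omega> - I t \<omega>\<bar>\<^sup>2) \<partial>M) < 1"
      using order_tendstoD(2)[OF limI, of t 1] t by simp
    ultimately have "\<forall>\<^sub>F k in sequentially. ?E (\<lambda>t \<omega>. simple_process (S k) t \<omega> - Z t \<omega>) < 1 \<and>
        (\<integral>\<^sup>+\<omega>. ennreal (\<bar>simple_integral W (S k) t \<omega> - I t \<omega>\<bar>\<^sup>2) \<partial>M) < 1" by eventually_elim simp
    then obtain k where k: "?E (\<lambda>t \<omega>. simple_process (S k) t \<omega> - Z t \<omega>) < 1"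
        "(\<integral>\<^sup>+\<omega>. ennreal ((simple_integral W (S k) t \<omega> - I t \<omega>)\<^sup>2) \<partial>M) < 1"
      using eventually_happens'[of sequentially] by auto
    have [measurable]: "I t \<in> borel_measurable M" "simple_integral W (S k) t \<in> borel_measurable M"
    proof -
      show "I t \<in> borel_measurable M" using I t measurable_F_imp_M[of t] by (auto simp: adapted_def)
      show "simple_integral W (S k) t \<in> borel_measurable M"
        using simple_integral_measurable S[of k] t by (cases "S k") auto
    qed
    have "?E (\<lambda>t \<omega>. (simple_process (S k) t \<omega> - Z t \<omega>) + Z t \<omega>)
      \<le> 2 * ?E (\<lambda>t \<omega>. simple_process (S k) t \<omega> - Z t \<omega>) + 2 * ?E Z"
      by (intro nn_integral_process_square_add_le measurable_process_diff sp L2_locD(1)[OF Z])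
    also have "\<dots> \<le> 2 * 1 + 2 * ?E Z"
      using k(1) by (intro add_mono mult_left_mono) auto
    finally have E: "?E (simple_process (S k)) \<le> 2 * 1 + 2 * ?E Z" by simp
    have "(\<integral>\<^sup>+\<omega>. ennreal ((simple_integral W (S k) t \<omega>)\<^sup>2) \<partial>M) \<le> ?E (simple_process (S k))"
      using simple_integral_second_moment_le[of _ _ _ t ?R] S[of k] t by (cases "S k") auto
    also note E
    finally have E': "(\<integral>\<^sup>+\<omega>. ennreal ((simple_integral W (S k) t \<omega>)\<^sup>2) \<partial>M) \<le> 2 * 1 + 2 * ?E Z" .
    have "(\<integral>\<^sup>+\<omega>. ennreal ((I t \<omega>)\<^sup>2) \<partial>M)
      = (\<integral>\<^sup>+\<omega>. ennreal ((simple_integral W (S k) t \<omega> + (I t \<omega> - simple_integral W (S k) t \<omega>))\<^sup>2) \<partial>M)" by simp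
    also have "\<dots> \<le> 2 * (\<integral>\<^sup>+\<omega>. ennreal ((simple_integral W (S k) t \<omega>)\<^sup>2) \<partial>M)
       + 2 * (\<integral>\<^sup>+\<omega>. ennreal ((I t \<omega> - simple_integral W (S k) t \<omega>)\<^sup>2) \<partial>M)"
      by (intro nn_integral_square_add_le) auto
    also have "\<dots> \<le> 2 * (2 * 1 + 2 * ?E Z) + 2 * 1"
      using E' k(2) by (intro add_mono mult_left_mono) (auto simp: power2_commute)
    finally show ?thesis .
  qed
  have "?E Z < \<infinity>" using L2_locD(3)[OF Z, of ?R] True by simp
  then have "2 * (2 * 1 + 2 * ?E Z) + 2 * 1 < \<infinity>"
    by (simp add: ennreal_mult_less_top)
  then have "ennreal (enn2real (2 * (2 * 1 + 2 * ?E Z) + 2 * 1)) = 2 * (2 * 1 + 2 * ?E Z) + 2 * 1"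
    unfolding infinity_ennreal_def by (rule ennreal_enn2real)
  then show ?thesis
    using bound by (intro exI[of _ "enn2real (2 * (2 * 1 + 2 * ?E Z) + 2 * 1)"]) (intro ballI, simp only:)
qed auto

lemma set_integral_process_second_moment_le:
  assumes "measurable_process M Z" "0 \<le> t"
  shows "(\<integral>\<^sup>+\<omega>. ennreal ((LINT s:{0..t}|lborel. Z s \<omega>)\<^sup>2) \<partial>M)
    \<le> ennreal t * (\<integral>\<^sup>+\<omega>. (\<integral>\<^sup>+s\<in>{0..t}. ennreal ((Z s \<omega>)\<^sup>2) \<partial>lborel) \<partial>M)"
proof -
  have "(\<integral>\<^sup>+\<omega>. ennreal ((LINT s:{0..t}|lborel. Z s \<omega>)\<^sup>2) \<partial>M)
     \<le> (\<integral>\<^sup>+\<omega>. ennreal t * (\<integral>\<^sup>+s\<in>{0..t}. ennreal ((Z s \<omega>)\<^sup>2) \<partial>lborel) \<partial>M)"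
  proof (rule nn_integral_mono)
    fix \<omega> assume \<omega>: "\<omega> \<in> space M"
    show "ennreal ((LINT s:{0..t}|lborel. Z s \<omega>)\<^sup>2) \<le> ennreal t * (\<integral>\<^sup>+s\<in>{0..t}. ennreal ((Z s \<omega>)\<^sup>2) \<partial>lborel)"
      using abs_set_integral_square_le[OF measurable_process_section[OF assms(1) \<omega>] assms(2)]
      by (subst set_integral_max_0, subst set_nn_integral_max_0) simp
  qed
  also have "\<dots> = ennreal t * (\<integral>\<^sup>+\<omega>. (\<integral>\<^sup>+s\<in>{0..t}. ennreal ((Z s \<omega>)\<^sup>2) \<partial>lborel) \<partial>M)"
    using set_nn_integral_process_measurable[OF assms(1), of "\<lambda>x. x\<^sup>2" t] by (intro nn_integral_cmult) simp
  finally show ?thesis .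
qed

lemma L2_loc_set_integrable_AE:
  assumes Z: "Z \<in> L2_loc M F" and t: "0 \<le> t"
  shows "AE \<omega> in M. set_integrable lborel {0..t} (\<lambda>s. Z s \<omega>)"
proof -
  have "(\<integral>\<^sup>+\<omega>. (\<integral>\<^sup>+s\<in>{0..t}. ennreal ((Z s \<omega>)\<^sup>2) \<partial>lborel) \<partial>M)
      \<le> (\<integral>\<^sup>+\<omega>. (\<integral>\<^sup>+s\<in>{0..t + 1}. ennreal ((Z s \<omega>)\<^sup>2) \<partial>lborel) \<partial>M)"
    by (intro nn_integral_mono) (auto simp: indicator_def)
  also have "\<dots> < \<infinity>" using L2_locD(3)[OF Z] t by simp
  finally have "(\<integral>\<^sup>+\<omega>. (\<integral>\<^sup>+s\<in>{0..t}. ennreal ((Z s \<omega>)\<^sup>2) \<partial>lborel) \<partial>M) \<noteq> \<infinity>" by simp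
  then have "AE \<omega> in M. (\<integral>\<^sup>+s\<in>{0..t}. ennreal ((Z s \<omega>)\<^sup>2) \<partial>lborel) \<noteq> \<infinity>"
    using set_nn_integral_process_measurable[OF L2_locD(1)[OF Z], of "\<lambda>x. x\<^sup>2" t]
    by (intro nn_integral_noteq_infinite) auto
  then show ?thesis
  proof (rule AE_mp, intro AE_I2 impI)
    fix \<omega> assume \<omega>: "\<omega> \<in> space M" and fin: "(\<integral>\<^sup>+s\<in>{0..t}. ennreal ((Z s \<omega>)\<^sup>2) \<partial>lborel) \<noteq> \<infinity>"
    then show "set_integrable lborel {0..t} (\<lambda>s. Z s \<omega>)"
      using set_integrable_of_square[OF measurable_process_section[OF L2_locD(1)[OF Z] \<omega>] _ t]
      by (subst set_integrable_max_0, subst (asm) (2) set_nn_integral_max_0) (auto simp: less_top)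
  qed
qed

text \<open>The weight is taken at \<open>T\<close> and not at \<open>t\<close>: the time integral of \<open>Z\<close> up to \<open>t\<close> is not known to be
  measurable with respect to \<open>F t\<close>, since \<open>Z\<close> is only measurable and adapted.\<close>

lemma ito_integral_tilted_mean_zero:
  assumes ito: "ito_integral M F W Z I" and Z: "Z \<in> L2_loc M F" and t: "0 \<le> t" "t \<le> T"
  shows "has_bochner_integral M
    (\<lambda>\<omega>. exp_mart (- lam) T \<omega> * (I t \<omega> + lam * (LINT s:{0..t}|lborel. Z s \<omega>))) 0"
proof -
  obtain S where S: "\<And>k. simple_integrand M F (S k)"
    and lim: "\<And>R. R > 0 \<Longrightarrow> (\<lambda>k. \<integral>\<^sup>+\<omega>. (\<integral>\<^sup>+t\<in>{0..R}. ennreal (\<bar>simple_process (S k) t \<omega> - Z t \<omega>\<bar>\<^sup>2) \<partial>lborel) \<partial>M) \<longlonglongrightarrow> 0"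
    and limI: "\<And>t. t \<ge> 0 \<Longrightarrow> (\<lambda>k. \<integral>\<^sup>+\<omega>. ennreal (\<bar>simple_integral W (S k) t \<omega> - I t \<omega>\<bar>\<^sup>2) \<partial>M) \<longlonglongrightarrow> 0"
    and I: "adapted F I"
    using ito unfolding ito_integral_def by blast
  note sp = measurable_process_simple_process[OF S] and Zm = L2_locD(1)[OF Z]
  have T: "0 \<le> T" using t by simp
  let ?L = "\<lambda>Y \<omega>. LINT s:{0..t}|lborel. Y s \<omega>"
  let ?E = "\<lambda>R Y. \<integral>\<^sup>+\<omega>. (\<integral>\<^sup>+t\<in>{0..R}. ennreal ((Y t \<omega>)\<^sup>2) \<partial>lborel) \<partial>M"
  \<comment> \<open>As t = 0 is allowed, norms are estimated over [0, t + 1], where the convergence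
    of the approximation is available.\<close>
  have Emono: "?E t Y \<le> ?E (t + 1) Y" for Y :: "real \<Rightarrow> 'a \<Rightarrow> real"
    by (intro nn_integral_mono) (auto simp: indicator_def)
  have [measurable]: "I t \<in> borel_measurable M" "exp_mart (- lam) T \<in> borel_measurable M"
    using I t measurable_F_imp_M[of t] T by (auto simp: adapted_def)
  have [measurable]: "simple_integral W (S k) t \<in> borel_measurable M" for k
    using simple_integral_measurable S[of k] t by (cases "S k") auto
  have [measurable]: "?L Z \<in> borel_measurable M" "?L (simple_process (S k)) \<in> borel_measurable M" for k
    by (intro set_integral_process_measurable Zm sp)+
  \<comment> \<open>A square-integrable weight makes the weighted mean continuous in L2, so its
    vanishing for simple integrands survives the limit.\<close>
  have \<zeta>: "integrable M (\<lambda>\<omega>. (exp_mart (- lam) T \<omega>)\<^sup>2)"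
    using exp_mart_power_moment[OF T, of "- lam" 2] by (auto simp: has_bochner_integral_iff)
  have sq: "integrable M (\<lambda>\<omega>. (I t \<omega> + lam * ?L Z \<omega>)\<^sup>2)"
  proof -
    obtain C where "(\<integral>\<^sup>+\<omega>. ennreal ((I t \<omega>)\<^sup>2) \<partial>M) \<le> ennreal C"
      using ito_integral_second_moment_bound[OF ito Z, of T] t by (meson atLeastAtMost_iff)
    then have "(\<integral>\<^sup>+\<omega>. ennreal ((I t \<omega>)\<^sup>2) \<partial>M) < \<infinity>" using le_less_trans by fastforce
    then have "integrable M (\<lambda>\<omega>. (I t \<omega>)\<^sup>2)" by (intro integrableI_bounded) auto
    moreover have "(\<integral>\<^sup>+\<omega>. ennreal ((?L Z \<omega>)\<^sup>2) \<partial>M) < \<infinity>"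
    proof (rule le_less_trans[OF set_integral_process_second_moment_le[OF Zm t(1)]])
      have "?E t Z < \<infinity>" using Emono[of Z] L2_locD(3)[OF Z, of "t + 1"] t by (simp add: le_less_trans)
      then show "ennreal t * ?E t Z < \<infinity>" by (simp add: ennreal_mult_less_top)
    qed
    then have "integrable M (\<lambda>\<omega>. (?L Z \<omega>)\<^sup>2)" by (intro integrableI_bounded) auto
    ultimately have "integrable M (\<lambda>\<omega>. (I t \<omega>)\<^sup>2 + 2 * lam * (I t \<omega> * ?L Z \<omega>) + lam\<^sup>2 * (?L Z \<omega>)\<^sup>2)"
      by (intro Bochner_Integration.integrable_add integrable_mult_right integrable_mult_of_squares) auto
    then show ?thesis by (simp add: power2_sum power_mult_distrib algebra_simps)
  qed
  have int: "integrable M (\<lambda>\<omega>. exp_mart (- lam) T \<omega> * (I t \<omega> + lam * ?L Z \<omega>))"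
    using \<zeta> sq by (intro integrable_mult_of_squares) auto
  have zero: "has_bochner_integral M (\<lambda>\<omega>. exp_mart (- lam) T \<omega> *
      (simple_integral W (S k) t \<omega> + lam * ?L (simple_process (S k)) \<omega>)) 0" for k
    using simple_integral_tilted[of _ _ _ t T lam] S[of k] t by (cases "S k") auto
  have "(\<lambda>k. \<integral>\<omega>. exp_mart (- lam) T \<omega> * (simple_integral W (S k) t \<omega> + lam * ?L (simple_process (S k)) \<omega>) \<partial>M)
    \<longlonglongrightarrow> (\<integral>\<omega>. exp_mart (- lam) T \<omega> * (I t \<omega> + lam * ?L Z \<omega>) \<partial>M)"
  proof (rule integral_mult_tendsto_L2)
    let ?b = "\<lambda>k. 2 * (\<integral>\<^sup>+\<omega>. ennreal (\<bar>simple_integral W (S k) t \<omega> - I t \<omega>\<bar>\<^sup>2) \<partial>M)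
        + 2 * (ennreal (lam\<^sup>2) * (ennreal t * ?E (t + 1) (\<lambda>s \<omega>. simple_process (S k) s \<omega> - Z s \<omega>)))"
    have "?b \<longlonglongrightarrow> 2 * 0 + 2 * (ennreal (lam\<^sup>2) * (ennreal t * 0))"
      using lim[of "t + 1"] limI[of t] t
      by (intro tendsto_add ennreal_tendsto_cmult) auto
    then have b0: "?b \<longlonglongrightarrow> 0" by simp
    have le: "(\<integral>\<^sup>+\<omega>. ennreal ((simple_integral W (S k) t \<omega> + lam * ?L (simple_process (S k)) \<omega> - (I t \<omega> + lam * ?L Z \<omega>))\<^sup>2) \<partial>M) \<le> ?b k" for k
    proof -
      let ?D = "\<lambda>s \<omega>. simple_process (S k) s \<omega> - Z s \<omega>"
      have Dm: "measurable_process M ?D" by (intro measurable_process_diff sp Zm)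
      note [measurable] = set_integral_process_measurable[OF Dm]
      \<comment> \<open>Linearity of the time integral needs integrable paths of \<open>Z\<close>,
        which are available only almost surely.\<close>
      have "AE \<omega> in M. simple_integral W (S k) t \<omega> + lam * ?L (simple_process (S k)) \<omega> - (I t \<omega> + lam * ?L Z \<omega>)
          = (simple_integral W (S k) t \<omega> - I t \<omega>) + lam * ?L ?D \<omega>"
        using L2_loc_set_integrable_AE[OF Z t(1)]
      proof eventually_elim
        fix \<omega> assume Zi: "set_integrable lborel {0..t} (\<lambda>s. Z s \<omega>)"
        have "set_integrable lborel {0..t} (\<lambda>s. simple_process (S k) s \<omega>)"
          using has_bochner_integral_simple_process[OF _ t(1)] S[of k]
          by (cases "S k") (fastforce simp: set_integrable_def has_bochner_integral_iff)
        then have "?L ?D \<omega> = ?L (simple_process (S k)) \<omega> - ?L Z \<omega>" using Zi by (rule set_integral_diff)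
        then show "simple_integral W (S k) t \<omega> + lam * ?L (simple_process (S k)) \<omega> - (I t \<omega> + lam * ?L Z \<omega>)
          = (simple_integral W (S k) t \<omega> - I t \<omega>) + lam * ?L ?D \<omega>" by (simp add: right_diff_distrib)
      qed
      then have "(\<integral>\<^sup>+\<omega>. ennreal ((simple_integral W (S k) t \<omega> + lam * ?L (simple_process (S k)) \<omega> - (I t \<omega> + lam * ?L Z \<omega>))\<^sup>2) \<partial>M)
        = (\<integral>\<^sup>+\<omega>. ennreal (((simple_integral W (S k) t \<omega> - I t \<omega>) + lam * ?L ?D \<omega>)\<^sup>2) \<partial>M)"
        by (intro nn_integral_cong_AE) (elim eventually_mono, simp only:)
      also have "\<dots> \<le> 2 * (\<integral>\<^sup>+\<omega>. ennreal ((simple_integral W (S k) t \<omega> - I t \<omega>)\<^sup>2) \<partial>M)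
          + 2 * (\<integral>\<^sup>+\<omega>. ennreal ((lam * ?L ?D \<omega>)\<^sup>2) \<partial>M)"
        by (intro nn_integral_square_add_le) auto
      also have "(\<integral>\<^sup>+\<omega>. ennreal ((lam * ?L ?D \<omega>)\<^sup>2) \<partial>M) = ennreal (lam\<^sup>2) * (\<integral>\<^sup>+\<omega>. ennreal ((?L ?D \<omega>)\<^sup>2) \<partial>M)"
        by (simp add: power_mult_distrib ennreal_mult nn_integral_cmult)
      also have "\<dots> \<le> ennreal (lam\<^sup>2) * (ennreal t * ?E (t + 1) ?D)"
        by (intro mult_left_mono order_trans[OF set_integral_process_second_moment_le[OF Dm t(1)]] Emono) auto
      finally show ?thesis by (simp add: add_left_mono mult_left_mono)
    qed
    show "(\<lambda>k. \<integral>\<^sup>+\<omega>. ennreal ((simple_integral W (S k) t \<omega> + lam * ?L (simple_process (S k)) \<omega> - (I t \<omega> + lam * ?L Z \<omega>))\<^sup>2) \<partial>M) \<longlonglongrightarrow> 0"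
      by (rule tendsto_sandwich[OF _ _ tendsto_const b0]) (use le in auto)
  qed (use \<zeta> int zero in \<open>auto simp: has_bochner_integral_iff\<close>)
  moreover have "(\<integral>\<omega>. exp_mart (- lam) T \<omega> * (simple_integral W (S k) t \<omega> + lam * ?L (simple_process (S k)) \<omega>) \<partial>M) = 0" for k
    using zero by (simp add: has_bochner_integral_iff)
  ultimately have "(\<integral>\<omega>. exp_mart (- lam) T \<omega> * (I t \<omega> + lam * ?L Z \<omega>) \<partial>M) = 0"
    by (simp add: LIMSEQ_const_iff)
  with int show ?thesis by (simp add: has_bochner_integral_iff)
qed

end

section \<open>The budget constraint and the duality bound\<close>

lemma continuous_on_set_integral:
  fixes f :: "real \<Rightarrow> real"
  assumes "set_integrable lborel {0..T} f"
  shows "continuous_on {0..T} (\<lambda>t. LINT s:{0..t}|lborel. f s)"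
proof -
  have "continuous_on {0..T} (\<lambda>t. integral {0..t} f)"
    using set_borel_integral_eq_integral(1)[OF assms] by (rule indefinite_integral_continuous_1)
  moreover have "integral {0..t} f = (LINT s:{0..t}|lborel. f s)" if "t \<in> {0..T}" for t
    using set_borel_integral_eq_integral(2)[OF set_integrable_subset[OF assms, of "{0..t}"]] that by auto
  ultimately show ?thesis by (rule continuous_on_eq)
qed

text \<open>Integration by parts for e^(-r t) D_t. As \<open>g\<close> is merely integrable, D need
  not be differentiable everywhere; Fubini's theorem on the triangle u <= s replaces the product
  rule.\<close>

lemma discounted_integral_identity:
  fixes g D :: "real \<Rightarrow> real"
  assumes T: "0 \<le> T" and g: "set_integrable lborel {0..T} g"
    and D: "\<And>t. t \<in> {0..T} \<Longrightarrow> D t = x + (LINT s:{0..t}|lborel. g s)"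
  shows "exp (- r * T) * D T
    = x + (LINT s:{0..T}|lborel. exp (- r * s) * g s) - (LINT s:{0..T}|lborel. r * exp (- r * s) * D s)"
proof -
  define G where "G u = indicator {0..T} u * g u" for u
  have G: "integrable lborel G" using g by (simp add: G_def[abs_def] set_integrable_def)
  then have [measurable]: "G \<in> borel_measurable borel" by auto
  define h where "h s = indicator {0..T} s * (r * exp (- r * s))" for s
  have h: "integrable lborel h"
    using borel_integrable_atLeastAtMost'[of 0 T "\<lambda>s. r * exp (- r * s)"]
    by (simp add: h_def[abs_def] set_integrable_def continuous_intros)
  \<comment> \<open>The kernel r e^(-r s) g(u) on 0 <= u <= s <= T. Integrating s first gives e^(-r
    u) - e^(-r T), integrating u first gives D s - x.\<close>
  define f where "f s u = h s * (indicator {u..} s * G u)" for s u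
  have prod: "integrable (lborel \<Otimes>\<^sub>M lborel) (\<lambda>(s, u). h s * G u)"
    using h G by (intro lborel_pair.Fubini_integrable) (auto simp: abs_mult)
  have [measurable]: "case_prod f \<in> borel_measurable (lborel \<Otimes>\<^sub>M lborel)"
  proof -
    have [measurable]: "h \<in> borel_measurable borel" by (simp add: h_def[abs_def])
    have "f = (\<lambda>s u. h s * ((if u \<le> s then 1 else 0) * G u))"
      by (auto simp: f_def fun_eq_iff indicator_def)
    then show ?thesis by simp
  qed
  have "integrable (lborel \<Otimes>\<^sub>M lborel) (case_prod f)"
    by (rule Bochner_Integration.integrable_bound[OF prod])
       (auto simp: f_def indicator_def abs_mult split_beta)
  from lborel_pair.Fubini_integral[OF this]
  have Fub: "(\<integral>u. (\<integral>s. f s u \<partial>lborel) \<partial>lborel) = (\<integral>s. (\<integral>u. f s u \<partial>lborel) \<partial>lborel)" .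
  have inner_s: "(\<integral>s. f s u \<partial>lborel) = indicator {0..T} u *\<^sub>R (exp (- r * u) * g u) - exp (- r * T) * G u" for u
  proof (cases "u \<in> {0..T}")
    case True
    have "(\<integral>s. (r * exp (- r * s)) * indicator {u..T} s \<partial>lborel) = - exp (- r * T) - (- exp (- r * u))"
      using True by (intro integral_FTC_Icc_real) (auto intro!: derivative_eq_intros continuous_intros)
    moreover have "f s u = G u * ((r * exp (- r * s)) * indicator {u..T} s)" for s
      using True by (auto simp: f_def h_def indicator_def)
    ultimately have "(\<integral>s. f s u \<partial>lborel) = G u * (exp (- r * u) - exp (- r * T))" by simp
    then show ?thesis using True by (simp add: G_def algebra_simps)
  qed (simp add: f_def G_def)
  have inner_u: "(\<integral>u. f s u \<partial>lborel) = indicator {0..T} s *\<^sub>R (r * exp (- r * s) * D s) - x * h s" for s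
  proof (cases "s \<in> {0..T}")
    case True
    have "(\<integral>u. indicator {u..} s * G u \<partial>lborel) = (LINT u:{0..s}|lborel. g u)"
      unfolding set_lebesgue_integral_def G_def using True
      by (intro Bochner_Integration.integral_cong) (auto simp: indicator_def)
    then have "(\<integral>u. f s u \<partial>lborel) = h s * (D s - x)"
      using D[OF True] by (simp add: f_def)
    then show ?thesis using True by (simp add: h_def algebra_simps)
  qed (simp add: f_def h_def)
  have eg: "set_integrable lborel {0..T} (\<lambda>s. exp (- r * s) * g s)"
    unfolding set_integrable_def
  proof (rule Bochner_Integration.integrable_bound)
    show "integrable lborel (\<lambda>s. exp (\<bar>r\<bar> * T) * G s)" using G by simp
    \<comment> \<open>The interest rate may have either sign, so discount factors are bounded
      through its absolute value.\<close>
    have "- r * s \<le> \<bar>r\<bar> * T" if "s \<in> {0..T}" for s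
      using that mult_mono[of "- r" "\<bar>r\<bar>" s T] by auto
    then show "AE s in lborel. norm (indicator {0..T} s *\<^sub>R (exp (- r * s) * g s)) \<le> norm (exp (\<bar>r\<bar> * T) * G s)"
      by (intro AE_I2) (auto simp: G_def indicator_def abs_mult intro!: mult_right_mono)
    have "(\<lambda>s. indicator {0..T} s *\<^sub>R (exp (- r * s) * g s)) = (\<lambda>s. exp (- r * s) * G s)"
      by (auto simp: G_def)
    then show "(\<lambda>s. indicator {0..T} s *\<^sub>R (exp (- r * s) * g s)) \<in> borel_measurable lborel" by simp
  qed
  have eD: "set_integrable lborel {0..T} (\<lambda>s. r * exp (- r * s) * D s)"
  proof -
    have "continuous_on {0..T} (\<lambda>t. x + (LINT s:{0..t}|lborel. g s))"
      by (intro continuous_intros continuous_on_set_integral g)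
    then have "continuous_on {0..T} D"
      by (rule continuous_on_eq) (use D in auto)
    then show ?thesis by (intro borel_integrable_atLeastAtMost' continuous_intros)
  qed
  have "(LINT s:{0..T}|lborel. exp (- r * s) * g s) - exp (- r * T) * (\<integral>u. G u \<partial>lborel)
      = (LINT s:{0..T}|lborel. r * exp (- r * s) * D s) - x * (\<integral>s. h s \<partial>lborel)"
    using Fub G h eg eD unfolding inner_s inner_u
    by (simp add: set_lebesgue_integral_def set_integrable_def)
  moreover have "(\<integral>s. h s \<partial>lborel) = 1 - exp (- r * T)"
  proof -
    have "(\<integral>s. (r * exp (- r * s)) * indicator {0..T} s \<partial>lborel) = - exp (- r * T) - (- exp (- r * 0))"
      using T by (intro integral_FTC_Icc_real) (auto intro!: derivative_eq_intros continuous_intros)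
    then show ?thesis by (simp add: h_def mult.commute)
  qed
  moreover have "(\<integral>u. G u \<partial>lborel) = D T - x"
    using D[of T] T by (simp add: G_def[abs_def] set_lebesgue_integral_def)
  ultimately show ?thesis by (simp add: algebra_simps)
qed

section \<open>Path integrability of strategies and the budget constraint\<close>

lemma L1_loc_nonnegD:
  assumes "c \<in> L1_loc_nonneg M F"
  shows "measurable_process M c" "adapted F c" "0 \<le> t \<Longrightarrow> \<omega> \<in> space M \<Longrightarrow> 0 \<le> c t \<omega>"
    and "0 < R \<Longrightarrow> (\<integral>\<^sup>+\<omega>. (\<integral>\<^sup>+t\<in>{0..R}. ennreal \<bar>c t \<omega>\<bar> \<partial>lborel) \<partial>M) < \<infinity>"
  using assms by (auto simp: L1_loc_nonneg_def)

lemma L1_loc_set_integrable_AE: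
  assumes c: "c \<in> L1_loc_nonneg M F" and t: "0 < t"
  shows "AE \<omega> in M. set_integrable lborel {0..t} (\<lambda>s. c s \<omega>)"
proof -
  have "(\<integral>\<^sup>+\<omega>. (\<integral>\<^sup>+s\<in>{0..t}. ennreal \<bar>c s \<omega>\<bar> \<partial>lborel) \<partial>M) \<noteq> \<infinity>"
    using L1_loc_nonnegD(4)[OF c t] by simp
  then have "AE \<omega> in M. (\<integral>\<^sup>+s\<in>{0..t}. ennreal \<bar>c s \<omega>\<bar> \<partial>lborel) \<noteq> \<infinity>"
    using set_nn_integral_process_measurable[OF L1_loc_nonnegD(1)[OF c], of abs t]
    by (intro nn_integral_noteq_infinite) auto
  then show ?thesis
  proof (rule AE_mp, intro AE_I2 impI)
    fix \<omega> assume \<omega>: "\<omega> \<in> space M" and fin: "(\<integral>\<^sup>+s\<in>{0..t}. ennreal \<bar>c s \<omega>\<bar> \<partial>lborel) \<noteq> \<infinity>"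
    note [measurable] = measurable_process_section[OF L1_loc_nonnegD(1)[OF c] \<omega>]
    have "(\<integral>\<^sup>+s. ennreal (norm (indicator {0..t} s *\<^sub>R c (max 0 s) \<omega>)) \<partial>lborel)
        = (\<integral>\<^sup>+s\<in>{0..t}. ennreal \<bar>c s \<omega>\<bar> \<partial>lborel)"
      by (intro nn_integral_cong) (auto simp: indicator_def)
    also have "\<dots> < \<infinity>" using fin by (simp add: less_top)
    finally have "set_integrable lborel {0..t} (\<lambda>s. c (max 0 s) \<omega>)"
      unfolding set_integrable_def by (intro integrableI_bounded) auto
    then show "set_integrable lborel {0..t} (\<lambda>s. c s \<omega>)" by (subst set_integrable_max_0)
  qed
qed

lemma L2_loc_cmult:
  assumes "Z \<in> L2_loc M F"
  shows "(\<lambda>t \<omega>. a * Z t \<omega>) \<in> L2_loc M F"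
proof -
  have "measurable_process M (\<lambda>t \<omega>. a * Z t \<omega>)"
    using borel_measurable_times[OF borel_measurable_const[of a] L2_locD(1)[OF assms, unfolded measurable_process_def]]
    by (simp add: measurable_process_def case_prod_beta)
  moreover have "adapted F (\<lambda>t \<omega>. a * Z t \<omega>)"
    using L2_locD(2)[OF assms] by (auto simp: adapted_def)
  moreover have "(\<integral>\<^sup>+\<omega>. (\<integral>\<^sup>+t\<in>{0..R}. ennreal ((a * Z t \<omega>)\<^sup>2) \<partial>lborel) \<partial>M) < \<infinity>" if "0 < R" for R
  proof -
    have "(\<integral>\<^sup>+t\<in>{0..R}. ennreal ((a * Z t \<omega>)\<^sup>2) \<partial>lborel) = ennreal (a\<^sup>2) * (\<integral>\<^sup>+t\<in>{0..R}. ennreal ((Z t \<omega>)\<^sup>2) \<partial>lborel)"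
      if "\<omega> \<in> space M" for \<omega>
    proof -
      note [measurable] = measurable_process_section[OF L2_locD(1)[OF assms] that]
      have "(\<integral>\<^sup>+t. ennreal (a\<^sup>2) * (ennreal ((Z (max 0 t) \<omega>)\<^sup>2) * indicator {0..R} t) \<partial>lborel)
        = ennreal (a\<^sup>2) * (\<integral>\<^sup>+t. ennreal ((Z (max 0 t) \<omega>)\<^sup>2) * indicator {0..R} t \<partial>lborel)"
        by (rule nn_integral_cmult) measurable
      then show ?thesis
        by (subst set_nn_integral_max_0, subst (2) set_nn_integral_max_0)
           (simp add: power_mult_distrib ennreal_mult mult.assoc)
    qed
    then have "(\<integral>\<^sup>+\<omega>. (\<integral>\<^sup>+t\<in>{0..R}. ennreal ((a * Z t \<omega>)\<^sup>2) \<partial>lborel) \<partial>M)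
       = (\<integral>\<^sup>+\<omega>. ennreal (a\<^sup>2) * (\<integral>\<^sup>+t\<in>{0..R}. ennreal ((Z t \<omega>)\<^sup>2) \<partial>lborel) \<partial>M)"
      by (intro nn_integral_cong) auto
    also have "\<dots> = ennreal (a\<^sup>2) * (\<integral>\<^sup>+\<omega>. (\<integral>\<^sup>+t\<in>{0..R}. ennreal ((Z t \<omega>)\<^sup>2) \<partial>lborel) \<partial>M)"
      using set_nn_integral_process_measurable[OF L2_locD(1)[OF assms], of "\<lambda>x. x\<^sup>2" R]
      by (intro nn_integral_cmult) simp
    also have "\<dots> < \<infinity>" using L2_locD(3)[OF assms that] by (simp add: ennreal_mult_less_top)
    finally show ?thesis .
  qed
  ultimately show ?thesis by (auto simp: L2_loc_def)
qed

context continuous_brownian_motion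
begin

text \<open>The weighted gains N have mean zero and wealth is nonnegative at T, so discounted
  consumption cannot cost more than x. The horizon is finite because the weight is used through its
  second moment, which is not bounded in T when lam is nonzero.\<close>

lemma budget_constraint:
  assumes c: "c \<in> L1_loc_nonneg M F" and \<pi>: "\<pi> \<in> L2_loc M F"
    and X: "wealth_process M F W r \<sigma> lam x c \<pi> X"
    and pos: "AE \<omega> in M. \<forall>t\<ge>0. 0 \<le> X t \<omega>" and T: "0 < T"
  shows "(\<integral>\<^sup>+\<omega>. (\<integral>\<^sup>+s\<in>{0..T}. ennreal (exp (- r * s) * exp_mart (- lam) s \<omega> * c s \<omega>) \<partial>lborel) \<partial>M) \<le> ennreal x"
proof -
  interpret P: pair_sigma_finite M lborel by unfold_locales
  define Z where "Z t \<omega> = \<sigma> * \<pi> t \<omega>" for t \<omega>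
  have Z: "Z \<in> L2_loc M F" using L2_loc_cmult[OF \<pi>] by (simp add: Z_def[abs_def])
  obtain I where ito: "ito_integral M F W Z I"
    and eq: "AE \<omega> in M. \<forall>t\<ge>0. X t \<omega> = x + (LINT s:{0..t}|lborel. r * X s \<omega> + \<sigma> * lam * \<pi> s \<omega>)
                     + I t \<omega> - (LINT s:{0..t}|lborel. c s \<omega>)"
    and contX: "AE \<omega> in M. continuous_on {0..} (\<lambda>t. X t \<omega>)"
    using X unfolding wealth_process_def Z_def[abs_def] by blast
  have contI: "AE \<omega> in M. continuous_on {0..} (\<lambda>t. I t \<omega>)" and I: "adapted F I"
    using ito unfolding ito_integral_def by blast+
  \<comment> \<open>All almost sure properties are gathered outside one null set \<open>A\<close>,
    so that the wealth equation can be solved path by path.\<close>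
  have "AE \<omega> in M. (\<forall>t\<ge>0. X t \<omega> = x + (LINT s:{0..t}|lborel. r * X s \<omega> + \<sigma> * lam * \<pi> s \<omega>)
                     + I t \<omega> - (LINT s:{0..t}|lborel. c s \<omega>)) \<and>
      continuous_on {0..} (\<lambda>t. X t \<omega>) \<and> continuous_on {0..} (\<lambda>t. I t \<omega>) \<and> (\<forall>t\<ge>0. 0 \<le> X t \<omega>) \<and>
      set_integrable lborel {0..T} (\<lambda>s. Z s \<omega>) \<and> set_integrable lborel {0..T} (\<lambda>s. c s \<omega>)"
    by (intro AE_conjI eq contX contI pos L2_loc_set_integrable_AE[OF Z] L1_loc_set_integrable_AE[OF c])
       (use T in auto)
  then obtain A where A: "A \<in> null_sets M" and good: "\<And>\<omega>. \<omega> \<in> space M \<Longrightarrow> \<omega> \<notin> A \<Longrightarrow>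
      (\<forall>t\<ge>0. X t \<omega> = x + (LINT s:{0..t}|lborel. r * X s \<omega> + \<sigma> * lam * \<pi> s \<omega>)
                     + I t \<omega> - (LINT s:{0..t}|lborel. c s \<omega>)) \<and>
      continuous_on {0..} (\<lambda>t. X t \<omega>) \<and> continuous_on {0..} (\<lambda>t. I t \<omega>) \<and> (\<forall>t\<ge>0. 0 \<le> X t \<omega>) \<and>
      set_integrable lborel {0..T} (\<lambda>s. Z s \<omega>) \<and> set_integrable lborel {0..T} (\<lambda>s. c s \<omega>)"
    by (rule AE_obtain_null) blast
  have notA: "AE \<omega> in M. \<omega> \<notin> A" using A by (rule AE_not_in)
  have [measurable]: "A \<in> sets M" using A by auto
  define N where "N t \<omega> = I t \<omega> + lam * (LINT s:{0..t}|lborel. Z s \<omega>)" for t \<omega>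
  \<comment> \<open>Setting N to 0 on the null set and holding it constant outside [0,T] makes every
    path continuous on the whole line, as joint measurability requires.\<close>
  define N' where "N' t \<omega> = (if \<omega> \<in> A then 0 else N (max 0 (min t T)) \<omega>)" for t \<omega>
  define \<zeta> where "\<zeta> = exp_mart (- lam) T"
  have \<zeta>m [measurable]: "\<zeta> \<in> borel_measurable M" using T by (simp add: \<zeta>_def)
  have \<zeta>pos: "0 < \<zeta> \<omega>" for \<omega> by (simp add: \<zeta>_def exp_mart_pos)
  have Nm [measurable]: "N t \<in> borel_measurable M" if "0 \<le> t" for t
  proof -
    have "I t \<in> borel_measurable M"
      using I measurable_F_imp_M[of t] that by (auto simp: adapted_def)
    then show ?thesis
      unfolding N_def[abs_def]
      by (intro borel_measurable_add borel_measurable_times borel_measurable_const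
          set_integral_process_measurable L2_locD(1)[OF Z])
  qed
  have [measurable]: "N' t \<in> borel_measurable M" for t
    unfolding N'_def[abs_def] using Nm[of "max 0 (min t T)"] by measurable
  have NcontT: "continuous_on {0..T} (\<lambda>t. N t \<omega>)" if "\<omega> \<in> space M" "\<omega> \<notin> A" for \<omega>
    unfolding N_def using good[OF that]
    by (intro continuous_intros continuous_on_set_integral) (auto intro: continuous_on_subset)
  have N'cont: "continuous_on UNIV (\<lambda>t. N' t \<omega>)" if "\<omega> \<in> space M" for \<omega>
  proof (cases "\<omega> \<in> A")
    case False
    have "continuous_on UNIV (\<lambda>t. N (max 0 (min t T)) \<omega>)"
      using T by (intro continuous_on_compose2[OF NcontT[OF that False]] continuous_intros) auto
    then show ?thesis using False by (simp add: N'_def)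
  qed (simp add: N'_def)
  have J [measurable]: "(\<lambda>z. N' (snd z) (fst z)) \<in> borel_measurable (M \<Otimes>\<^sub>M lborel)"
    by (rule continuous_process_jointly_measurable) (auto intro: N'cont)
  have \<zeta>sq: "integrable M (\<lambda>\<omega>. (\<zeta> \<omega>)\<^sup>2)" and \<zeta>1: "has_bochner_integral M \<zeta> 1"
    using exp_mart_power_moment[of T "- lam" 2] exp_mart_power_moment[of T "- lam" 1] T
    by (auto simp: has_bochner_integral_iff \<zeta>_def)
  have mean0: "has_bochner_integral M (\<lambda>\<omega>. \<zeta> \<omega> * N' t \<omega>) 0" if t: "t \<in> {0..T}" for t
  proof -
    have "has_bochner_integral M (\<lambda>\<omega>. \<zeta> \<omega> * N t \<omega>) 0"
      unfolding \<zeta>_def N_def using t by (intro ito_integral_tilted_mean_zero[OF ito Z]) auto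
    moreover have "AE \<omega> in M. \<zeta> \<omega> * N t \<omega> = \<zeta> \<omega> * N' t \<omega>"
      using notA t by (auto simp: N'_def elim!: eventually_mono)
    ultimately show ?thesis
      using t by (subst (asm) has_bochner_integral_cong_AE) auto
  qed
  obtain B where B: "\<And>t. t \<in> {0..T} \<Longrightarrow> (\<integral>\<^sup>+\<omega>. ennreal ((N' t \<omega>)\<^sup>2) \<partial>M) \<le> B" "B < \<infinity>"
  proof -
    obtain C where C: "\<And>t. t \<in> {0..T} \<Longrightarrow> (\<integral>\<^sup>+\<omega>. ennreal ((I t \<omega>)\<^sup>2) \<partial>M) \<le> ennreal C"
      using ito_integral_second_moment_bound[OF ito Z, of T] by blast
    let ?E = "\<lambda>t. \<integral>\<^sup>+\<omega>. (\<integral>\<^sup>+s\<in>{0..t}. ennreal ((Z s \<omega>)\<^sup>2) \<partial>lborel) \<partial>M"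
    let ?B = "2 * ennreal C + 2 * (ennreal (lam\<^sup>2) * (ennreal T * ?E T))"
    have "(\<integral>\<^sup>+\<omega>. ennreal ((N' t \<omega>)\<^sup>2) \<partial>M) \<le> ?B" if t: "t \<in> {0..T}" for t
    proof -
      have [measurable]: "I t \<in> borel_measurable M"
        using I measurable_F_imp_M[of t] t by (auto simp: adapted_def)
      note [measurable] = set_integral_process_measurable[OF L2_locD(1)[OF Z], of t]
      have "(\<integral>\<^sup>+\<omega>. ennreal ((N' t \<omega>)\<^sup>2) \<partial>M) \<le> (\<integral>\<^sup>+\<omega>. ennreal ((N t \<omega>)\<^sup>2) \<partial>M)"
        using t by (intro nn_integral_mono) (auto simp: N'_def)
      also have "\<dots> \<le> 2 * (\<integral>\<^sup>+\<omega>. ennreal ((I t \<omega>)\<^sup>2) \<partial>M)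
          + 2 * (\<integral>\<^sup>+\<omega>. ennreal ((lam * (LINT s:{0..t}|lborel. Z s \<omega>))\<^sup>2) \<partial>M)"
        unfolding N_def by (intro nn_integral_square_add_le) auto
      also have "(\<integral>\<^sup>+\<omega>. ennreal ((lam * (LINT s:{0..t}|lborel. Z s \<omega>))\<^sup>2) \<partial>M)
          = ennreal (lam\<^sup>2) * (\<integral>\<^sup>+\<omega>. ennreal ((LINT s:{0..t}|lborel. Z s \<omega>)\<^sup>2) \<partial>M)"
        by (simp add: power_mult_distrib ennreal_mult nn_integral_cmult)
      also have "(\<integral>\<^sup>+\<omega>. ennreal ((LINT s:{0..t}|lborel. Z s \<omega>)\<^sup>2) \<partial>M) \<le> ennreal t * ?E t"
        using t by (intro set_integral_process_second_moment_le L2_locD(1)[OF Z]) auto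
      also have "\<dots> \<le> ennreal T * ?E T"
        using t by (intro mult_mono nn_integral_mono) (auto simp: indicator_def intro: ennreal_leI)
      also note C[OF t]
      finally show ?thesis by (simp add: add_mono mult_left_mono)
    qed
    moreover have "?B < \<infinity>"
      using L2_locD(3)[OF Z T] by (simp add: ennreal_mult_less_top)
    ultimately show ?thesis using that by blast
  qed
  \<comment> \<open>Fubini's theorem for this kernel transfers the zero weighted mean from each
    fixed time to the discounted time integral of N; the uniform bound \<open>B\<close> supplies its
    integrability.\<close>
  define f where "f \<omega> s = \<zeta> \<omega> * (indicator {0..T} s * (exp (- r * s) * N' s \<omega>))" for \<omega> s
  have fm [measurable]: "case_prod f \<in> borel_measurable (M \<Otimes>\<^sub>M lborel)"
  proof -
    have "(\<lambda>z. \<zeta> (fst z) * (indicator {0..T} (snd z) * (exp (- r * snd z) * N' (snd z) (fst z))))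
        \<in> borel_measurable (M \<Otimes>\<^sub>M lborel)" by measurable
    then show ?thesis by (simp add: f_def case_prod_beta')
  qed
  have int_f: "integrable (M \<Otimes>\<^sub>M lborel) (case_prod f)"
  proof (rule integrableI_bounded[OF fm])
    let ?K = "ennreal (exp (\<bar>r\<bar> * T)) * ((\<integral>\<^sup>+\<omega>. ennreal ((\<zeta> \<omega>)\<^sup>2) \<partial>M) + B)"
    have inner: "(\<integral>\<^sup>+\<omega>. ennreal (norm (f \<omega> s)) \<partial>M) \<le> ?K * indicator {0..T} s" for s
    proof (cases "s \<in> {0..T}")
      case True
      have e: "exp (- r * s) \<le> exp (\<bar>r\<bar> * T)"
        using True mult_mono[of "- r" "\<bar>r\<bar>" s T] by auto
      have "norm (f \<omega> s) \<le> exp (\<bar>r\<bar> * T) * ((\<zeta> \<omega>)\<^sup>2 + (N' s \<omega>)\<^sup>2)" for \<omega>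
      proof -
        have "2 * (\<bar>\<zeta> \<omega>\<bar> * \<bar>N' s \<omega>\<bar>) \<le> (\<zeta> \<omega>)\<^sup>2 + (N' s \<omega>)\<^sup>2"
          using sum_squares_bound[of "\<bar>\<zeta> \<omega>\<bar>" "\<bar>N' s \<omega>\<bar>"] by simp
        moreover have "0 \<le> \<bar>\<zeta> \<omega>\<bar> * \<bar>N' s \<omega>\<bar>" by simp
        ultimately have "\<bar>\<zeta> \<omega>\<bar> * \<bar>N' s \<omega>\<bar> \<le> (\<zeta> \<omega>)\<^sup>2 + (N' s \<omega>)\<^sup>2" by linarith
        then have "exp (- r * s) * (\<bar>\<zeta> \<omega>\<bar> * \<bar>N' s \<omega>\<bar>) \<le> exp (\<bar>r\<bar> * T) * ((\<zeta> \<omega>)\<^sup>2 + (N' s \<omega>)\<^sup>2)"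
          using e by (intro mult_mono) auto
        then show ?thesis using True by (simp add: f_def abs_mult mult_ac)
      qed
      then have "(\<integral>\<^sup>+\<omega>. ennreal (norm (f \<omega> s)) \<partial>M)
          \<le> (\<integral>\<^sup>+\<omega>. ennreal (exp (\<bar>r\<bar> * T)) * (ennreal ((\<zeta> \<omega>)\<^sup>2) + ennreal ((N' s \<omega>)\<^sup>2)) \<partial>M)"
        by (intro nn_integral_mono) (metis ennreal_leI ennreal_mult ennreal_plus exp_ge_zero zero_le_power2 add_nonneg_nonneg)
      also have "\<dots> = ennreal (exp (\<bar>r\<bar> * T)) * ((\<integral>\<^sup>+\<omega>. ennreal ((\<zeta> \<omega>)\<^sup>2) \<partial>M) + (\<integral>\<^sup>+\<omega>. ennreal ((N' s \<omega>)\<^sup>2) \<partial>M))"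
        by (simp add: nn_integral_add nn_integral_cmult)
      also have "\<dots> \<le> ?K" using B(1)[OF True] by (intro mult_left_mono add_left_mono) auto
      finally show ?thesis using True by simp
    qed (simp add: f_def)
    have "(\<integral>\<^sup>+z. ennreal (norm (case_prod f z)) \<partial>(M \<Otimes>\<^sub>M lborel)) = (\<integral>\<^sup>+s. (\<integral>\<^sup>+\<omega>. ennreal (norm (f \<omega> s)) \<partial>M) \<partial>lborel)"
      by (subst P.nn_integral_snd[symmetric]) auto
    also have "\<dots> \<le> (\<integral>\<^sup>+s. ?K * indicator {0..T} s \<partial>lborel)" by (intro nn_integral_mono inner)
    also have "\<dots> = ?K * ennreal T" using T by (subst nn_integral_cmult) auto
    also have "\<dots> < \<infinity>"
      using \<zeta>sq B(2) by (simp add: ennreal_mult_less_top integrable_iff_bounded)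
    finally show "(\<integral>\<^sup>+z. ennreal (norm (case_prod f z)) \<partial>(M \<Otimes>\<^sub>M lborel)) < \<infinity>" .
  qed
  have f_path: "(\<integral>s. f \<omega> s \<partial>lborel) = \<zeta> \<omega> * (LINT s:{0..T}|lborel. exp (- r * s) * N' s \<omega>)" for \<omega>
    by (simp add: f_def set_lebesgue_integral_def)
  have "(\<integral>\<omega>. f \<omega> s \<partial>M) = 0" for s
  proof (cases "s \<in> {0..T}")
    case True
    have "f \<omega> s = exp (- r * s) * (\<zeta> \<omega> * N' s \<omega>)" for \<omega> using True by (simp add: f_def)
    then show ?thesis using mean0[OF True] by (simp add: has_bochner_integral_iff)
  qed (simp add: f_def)
  then have "(\<integral>\<omega>. (\<integral>s. f \<omega> s \<partial>lborel) \<partial>M) = 0"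
    using P.Fubini_integral[OF int_f] by simp
  then have int_path: "has_bochner_integral M (\<lambda>\<omega>. \<zeta> \<omega> * (LINT s:{0..T}|lborel. exp (- r * s) * N' s \<omega>)) 0"
    using P.integrable_fst'[OF int_f] by (simp add: has_bochner_integral_iff f_path)
  \<comment> \<open>The pathwise upper bound for discounted consumption. Its two random terms have
    weighted mean 0 and the weight has mean 1, which leaves exactly x.\<close>
  define R where "R \<omega> = x + exp (- r * T) * N' T \<omega> + r * (LINT s:{0..T}|lborel. exp (- r * s) * N' s \<omega>)" for \<omega>
  have R: "has_bochner_integral M (\<lambda>\<omega>. \<zeta> \<omega> * R \<omega>) x"
  proof -
    have "has_bochner_integral M (\<lambda>\<omega>. x * \<zeta> \<omega> + exp (- r * T) * (\<zeta> \<omega> * N' T \<omega>)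
         + r * (\<zeta> \<omega> * (LINT s:{0..T}|lborel. exp (- r * s) * N' s \<omega>))) (x * 1 + exp (- r * T) * 0 + r * 0)"
      using mean0[of T] T by (intro has_bochner_integral_add has_bochner_integral_mult_right \<zeta>1 int_path) auto
    then show ?thesis by (simp add: R_def algebra_simps)
  qed
  have path: "0 \<le> (LINT s:{0..T}|lborel. exp (- r * s) * c s \<omega>)
      \<and> (LINT s:{0..T}|lborel. exp (- r * s) * c s \<omega>) \<le> R \<omega>
      \<and> (\<integral>\<^sup>+s\<in>{0..T}. ennreal (exp (- r * s) * c s \<omega>) \<partial>lborel) = ennreal (LINT s:{0..T}|lborel. exp (- r * s) * c s \<omega>)"
    if \<omega>: "\<omega> \<in> space M" "\<omega> \<notin> A" for \<omega>
  proof -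
    note G = good[OF \<omega>]
    have ci: "set_integrable lborel {0..T} (\<lambda>s. c s \<omega>)" and Zi: "set_integrable lborel {0..T} (\<lambda>s. Z s \<omega>)"
      using G by auto
    have rXc: "continuous_on {0..T} (\<lambda>s. r * X s \<omega>)"
      using G by (auto intro!: continuous_intros intro: continuous_on_subset)
    then have rX: "set_integrable lborel {0..T} (\<lambda>s. r * X s \<omega>)" by (rule borel_integrable_atLeastAtMost')
    have ec: "set_integrable lborel {0..T} (\<lambda>s. exp (- r * s) * c s \<omega>)"
    proof -
      note [measurable] = measurable_process_section[OF L1_loc_nonnegD(1)[OF c] \<omega>(1)]
      have "set_integrable lborel {0..T} (\<lambda>s. exp (- r * s) * c (max 0 s) \<omega>)"
        unfolding set_integrable_def
      proof (rule Bochner_Integration.integrable_bound)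
        show "integrable lborel (\<lambda>s. exp (\<bar>r\<bar> * T) * (indicator {0..T} s * c s \<omega>))"
          using ci by (simp add: set_integrable_def)
        have "- r * s \<le> \<bar>r\<bar> * T" if "s \<in> {0..T}" for s
          using that mult_mono[of "- r" "\<bar>r\<bar>" s T] by auto
        then show "AE s in lborel. norm (indicator {0..T} s *\<^sub>R (exp (- r * s) * c (max 0 s) \<omega>))
            \<le> norm (exp (\<bar>r\<bar> * T) * (indicator {0..T} s * c s \<omega>))"
          by (intro AE_I2) (auto simp: indicator_def abs_mult intro!: mult_right_mono)
      qed measurable
      then show ?thesis
        unfolding set_integrable_def
        by (rule Bochner_Integration.integrable_cong[THEN iffD1, rotated -1]) (auto simp: indicator_def)
    qed
    have nonneg: "0 \<le> exp (- r * s) * c s \<omega>" if "s \<in> {0..T}" for s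
      using L1_loc_nonnegD(3)[OF c _ \<omega>(1)] that by auto
    have Nc: "continuous_on {0..T} (\<lambda>s. r * exp (- r * s) * N s \<omega>)"
      by (intro continuous_intros NcontT \<omega>)
    \<comment> \<open>Subtracting N removes the stochastic integral together with the risk premium;
      what is left is a time integral, to which the integration by parts applies.\<close>
    have D: "X t \<omega> - N t \<omega> = x + (LINT s:{0..t}|lborel. r * X s \<omega> - c s \<omega>)" if t: "t \<in> {0..T}" for t
    proof -
      have sub: "set_integrable lborel {0..t} h" if "set_integrable lborel {0..T} h" for h :: "real \<Rightarrow> real"
        using set_integrable_subset[OF that, of "{0..t}"] t by auto
      have "(\<lambda>s. r * X s \<omega> + \<sigma> * lam * \<pi> s \<omega>) = (\<lambda>s. r * X s \<omega> + lam * Z s \<omega>)"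
        by (auto simp: Z_def)
      moreover have "(LINT s:{0..t}|lborel. r * X s \<omega> + lam * Z s \<omega>)
          = (LINT s:{0..t}|lborel. r * X s \<omega>) + lam * (LINT s:{0..t}|lborel. Z s \<omega>)"
        using sub[OF rX] sub[OF Zi] by (subst set_integral_add) auto
      moreover have "(LINT s:{0..t}|lborel. r * X s \<omega> - c s \<omega>)
          = (LINT s:{0..t}|lborel. r * X s \<omega>) - (LINT s:{0..t}|lborel. c s \<omega>)"
        using sub[OF rX] sub[OF ci] by (rule set_integral_diff)
      moreover have "X t \<omega> = x + (LINT s:{0..t}|lborel. r * X s \<omega> + \<sigma> * lam * \<pi> s \<omega>)
                     + I t \<omega> - (LINT s:{0..t}|lborel. c s \<omega>)"
        using G t by auto
      ultimately show ?thesis by (simp add: N_def)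
    qed
    have "exp (- r * T) * (X T \<omega> - N T \<omega>) = x + (LINT s:{0..T}|lborel. exp (- r * s) * (r * X s \<omega> - c s \<omega>))
        - (LINT s:{0..T}|lborel. r * exp (- r * s) * (X s \<omega> - N s \<omega>))"
      using T D rX ci by (intro discounted_integral_identity[where D="\<lambda>t. X t \<omega> - N t \<omega>"]) auto
    also have "(LINT s:{0..T}|lborel. exp (- r * s) * (r * X s \<omega> - c s \<omega>))
        = (LINT s:{0..T}|lborel. exp (- r * s) * (r * X s \<omega>)) - (LINT s:{0..T}|lborel. exp (- r * s) * c s \<omega>)"
    proof -
      have "set_integrable lborel {0..T} (\<lambda>s. exp (- r * s) * (r * X s \<omega>))"
        by (intro borel_integrable_atLeastAtMost' continuous_intros rXc)
      from set_integral_diff(2)[OF this ec] show ?thesis by (simp add: right_diff_distrib)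
    qed
    also have "(LINT s:{0..T}|lborel. r * exp (- r * s) * (X s \<omega> - N s \<omega>))
        = (LINT s:{0..T}|lborel. exp (- r * s) * (r * X s \<omega>)) - (LINT s:{0..T}|lborel. r * exp (- r * s) * N s \<omega>)"
    proof -
      have "set_integrable lborel {0..T} (\<lambda>s. exp (- r * s) * (r * X s \<omega>))"
        "set_integrable lborel {0..T} (\<lambda>s. r * exp (- r * s) * N s \<omega>)"
        by (intro borel_integrable_atLeastAtMost' continuous_intros rXc Nc NcontT[OF \<omega>])+
      from set_integral_diff(2)[OF this] show ?thesis by (simp add: algebra_simps)
    qed
    also have "(LINT s:{0..T}|lborel. r * exp (- r * s) * N s \<omega>) = r * (LINT s:{0..T}|lborel. exp (- r * s) * N' s \<omega>)"
    proof -
      have "(LINT s:{0..T}|lborel. r * exp (- r * s) * N s \<omega>) = (LINT s:{0..T}|lborel. r * (exp (- r * s) * N' s \<omega>))"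
        unfolding set_lebesgue_integral_def using \<omega>
        by (intro Bochner_Integration.integral_cong) (auto simp: indicator_def N'_def)
      then show ?thesis by simp
    qed
    finally have fin: "exp (- r * T) * (X T \<omega> - N T \<omega>)
        = x + ((LINT s:{0..T}|lborel. exp (- r * s) * (r * X s \<omega>)) - (LINT s:{0..T}|lborel. exp (- r * s) * c s \<omega>))
          - ((LINT s:{0..T}|lborel. exp (- r * s) * (r * X s \<omega>)) - r * (LINT s:{0..T}|lborel. exp (- r * s) * N' s \<omega>))" .
    have N'T: "N' T \<omega> = N T \<omega>" using \<omega> T by (simp add: N'_def)
    \<comment> \<open>The discounted integrals of r X on both sides cancel, so among the values of X
      only terminal wealth survives, and its sign is known.\<close>
    have "(LINT s:{0..T}|lborel. exp (- r * s) * c s \<omega>) = R \<omega> - exp (- r * T) * X T \<omega>"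
    proof -
      have "C = (x + e * n + r * l) - e * v" if "e * (v - n) = x + (b - C) - (b - r * l)"
        for e v n b C l :: real
        using that by (simp add: algebra_simps)
      from this[OF fin] show ?thesis unfolding R_def N'T .
    qed
    moreover have "0 \<le> exp (- r * T) * X T \<omega>"
    proof -
      have "\<forall>t\<ge>0. 0 \<le> X t \<omega>" using G by blast
      then show ?thesis using T by simp
    qed
    moreover have "0 \<le> (LINT s:{0..T}|lborel. exp (- r * s) * c s \<omega>)"
      unfolding set_lebesgue_integral_def using nonneg
      by (intro Bochner_Integration.integral_nonneg) (auto simp: indicator_def)
    moreover have "(\<integral>\<^sup>+s\<in>{0..T}. ennreal (exp (- r * s) * c s \<omega>) \<partial>lborel)
        = (\<integral>\<^sup>+s. ennreal (indicator {0..T} s *\<^sub>R (exp (- r * s) * c s \<omega>)) \<partial>lborel)"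
      by (intro nn_integral_cong) (auto simp: indicator_def)
    moreover have "\<dots> = ennreal (LINT s:{0..T}|lborel. exp (- r * s) * c s \<omega>)"
      unfolding set_lebesgue_integral_def using ec nonneg
      by (intro nn_integral_eq_integral) (auto simp: set_integrable_def indicator_def)
    ultimately show ?thesis by simp
  qed
  note cm [measurable] = measurable_process_max[OF L1_loc_nonnegD(1)[OF c]]
  note em [measurable] = exp_mart_jointly_measurable[of "- lam"]
  have "(\<integral>\<^sup>+\<omega>. (\<integral>\<^sup>+s\<in>{0..T}. ennreal (exp (- r * s) * exp_mart (- lam) s \<omega> * c s \<omega>) \<partial>lborel) \<partial>M)
     = (\<integral>\<^sup>+\<omega>. (\<integral>\<^sup>+s. ennreal (exp (- r * s) * exp_mart (- lam) (max 0 s) \<omega> * c (max 0 s) \<omega>) * indicator {0..T} s \<partial>lborel) \<partial>M)"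
    by (intro nn_integral_cong) (auto simp: indicator_def)
  \<comment> \<open>The order of integration is exchanged and restored below. In between, at fixed
    s, the weight at s becomes the weight at T, since \<open>c s\<close> is
    \<open>F s\<close>-measurable.\<close>
  also have "\<dots> = (\<integral>\<^sup>+s. (\<integral>\<^sup>+\<omega>. ennreal (exp (- r * s) * exp_mart (- lam) (max 0 s) \<omega> * c (max 0 s) \<omega>) * indicator {0..T} s \<partial>M) \<partial>lborel)"
  proof (rule P.Fubini'[symmetric])
    have "(\<lambda>z. ennreal (exp (- r * snd z) * exp_mart (- lam) (max 0 (snd z)) (fst z) * c (max 0 (snd z)) (fst z)) * indicator {0..T} (snd z))
      \<in> borel_measurable (M \<Otimes>\<^sub>M lborel)" by measurable
    then show "(\<lambda>(\<omega>, s). ennreal (exp (- r * s) * exp_mart (- lam) (max 0 s) \<omega> * c (max 0 s) \<omega>) * indicator {0..T} s)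
      \<in> borel_measurable (M \<Otimes>\<^sub>M lborel)" by (simp add: case_prod_beta')
  qed
  also have "\<dots> = (\<integral>\<^sup>+s. (\<integral>\<^sup>+\<omega>. ennreal (\<zeta> \<omega>) * (ennreal (exp (- r * s) * c (max 0 s) \<omega>) * indicator {0..T} s) \<partial>M) \<partial>lborel)"
  proof (rule nn_integral_cong)
    fix s :: real
    show "(\<integral>\<^sup>+\<omega>. ennreal (exp (- r * s) * exp_mart (- lam) (max 0 s) \<omega> * c (max 0 s) \<omega>) * indicator {0..T} s \<partial>M)
       = (\<integral>\<^sup>+\<omega>. ennreal (\<zeta> \<omega>) * (ennreal (exp (- r * s) * c (max 0 s) \<omega>) * indicator {0..T} s) \<partial>M)"
    proof (cases "s \<in> {0..T}")
      case True
      then have ms: "max 0 s = s" by auto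
      have cF: "c s \<in> borel_measurable (F s)" using L1_loc_nonnegD(2)[OF c] True by (auto simp: adapted_def)
      have "(\<integral>\<^sup>+\<omega>. ennreal (exp (- r * s) * exp_mart (- lam) s \<omega> * c s \<omega>) \<partial>M)
          = (\<integral>\<^sup>+\<omega>. ennreal (exp (- r * s) * c s \<omega>) * ennreal (exp_mart (- lam) s \<omega>) \<partial>M)"
        using True L1_loc_nonnegD(3)[OF c] exp_mart_pos
        by (intro nn_integral_cong, subst ennreal_mult[symmetric]) (auto simp: mult_ac less_imp_le)
      also have "\<dots> = (\<integral>\<^sup>+\<omega>. ennreal (exp (- r * s) * c s \<omega>) * ennreal (exp_mart (- lam) T \<omega>) \<partial>M)"
        using True cF by (intro exp_mart_nn_integral[symmetric]) auto
      finally show ?thesis using True unfolding ms by (simp add: \<zeta>_def mult.commute)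
    qed simp
  qed
  also have "\<dots> = (\<integral>\<^sup>+\<omega>. (\<integral>\<^sup>+s. ennreal (\<zeta> \<omega>) * (ennreal (exp (- r * s) * c (max 0 s) \<omega>) * indicator {0..T} s) \<partial>lborel) \<partial>M)"
  proof (rule P.Fubini')
    have "(\<lambda>z. ennreal (\<zeta> (fst z)) * (ennreal (exp (- r * snd z) * c (max 0 (snd z)) (fst z)) * indicator {0..T} (snd z)))
      \<in> borel_measurable (M \<Otimes>\<^sub>M lborel)" by measurable
    then show "(\<lambda>(\<omega>, s). ennreal (\<zeta> \<omega>) * (ennreal (exp (- r * s) * c (max 0 s) \<omega>) * indicator {0..T} s))
      \<in> borel_measurable (M \<Otimes>\<^sub>M lborel)" by (simp add: case_prod_beta')
  qed
  also have "\<dots> \<le> (\<integral>\<^sup>+\<omega>. ennreal (\<zeta> \<omega> * R \<omega>) \<partial>M)"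
  proof (rule nn_integral_mono_AE)
    show "AE \<omega> in M. (\<integral>\<^sup>+s. ennreal (\<zeta> \<omega>) * (ennreal (exp (- r * s) * c (max 0 s) \<omega>) * indicator {0..T} s) \<partial>lborel)
        \<le> ennreal (\<zeta> \<omega> * R \<omega>)"
      using notA AE_space
    proof eventually_elim
      fix \<omega> assume \<omega>: "\<omega> \<notin> A" "\<omega> \<in> space M"
      note [measurable] = measurable_process_section[OF L1_loc_nonnegD(1)[OF c] \<omega>(2)]
      note p = path[OF \<omega>(2,1)]
      have "(\<integral>\<^sup>+s. ennreal (\<zeta> \<omega>) * (ennreal (exp (- r * s) * c (max 0 s) \<omega>) * indicator {0..T} s) \<partial>lborel)
        = ennreal (\<zeta> \<omega>) * (\<integral>\<^sup>+s. ennreal (exp (- r * s) * c (max 0 s) \<omega>) * indicator {0..T} s \<partial>lborel)"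
        by (rule nn_integral_cmult) measurable
      also have "(\<integral>\<^sup>+s. ennreal (exp (- r * s) * c (max 0 s) \<omega>) * indicator {0..T} s \<partial>lborel)
          = (\<integral>\<^sup>+s\<in>{0..T}. ennreal (exp (- r * s) * c s \<omega>) \<partial>lborel)"
        by (intro nn_integral_cong) (auto simp: indicator_def)
      also have "\<dots> = ennreal (LINT s:{0..T}|lborel. exp (- r * s) * c s \<omega>)" using p by simp
      also have "\<dots> \<le> ennreal (R \<omega>)" using p by (intro ennreal_leI) simp
      also have "ennreal (\<zeta> \<omega>) * ennreal (R \<omega>) = ennreal (\<zeta> \<omega> * R \<omega>)"
        using \<zeta>pos[of \<omega>] p by (intro ennreal_mult[symmetric]) auto
      finally show "(\<integral>\<^sup>+s. ennreal (\<zeta> \<omega>) * (ennreal (exp (- r * s) * c (max 0 s) \<omega>) * indicator {0..T} s) \<partial>lborel)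
        \<le> ennreal (\<zeta> \<omega> * R \<omega>)" by (simp add: mult_left_mono)
    qed
  qed
  also have "\<dots> = ennreal (\<integral>\<omega>. \<zeta> \<omega> * R \<omega> \<partial>M)"
  proof (rule nn_integral_eq_integral)
    show "AE \<omega> in M. 0 \<le> \<zeta> \<omega> * R \<omega>"
      using notA AE_space
    proof eventually_elim
      fix \<omega> assume "\<omega> \<notin> A" "\<omega> \<in> space M"
      then have "0 \<le> R \<omega>" using path[of \<omega>] by linarith
      then show "0 \<le> \<zeta> \<omega> * R \<omega>" using \<zeta>pos[of \<omega>] by simp
    qed
  qed (use R in \<open>simp add: has_bochner_integral_iff\<close>)
  finally show ?thesis using R by (simp add: has_bochner_integral_iff)
qed

end

text \<open>Young's inequality with weights (\<gamma> - 1) / \<gamma> and 1 / \<gamma> on the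
  numbers z c and c^(1-\<gamma>): in their weighted geometric mean the powers of c cancel. Equality
  holds for z = c^(-\<gamma>), the marginal utility.\<close>

lemma crra_conjugate_le:
  fixes \<gamma> c z :: real
  assumes \<gamma>: "1 < \<gamma>" and z: "0 < z" and c: "0 < c"
  shows "\<gamma> / (\<gamma> - 1) * z powr ((\<gamma> - 1) / \<gamma>) \<le> c powr (1 - \<gamma>) / (\<gamma> - 1) + z * c"
proof -
  let ?p = "(\<gamma> - 1) / \<gamma>"
  have "(z * c) powr ?p * (c powr (1 - \<gamma>)) powr (1 / \<gamma>) \<le> ?p * (z * c) + 1 / \<gamma> * c powr (1 - \<gamma>)"
    using assms by (intro Youngs_inequality_0) (auto simp: field_simps)
  also have "(z * c) powr ?p * (c powr (1 - \<gamma>)) powr (1 / \<gamma>) = z powr ?p * (c powr ?p * c powr ((1 - \<gamma>) / \<gamma>))"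
    using z c by (simp add: powr_mult powr_powr)
  also have "c powr ?p * c powr ((1 - \<gamma>) / \<gamma>) = c powr 0"
    by (simp flip: powr_add add_divide_distrib)
  finally have "z powr ?p \<le> ?p * (z * c) + 1 / \<gamma> * c powr (1 - \<gamma>)" using c by simp
  then have "\<gamma> / (\<gamma> - 1) * z powr ?p \<le> \<gamma> / (\<gamma> - 1) * (?p * (z * c) + 1 / \<gamma> * c powr (1 - \<gamma>))"
    using \<gamma> by (intro mult_left_mono) auto
  also have "\<dots> = c powr (1 - \<gamma>) / (\<gamma> - 1) + z * c"
    using \<gamma> by (simp add: distrib_left)
  finally show ?thesis .
qed

lemma nn_integral_exp_Icc:
  fixes a K T :: real
  assumes "0 < a" "0 \<le> K" "0 \<le> T"
  shows "(\<integral>\<^sup>+s\<in>{0..T}. ennreal (K * exp (- a * s)) \<partial>lborel) = ennreal (K / a * (1 - exp (- a * T)))"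
proof -
  have "(\<integral>\<^sup>+s. ennreal (K * exp (- a * s)) * indicator {0..T} s \<partial>lborel)
      = ennreal ((K / a * (1 - exp (- a * T))) - (K / a * (1 - exp (- a * 0))))"
    using assms by (intro nn_integral_FTC_Icc) (auto intro!: derivative_eq_intros simp: field_simps)
  then show ?thesis by simp
qed

context continuous_brownian_motion
begin

lemma exp_mart_powr_nn_integral:
  assumes "0 \<le> t"
  shows "(\<integral>\<^sup>+\<omega>. ennreal (exp_mart p t \<omega> powr q) \<partial>M) = ennreal (exp ((q\<^sup>2 - q) * p\<^sup>2 * t / 2))"
proof -
  have "exp_mart p t \<omega> powr q = exp (q * (p * W t \<omega> - p\<^sup>2 * t / 2))" for \<omega>
    by (simp add: exp_mart_def powr_def)
  then show ?thesis
    using exp_mart_moment[OF assms, of q p]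
    by (simp add: nn_integral_eq_integral has_bochner_integral_iff)
qed

text \<open>Lagrangian duality: utility is traded against the cost of consumption at a fixed
  multiplier, and the budget constraint bounds the total cost.\<close>

lemma objective_le:
  fixes r \<rho> \<sigma> lam \<gamma> x a :: real
  assumes \<gamma>: "\<gamma> > 1" and x: "x > 0"
    and a: "a = (\<rho> - (1 - \<gamma>) * (r + lam\<^sup>2 / (2 * \<gamma>))) / \<gamma>" "a > 0"
    and adm: "(c, \<pi>) \<in> admissible M F W r \<sigma> lam x"
  shows "objective M \<rho> \<gamma> c \<le> ereal (a powr (- \<gamma>) * x powr (1 - \<gamma>) / (1 - \<gamma>))"
proof -
  interpret P: pair_sigma_finite M lborel by unfold_locales
  obtain X where c: "c \<in> L1_loc_nonneg M F" and \<pi>: "\<pi> \<in> L2_loc M F"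
    and X: "wealth_process M F W r \<sigma> lam x c \<pi> X" and pos: "AE \<omega> in M. \<forall>t\<ge>0. 0 \<le> X t \<omega>"
    using adm by (auto simp: admissible_def)
  define U where "U s \<omega> = e2ennreal (- (ereal (exp (- \<rho> * s)) * crra_utility \<gamma> (c s \<omega>)))" for s \<omega>
  define J where "J = (\<integral>\<^sup>+\<omega>. (\<integral>\<^sup>+s\<in>{0..}. U s \<omega> \<partial>lborel) \<partial>M)"
  define p where "p = (\<gamma> - 1) / \<gamma>"
  \<comment> \<open>The Lagrange multiplier: marginal utility at a x, the initial consumption of the
    optimal strategy.\<close>
  define y where "y = (a * x) powr (- \<gamma>)"
  define K where "K = \<gamma> / (\<gamma> - 1) * y powr p"
  have y: "0 < y" using a(2) x by (simp add: y_def)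
  have K: "0 < K" using \<gamma> y by (simp add: K_def)
  define B where "B s \<omega> = ennreal (y * (exp (- r * s) * exp_mart (- lam) (max 0 s) \<omega> * c (max 0 s) \<omega>))" for s \<omega>
  define C where "C s \<omega> = ennreal (K * exp ((p * (\<rho> - r) - \<rho>) * s) * exp_mart (- lam) (max 0 s) \<omega> powr p)" for s \<omega>
  note [measurable] = measurable_process_max[OF L1_loc_nonnegD(1)[OF c]] exp_mart_jointly_measurable[of "- lam"]
  have Bm [measurable]: "(\<lambda>z. B (snd z) (fst z)) \<in> borel_measurable (M \<Otimes>\<^sub>M lborel)"
    unfolding B_def by measurable
  have Cm [measurable]: "(\<lambda>z. C (snd z) (fst z)) \<in> borel_measurable (M \<Otimes>\<^sub>M lborel)"
    unfolding C_def by measurable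
  have Cfin: "C s \<omega> \<noteq> top" for s \<omega> by (simp add: C_def)
  have CB: "C s \<omega> \<le> (C s \<omega> - B s \<omega>) + B s \<omega>" for s \<omega>
    using ennreal_minus_le_iff[of "C s \<omega>" "B s \<omega>" "C s \<omega> - B s \<omega>"] Cfin[of s \<omega>] by (simp add: add.commute)
  \<comment> \<open>Truncated subtraction in \<open>ennreal\<close> keeps the lower bound jointly
    measurable by construction; the integral is then split for C - B and B, and U enters only
    through monotonicity.\<close>
  have dual: "C s \<omega> - B s \<omega> \<le> U s \<omega>" if s: "0 \<le> s" and \<omega>: "\<omega> \<in> space M" for s \<omega>
  proof (cases "c s \<omega> = 0")
    \<comment> \<open>Zero consumption has utility minus infinity by convention, so its negation
      dominates everything.\<close>
    case True
    then have "U s \<omega> = \<infinity>" by (simp add: U_def crra_utility_def)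
    then show ?thesis by simp
  next
    case False
    then have cpos: "0 < c s \<omega>" using L1_loc_nonnegD(3)[OF c s \<omega>] by simp
    define \<zeta> where "\<zeta> = exp_mart (- lam) s \<omega>"
    have \<zeta>: "0 < \<zeta>" by (simp add: \<zeta>_def exp_mart_pos)
    define z where "z = y * exp ((\<rho> - r) * s) * \<zeta>"
    have z: "0 < z" using y \<zeta> by (simp add: z_def)
    have U: "U s \<omega> = ennreal (exp (- \<rho> * s) * (c s \<omega> powr (1 - \<gamma>) / (\<gamma> - 1)))"
    proof -
      have "- (ereal (exp (- \<rho> * s)) * crra_utility \<gamma> (c s \<omega>))
          = ereal (exp (- \<rho> * s) * (c s \<omega> powr (1 - \<gamma>) / (\<gamma> - 1)))"
        using False \<gamma> by (simp add: crra_utility_def field_simps)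
      then show ?thesis by (simp add: U_def e2ennreal_ereal)
    qed
    have "exp (- \<rho> * s) * (\<gamma> / (\<gamma> - 1) * z powr p)
        \<le> exp (- \<rho> * s) * (c s \<omega> powr (1 - \<gamma>) / (\<gamma> - 1) + z * c s \<omega>)"
      unfolding p_def by (intro mult_left_mono crra_conjugate_le \<gamma> z cpos) auto
    moreover have "exp (- \<rho> * s) * (\<gamma> / (\<gamma> - 1) * z powr p) = K * exp ((p * (\<rho> - r) - \<rho>) * s) * \<zeta> powr p"
    proof -
      have "z powr p = y powr p * exp (p * (\<rho> - r) * s) * \<zeta> powr p"
      proof -
        have "exp ((\<rho> - r) * s) powr p = exp (p * (\<rho> - r) * s)" by (simp add: powr_def mult.assoc)
        then show ?thesis using y \<zeta> by (simp add: z_def powr_mult)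
      qed
      moreover have "exp (- \<rho> * s) * exp (p * (\<rho> - r) * s) = exp ((p * (\<rho> - r) - \<rho>) * s)"
        by (simp add: algebra_simps flip: exp_add)
      ultimately show ?thesis by (simp add: K_def mult_ac)
    qed
    moreover have "exp (- \<rho> * s) * (z * c s \<omega>) = y * (exp (- r * s) * \<zeta> * c s \<omega>)"
    proof -
      have "exp (- \<rho> * s) * exp ((\<rho> - r) * s) = exp (- r * s)"
        by (simp add: algebra_simps flip: exp_add)
      then show ?thesis by (simp add: z_def mult_ac)
    qed
    ultimately have le: "K * exp ((p * (\<rho> - r) - \<rho>) * s) * \<zeta> powr p
        \<le> exp (- \<rho> * s) * (c s \<omega> powr (1 - \<gamma>) / (\<gamma> - 1)) + y * (exp (- r * s) * \<zeta> * c s \<omega>)"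
      by (simp only: distrib_left)
    have ms: "max 0 s = s" using s by simp
    have "C s \<omega> \<le> ennreal (exp (- \<rho> * s) * (c s \<omega> powr (1 - \<gamma>) / (\<gamma> - 1)) + y * (exp (- r * s) * \<zeta> * c s \<omega>))"
      unfolding C_def ms \<zeta>_def[symmetric] using le by (rule ennreal_leI)
    also have "\<dots> = U s \<omega> + B s \<omega>"
      unfolding B_def U ms \<zeta>_def[symmetric] using cpos y \<zeta> \<gamma> by (intro ennreal_plus) auto
    finally show ?thesis
      using Cfin by (simp add: ennreal_minus_le_iff add.commute)
  qed
  have pair_eq: "(\<integral>\<^sup>+\<omega>. (\<integral>\<^sup>+s. g s \<omega> \<partial>lborel) \<partial>M) = (\<integral>\<^sup>+z. g (snd z) (fst z) \<partial>(M \<Otimes>\<^sub>M lborel))"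
    if "(\<lambda>z. g (snd z) (fst z)) \<in> borel_measurable (M \<Otimes>\<^sub>M lborel)" for g :: "real \<Rightarrow> 'a \<Rightarrow> ennreal"
    using lborel.nn_integral_fst[OF that] by simp
  have main: "ennreal (K / a * (1 - exp (- a * T))) \<le> J + ennreal (y * x)" if T: "0 < T" for T
  proof -
    let ?I = "\<lambda>s. indicator {0..T} s :: ennreal"
    have "(\<integral>\<^sup>+\<omega>. C s \<omega> \<partial>M) = ennreal (K * exp (- a * s))" if "0 \<le> s" for s
    proof -
      have [measurable]: "exp_mart (- lam) s \<in> borel_measurable M" using that by simp
      have "(\<integral>\<^sup>+\<omega>. C s \<omega> \<partial>M)
          = (\<integral>\<^sup>+\<omega>. ennreal (K * exp ((p * (\<rho> - r) - \<rho>) * s)) * ennreal (exp_mart (- lam) s \<omega> powr p) \<partial>M)"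
        using that K by (intro nn_integral_cong) (simp add: C_def ennreal_mult)
      also have "\<dots> = ennreal (K * exp ((p * (\<rho> - r) - \<rho>) * s)) * ennreal (exp ((p\<^sup>2 - p) * (- lam)\<^sup>2 * s / 2))"
        using that by (subst nn_integral_cmult) (auto simp: exp_mart_powr_nn_integral)
      also have "\<dots> = ennreal (K * (exp ((p * (\<rho> - r) - \<rho>) * s) * exp ((p\<^sup>2 - p) * (- lam)\<^sup>2 * s / 2)))"
        using K by (simp add: ennreal_mult mult.assoc)
      also have "exp ((p * (\<rho> - r) - \<rho>) * s) * exp ((p\<^sup>2 - p) * (- lam)\<^sup>2 * s / 2) = exp (- a * s)"
      proof -
        \<comment> \<open>The rate \<open>a\<close> appears here as the exponential decay rate of
          the mean of the conjugate term; its positivity makes the integral over all times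
          finite.\<close>
        have "(p * (\<rho> - r) - \<rho>) + (p\<^sup>2 - p) * lam\<^sup>2 / 2 = - a"
          unfolding a(1) p_def using \<gamma> by (simp add: field_simps power2_eq_square)
        then have "((p * (\<rho> - r) - \<rho>) + (p\<^sup>2 - p) * lam\<^sup>2 / 2) * s = - a * s" by simp
        then have "(p * (\<rho> - r) - \<rho>) * s + (p\<^sup>2 - p) * (- lam)\<^sup>2 * s / 2 = - a * s"
          by (simp add: distrib_right)
        then show ?thesis by (metis exp_add)
      qed
      finally show ?thesis .
    qed
    then have "ennreal (K / a * (1 - exp (- a * T))) = (\<integral>\<^sup>+s. (\<integral>\<^sup>+\<omega>. C s \<omega> * ?I s \<partial>M) \<partial>lborel)"
      using a(2) K T by (subst nn_integral_exp_Icc[symmetric]) (auto intro!: nn_integral_cong simp: indicator_def)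
    also have "\<dots> = (\<integral>\<^sup>+\<omega>. (\<integral>\<^sup>+s. C s \<omega> * ?I s \<partial>lborel) \<partial>M)"
    proof (rule P.Fubini')
      have "(\<lambda>z. C (snd z) (fst z) * indicator {0..T} (snd z)) \<in> borel_measurable (M \<Otimes>\<^sub>M lborel)"
        using Cm by measurable
      then show "(\<lambda>(\<omega>, s). C s \<omega> * ?I s) \<in> borel_measurable (M \<Otimes>\<^sub>M lborel)" by (simp add: case_prod_beta')
    qed
    also have "\<dots> = (\<integral>\<^sup>+z. C (snd z) (fst z) * ?I (snd z) \<partial>(M \<Otimes>\<^sub>M lborel))"
      by (rule pair_eq) measurable
    also have "\<dots> \<le> (\<integral>\<^sup>+z. (C (snd z) (fst z) - B (snd z) (fst z)) * ?I (snd z) + B (snd z) (fst z) * ?I (snd z) \<partial>(M \<Otimes>\<^sub>M lborel))"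
      by (intro nn_integral_mono) (auto simp: indicator_def CB)
    also have "\<dots> = (\<integral>\<^sup>+z. (C (snd z) (fst z) - B (snd z) (fst z)) * ?I (snd z) \<partial>(M \<Otimes>\<^sub>M lborel))
        + (\<integral>\<^sup>+z. B (snd z) (fst z) * ?I (snd z) \<partial>(M \<Otimes>\<^sub>M lborel))"
      by (rule nn_integral_add) measurable
    also have "\<dots> \<le> J + ennreal (y * x)"
    proof (rule add_mono)
      have "(\<integral>\<^sup>+z. (C (snd z) (fst z) - B (snd z) (fst z)) * ?I (snd z) \<partial>(M \<Otimes>\<^sub>M lborel))
          = (\<integral>\<^sup>+\<omega>. (\<integral>\<^sup>+s. (C s \<omega> - B s \<omega>) * ?I s \<partial>lborel) \<partial>M)"
        by (rule pair_eq[symmetric]) measurable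
      also have "\<dots> \<le> J"
        unfolding J_def using dual by (intro nn_integral_mono) (auto simp: indicator_def)
      finally show "(\<integral>\<^sup>+z. (C (snd z) (fst z) - B (snd z) (fst z)) * ?I (snd z) \<partial>(M \<Otimes>\<^sub>M lborel)) \<le> J" .
      let ?b = "\<lambda>s \<omega>. ennreal (exp (- r * s) * exp_mart (- lam) (max 0 s) \<omega> * c (max 0 s) \<omega>) * ?I s"
      have bm: "(\<lambda>z. ?b (snd z) (fst z)) \<in> borel_measurable (M \<Otimes>\<^sub>M lborel)" by measurable
      have "(\<integral>\<^sup>+z. B (snd z) (fst z) * ?I (snd z) \<partial>(M \<Otimes>\<^sub>M lborel))
          = (\<integral>\<^sup>+z. ennreal y * ?b (snd z) (fst z) \<partial>(M \<Otimes>\<^sub>M lborel))"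
        using y by (intro nn_integral_cong) (simp add: B_def ennreal_mult' mult.assoc)
      also have "\<dots> = ennreal y * (\<integral>\<^sup>+z. ?b (snd z) (fst z) \<partial>(M \<Otimes>\<^sub>M lborel))"
        using bm by (rule nn_integral_cmult)
      also have "(\<integral>\<^sup>+z. ?b (snd z) (fst z) \<partial>(M \<Otimes>\<^sub>M lborel)) = (\<integral>\<^sup>+\<omega>. (\<integral>\<^sup>+s. ?b s \<omega> \<partial>lborel) \<partial>M)"
        using bm by (rule pair_eq[symmetric])
      also have "\<dots> = (\<integral>\<^sup>+\<omega>. (\<integral>\<^sup>+s\<in>{0..T}. ennreal (exp (- r * s) * exp_mart (- lam) s \<omega> * c s \<omega>) \<partial>lborel) \<partial>M)"
        by (intro nn_integral_cong) (auto simp: indicator_def)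
      also have "\<dots> \<le> ennreal x" by (rule budget_constraint[OF c \<pi> X pos T])
      finally show "(\<integral>\<^sup>+z. B (snd z) (fst z) * ?I (snd z) \<partial>(M \<Otimes>\<^sub>M lborel)) \<le> ennreal (y * x)"
        using x y by (simp add: ennreal_mult mult_left_mono)
    qed
    finally show ?thesis .
  qed
  have obj: "objective M \<rho> \<gamma> c = - enn2ereal J"
    by (simp add: objective_def J_def U_def)
  \<comment> \<open>With Q = a^(-\<gamma>) x^(1-\<gamma>), the dual value is \<gamma> Q / (\<gamma>
    - 1) and the budget term is Q; the multiplier was chosen to produce a common Q.\<close>
  have Kay: "K / a - y * x = a powr (- \<gamma>) * x powr (1 - \<gamma>) / (\<gamma> - 1)"
  proof -
    define Q where "Q = a powr (- \<gamma>) * x powr (1 - \<gamma>)"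
    have "y powr p = (a * x) powr (1 - \<gamma>)"
      using \<gamma> by (simp add: y_def p_def powr_powr)
    also have "\<dots> = a powr (1 - \<gamma>) * x powr (1 - \<gamma>)" using a(2) x by (simp add: powr_mult)
    also have "a powr (1 - \<gamma>) = a powr 1 * a powr (- \<gamma>)" by (subst powr_add[symmetric]) simp
    finally have "y powr p = a * Q" using a(2) by (simp add: Q_def)
    moreover have "y * x = Q"
    proof -
      have "y * x = a powr (- \<gamma>) * (x powr (- \<gamma>) * x powr 1)" using a(2) x by (simp add: y_def powr_mult)
      also have "x powr (- \<gamma>) * x powr 1 = x powr (1 - \<gamma>)" by (subst powr_add[symmetric]) simp
      finally show ?thesis by (simp add: Q_def)
    qed
    ultimately have "K / a - y * x = \<gamma> / (\<gamma> - 1) * Q - Q" using a(2) by (simp add: K_def)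
    also have "\<dots> = Q / (\<gamma> - 1)" using \<gamma> by (simp add: field_simps)
    finally show ?thesis by (simp add: Q_def)
  qed
  show ?thesis
  proof (cases J)
    case top
    then show ?thesis unfolding obj by simp
  next
    case (real j)
    \<comment> \<open>The right-hand side does not depend on T, so the horizon can be sent to
      infinity.\<close>
    have "K / a * (1 - exp (- a * T)) \<le> j + y * x" if "0 < T" for T
      using main[OF that] real x y by (simp add: ennreal_plus[symmetric] ennreal_le_iff del: ennreal_plus)
    then have ev: "\<forall>\<^sub>F T in at_top. K / a * (1 - exp (- a * T)) \<le> j + y * x"
      by (rule eventually_mono[OF eventually_gt_at_top[of 0]])
    have "filterlim (\<lambda>T. - a * T) at_bot at_top"
      using a(2) by (intro filterlim_tendsto_neg_mult_at_bot[OF tendsto_const _ filterlim_ident]) simp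
    then have "((\<lambda>T. exp (- a * T)) \<longlongrightarrow> 0) at_top"
      by (rule filterlim_compose[OF exp_at_bot])
    then have "((\<lambda>T. K / a * (1 - exp (- a * T))) \<longlongrightarrow> K / a * (1 - 0)) at_top"
      by (intro tendsto_intros)
    from tendsto_upperbound[OF this ev] have "K / a \<le> j + y * x" by simp
    then have "- j \<le> a powr (- \<gamma>) * x powr (1 - \<gamma>) / (1 - \<gamma>)"
      using Kay minus_divide_right[of "a powr (- \<gamma>) * x powr (1 - \<gamma>)" "\<gamma> - 1"] by simp
    then show ?thesis unfolding obj using real by (simp add: enn2ereal_ennreal)
  qed
qed

end

section \<open>The Ito integral of geometric Brownian motion\<close>

lemma integrable_nonneg_bound:
  fixes f b :: "'a \<Rightarrow> real"
  assumes "integrable M b" "f \<in> borel_measurable M" "\<And>x. 0 \<le> f x" "\<And>x. f x \<le> b x"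
  shows "integrable M f"
proof (rule Bochner_Integration.integrable_bound[OF assms(1,2)])
  show "AE x in M. norm (f x) \<le> norm (b x)"
    using assms(3,4) order_trans[OF assms(3,4)] by (intro AE_I2) (simp add: abs_of_nonneg)
qed

section \<open>Second moments for the stochastic exponential and its expansion\<close>

context continuous_brownian_motion
begin

text \<open>By the martingale property the mixed moment equals the second moment at the earlier time
  u, so the square expands to a difference of second moments.\<close>

lemma exp_mart_diff_second_moment:
  assumes us: "0 \<le> u" "u \<le> s"
  shows "has_bochner_integral M (\<lambda>\<omega>. (exp_mart p s \<omega> - exp_mart p u \<omega>)\<^sup>2) (exp (p\<^sup>2 * s) - exp (p\<^sup>2 * u))"
proof -
  have sq: "has_bochner_integral M (\<lambda>\<omega>. (exp_mart p v \<omega>)\<^sup>2) (exp (p\<^sup>2 * v))" if "0 \<le> v" for v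
    using exp_mart_power_moment[OF that, of p 2] by simp
  have "has_bochner_integral M (\<lambda>\<omega>. exp_mart p u \<omega> * exp_mart p s \<omega>) (exp (p\<^sup>2 * u))"
    using sq[OF us(1)] by (intro exp_mart_integral[OF us] exp_mart_measurable_F us) (simp add: power2_eq_square)
  then have "has_bochner_integral M
      (\<lambda>\<omega>. ((exp_mart p s \<omega>)\<^sup>2 + (exp_mart p u \<omega>)\<^sup>2) - 2 * (exp_mart p u \<omega> * exp_mart p s \<omega>))
      ((exp (p\<^sup>2 * s) + exp (p\<^sup>2 * u)) - 2 * exp (p\<^sup>2 * u))"
    using us by (intro has_bochner_integral_diff has_bochner_integral_add has_bochner_integral_mult_right sq) auto
  then show ?thesis by (simp add: power2_diff algebra_simps)
qed

text \<open>The excess of e over N is at most e^2 / N, so its square is controlled by the fourth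
  moment; the constant 6 is (4^2 - 4) / 2.\<close>

lemma exp_mart_truncation_second_moment:
  assumes u: "0 \<le> u" and N: "0 < N"
  shows "integrable M (\<lambda>\<omega>. (exp_mart p u \<omega> - min (exp_mart p u \<omega>) N)\<^sup>2)"
    and "(\<integral>\<omega>. (exp_mart p u \<omega> - min (exp_mart p u \<omega>) N)\<^sup>2 \<partial>M) \<le> exp (6 * p\<^sup>2 * u) / N\<^sup>2"
proof -
  have m: "has_bochner_integral M (\<lambda>\<omega>. exp_mart p u \<omega> ^ 4 / N\<^sup>2) (exp (6 * p\<^sup>2 * u) / N\<^sup>2)"
    using exp_mart_power_moment[OF u, of p 4] by (intro has_bochner_integral_divide) (simp add: power2_eq_square mult.assoc)
  have le: "(e - min e N)\<^sup>2 \<le> e ^ 4 / N\<^sup>2" if "0 < e" for e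
  proof (cases "e \<le> N")
    case False
    have "e * e \<ge> e * N" using False that by (intro mult_left_mono) auto
    then have "e \<le> e\<^sup>2 / N" using N by (simp add: field_simps power2_eq_square)
    then have "e - N \<le> e\<^sup>2 / N" using N by linarith
    then have "(e - N)\<^sup>2 \<le> (e\<^sup>2 / N)\<^sup>2" using False by (intro power_mono) auto
    then show ?thesis using False by (simp add: power_divide flip: power_mult)
  qed (simp add: min_absorb1)
  have [measurable]: "exp_mart p u \<in> borel_measurable M" using u by simp
  show int: "integrable M (\<lambda>\<omega>. (exp_mart p u \<omega> - min (exp_mart p u \<omega>) N)\<^sup>2)"
  proof (rule integrable_nonneg_bound)
    show "integrable M (\<lambda>\<omega>. exp_mart p u \<omega> ^ 4 / N\<^sup>2)" using m by (simp add: has_bochner_integral_iff)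
  qed (use le[OF exp_mart_pos] in auto)
  have "(\<integral>\<omega>. (exp_mart p u \<omega> - min (exp_mart p u \<omega>) N)\<^sup>2 \<partial>M) \<le> (\<integral>\<omega>. exp_mart p u \<omega> ^ 4 / N\<^sup>2 \<partial>M)"
    using int m le[OF exp_mart_pos] by (intro integral_mono) (auto simp: has_bochner_integral_iff)
  then show "(\<integral>\<omega>. (exp_mart p u \<omega> - min (exp_mart p u \<omega>) N)\<^sup>2 \<partial>M) \<le> exp (6 * p\<^sup>2 * u) / N\<^sup>2"
    using m N by (simp add: has_bochner_integral_iff)
qed

lemma increment_mean_zero:
  assumes "0 \<le> s" "s \<le> t"
  shows "has_bochner_integral M (\<lambda>\<omega>. W t \<omega> - W s \<omega>) 0"
  using increment_exp_first_moment[OF assms, of 0] by simp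

lemma increment_exp_remainder_mean:
  assumes "0 \<le> s" "s \<le> t"
  shows "has_bochner_integral M (\<lambda>\<omega>. exp (p * (W t \<omega> - W s \<omega>)) * exp (- p\<^sup>2 * (t - s) / 2) - 1 - p * (W t \<omega> - W s \<omega>)) 0"
proof -
  have "has_bochner_integral M (\<lambda>\<omega>. 1 :: real) 1" by (simp add: has_bochner_integral_iff prob_space)
  then have "has_bochner_integral M
      (\<lambda>\<omega>. exp (p * (W t \<omega> - W s \<omega>)) * exp (- p\<^sup>2 * (t - s) / 2) - 1 - p * (W t \<omega> - W s \<omega>)) (1 - 1 - p * 0)"
    by (intro has_bochner_integral_diff has_bochner_integral_mult_right increment_exp_mart_integral
        increment_mean_zero assms)
  then show ?thesis by simp
qed

text \<open>Removing the constant and linear terms in the increment from the normalized exponential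
  removes 1 and p^2 h from its second moment e^(p^2 h). The rest is of order h^2, so the sum over a
  partition is small with the mesh.\<close>

lemma increment_exp_remainder_second_moment:
  assumes st: "0 \<le> s" "s \<le> t"
  shows "has_bochner_integral M
    (\<lambda>\<omega>. (exp (p * (W t \<omega> - W s \<omega>)) * exp (- p\<^sup>2 * (t - s) / 2) - 1 - p * (W t \<omega> - W s \<omega>))\<^sup>2)
    (exp (p\<^sup>2 * (t - s)) - 1 - p\<^sup>2 * (t - s))"
proof -
  let ?h = "t - s" and ?w = "\<lambda>\<omega>. W t \<omega> - W s \<omega>"
  let ?q = "exp (- p\<^sup>2 * ?h / 2)"
  have one: "has_bochner_integral M (\<lambda>\<omega>. 1 :: real) 1" by (simp add: has_bochner_integral_iff prob_space)
  have "has_bochner_integral M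
     (\<lambda>\<omega>. exp ((2 * p) * ?w \<omega>) * ?q\<^sup>2 + 1 + p\<^sup>2 * (?w \<omega>)\<^sup>2 + 2 * p * ?w \<omega>
        - 2 * (exp (p * ?w \<omega>) * ?q) - 2 * p * ((exp (p * ?w \<omega>) * ?w \<omega>) * ?q))
     (exp ((2 * p)\<^sup>2 * ?h / 2) * ?q\<^sup>2 + 1 + p\<^sup>2 * ?h + 2 * p * 0 - 2 * 1 - 2 * p * ((p * ?h * exp (p\<^sup>2 * ?h / 2)) * ?q))"
    by (intro has_bochner_integral_diff has_bochner_integral_add has_bochner_integral_mult_right
        has_bochner_integral_mult_left one increment_exp_mart_integral increment_mean_zero
        increment_exp_moment increment_exp_first_moment increment_second_moment st)
  moreover have "exp ((2 * p) * w) * ?q\<^sup>2 + 1 + p\<^sup>2 * w\<^sup>2 + 2 * p * w - 2 * (exp (p * w) * ?q) - 2 * p * ((exp (p * w) * w) * ?q)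
      = (exp (p * w) * ?q - 1 - p * w)\<^sup>2" for w
  proof -
    have "exp ((2 * p) * w) = (exp (p * w))\<^sup>2" by (simp add: power2_eq_square flip: exp_add)
    then show ?thesis by (simp add: power2_eq_square algebra_simps)
  qed
  moreover have "exp ((2 * p)\<^sup>2 * ?h / 2) * ?q\<^sup>2 + 1 + p\<^sup>2 * ?h + 2 * p * 0 - 2 * 1 - 2 * p * ((p * ?h * exp (p\<^sup>2 * ?h / 2)) * ?q)
     = exp (p\<^sup>2 * ?h) - 1 - p\<^sup>2 * ?h"
  proof -
    have "exp ((2 * p)\<^sup>2 * ?h / 2) * ?q\<^sup>2 = exp (p\<^sup>2 * ?h)"
    proof -
      have "?q\<^sup>2 = exp (2 * (- p\<^sup>2 * ?h / 2))" by (rule exp_double[symmetric])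
      moreover have "(2 * p)\<^sup>2 * ?h / 2 + 2 * (- p\<^sup>2 * ?h / 2) = p\<^sup>2 * ?h"
        by (simp add: power2_eq_square)
      ultimately show ?thesis by (metis exp_add)
    qed
    moreover have "exp (p\<^sup>2 * ?h / 2) * ?q = 1" by (simp flip: exp_add)
    ultimately show ?thesis by (simp add: power2_eq_square mult.assoc)
  qed
  ultimately show ?thesis by (simp only:)
qed

text \<open>From 1 - y <= e^(-y). It writes the second-order remainder as the length y times a
  factor that vanishes with the mesh, which is the form that can be summed.\<close>

lemma exp_minus_1_minus_le:
  fixes y :: real assumes "0 \<le> y"
  shows "exp y - 1 - y \<le> y * (exp y - 1)"
proof -
  have "(1 - y) * exp y \<le> exp (- y) * exp y"
    using exp_ge_add_one_self[of "- y"] by (intro mult_right_mono) auto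
  then show ?thesis by (simp add: algebra_simps flip: exp_add)
qed

text \<open>The summands are orthogonal in \<open>L\<^sup>2\<close>, and each has second moment of order \<open>o(1)\<close> times the
  length of its interval.\<close>

lemma exp_mart_riemann_sum_error:
  fixes s w :: "nat \<Rightarrow> real"
  assumes s0: "0 \<le> s 0" and mono: "\<And>i. i < m \<Longrightarrow> s i \<le> s (Suc i)" and mesh: "\<And>i. i < m \<Longrightarrow> s (Suc i) - s i \<le> \<delta>"
    and \<delta>: "0 \<le> \<delta>"
    and t: "s m \<le> t" and w: "\<And>i. i < m \<Longrightarrow> \<bar>w i\<bar> \<le> B" and N: "0 < N"
  shows "(\<integral>\<^sup>+\<omega>. ennreal ((\<Sum>i<m. w i * (exp_mart p (s (Suc i)) \<omega> - exp_mart p (s i) \<omega>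
        - p * min (exp_mart p (s i) \<omega>) N * (W (s (Suc i)) \<omega> - W (s i) \<omega>)))\<^sup>2) \<partial>M)
    \<le> ennreal (2 * B\<^sup>2 * p\<^sup>2 * t * (exp (p\<^sup>2 * t) * (exp (p\<^sup>2 * \<delta>) - 1) + exp (6 * p\<^sup>2 * t) / N\<^sup>2))"
proof -
  let ?E = "\<lambda>i. exp_mart p (s i)" and ?h = "\<lambda>i. s (Suc i) - s i" and ?d = "\<lambda>i \<omega>. W (s (Suc i)) \<omega> - W (s i) \<omega>"
  define g where "g i v = exp (p * v) * exp (- p\<^sup>2 * ?h i / 2) - 1 - p * v" for i v
  define A where "A i \<omega> = w i * ?E i \<omega>" for i \<omega>
  define C where "C i \<omega> = w i * p * (?E i \<omega> - min (?E i \<omega>) N)" for i \<omega>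
  define D where "D i \<omega> = w i * (?E (Suc i) \<omega> - ?E i \<omega> - p * min (?E i \<omega>) N * ?d i \<omega>)" for i \<omega>
  \<comment> \<open>The error splits into the nonlinear remainder of the exponential and the effect
    of truncation. Both are a factor known at the left endpoint times a centred function of the
    increment, which gives orthogonality later.\<close>
  have D_eq: "D i \<omega> = A i \<omega> * g i (?d i \<omega>) + C i \<omega> * ?d i \<omega>" for i \<omega>
    unfolding D_def A_def C_def g_def exp_mart_split[of p "s (Suc i)" \<omega> "s i"]
    by (simp add: algebra_simps)
  have sle: "s i \<le> s j" if "i \<le> j" "j \<le> m" for i j
    by (rule partition_mono[of m s, OF mono that])
  have spos: "0 \<le> s i" and st: "s i \<le> t" if "i \<le> m" for i
    using sle[of 0 i] sle[of i m] s0 t that by auto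
  have AF: "A i \<in> borel_measurable (F (s i))" and CF: "C i \<in> borel_measurable (F (s i))" if "i \<le> m" for i
    using exp_mart_measurable_F[OF spos[OF that], of p] unfolding A_def[abs_def] C_def[abs_def] by measurable
  have AM [measurable]: "A i \<in> borel_measurable M" and CM [measurable]: "C i \<in> borel_measurable M" if "i \<le> m" for i
    using AF CF measurable_F_imp_M spos that by blast+
  have gm [measurable]: "g i \<in> borel_measurable borel" for i unfolding g_def[abs_def] by measurable
  have dm [measurable]: "?d i \<in> borel_measurable M" if "i < m" for i
    using spos[of i] mono[OF that] that by (intro increment_measurable) auto
  have DM: "D i \<in> borel_measurable M" if "i < m" for i
    unfolding D_eq[abs_def] using that
    by (intro borel_measurable_add borel_measurable_times AM CM dm measurable_compose[OF dm gm]) auto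
  have Asq: "has_bochner_integral M (\<lambda>\<omega>. (A i \<omega>)\<^sup>2) ((w i)\<^sup>2 * exp (p\<^sup>2 * s i))" if "i \<le> m" for i
    using exp_mart_power_moment[OF spos[OF that], of p 2]
    unfolding A_def power_mult_distrib by (intro has_bochner_integral_mult_right) simp
  have Csq: "integrable M (\<lambda>\<omega>. (C i \<omega>)\<^sup>2)" and
    Cle: "(\<integral>\<omega>. (C i \<omega>)\<^sup>2 \<partial>M) \<le> (w i)\<^sup>2 * p\<^sup>2 * (exp (6 * p\<^sup>2 * s i) / N\<^sup>2)" if "i \<le> m" for i
    using exp_mart_truncation_second_moment(1)[OF spos[OF that] N, of p]
      mult_left_mono[OF exp_mart_truncation_second_moment(2)[OF spos[OF that] N, of p], of "(w i)\<^sup>2 * p\<^sup>2"]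
    by (simp_all add: C_def power_mult_distrib)
  have gsq: "has_bochner_integral M (\<lambda>\<omega>. (g i (?d i \<omega>))\<^sup>2) (exp (p\<^sup>2 * ?h i) - 1 - p\<^sup>2 * ?h i)" if "i < m" for i
    unfolding g_def using that spos[of i] mono by (intro increment_exp_remainder_second_moment) auto
  have Ag: "has_bochner_integral M (\<lambda>\<omega>. (A i \<omega> * g i (?d i \<omega>))\<^sup>2)
      ((w i)\<^sup>2 * exp (p\<^sup>2 * s i) * (exp (p\<^sup>2 * ?h i) - 1 - p\<^sup>2 * ?h i))" if "i < m" for i
    unfolding power_mult_distrib
  proof (rule has_bochner_integral_increment_mult[where \<phi>="\<lambda>v. (g i v)\<^sup>2"])
    show "(\<lambda>\<omega>. (A i \<omega>)\<^sup>2) \<in> borel_measurable (F (s i))" using AF[OF less_imp_le[OF that]] by measurable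
  qed (use that spos[of i] mono Asq[of i] gsq in auto)
  have Cd: "has_bochner_integral M (\<lambda>\<omega>. (C i \<omega> * ?d i \<omega>)\<^sup>2) ((\<integral>\<omega>. (C i \<omega>)\<^sup>2 \<partial>M) * ?h i)" if "i < m" for i
    unfolding power_mult_distrib
  proof (rule has_bochner_integral_increment_mult[where \<phi>="\<lambda>v. v\<^sup>2"])
    show "(\<lambda>\<omega>. (C i \<omega>)\<^sup>2) \<in> borel_measurable (F (s i))" using CF[OF less_imp_le[OF that]] by measurable
  qed (use that spos[of i] mono Csq[of i] increment_second_moment in \<open>auto simp: has_bochner_integral_iff\<close>)
  let ?K = "exp (p\<^sup>2 * t) * (exp (p\<^sup>2 * \<delta>) - 1) + exp (6 * p\<^sup>2 * t) / N\<^sup>2"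
  have Dsq: "integrable M (\<lambda>\<omega>. (D i \<omega>)\<^sup>2)" and Dle: "(\<integral>\<omega>. (D i \<omega>)\<^sup>2 \<partial>M) \<le> 2 * B\<^sup>2 * p\<^sup>2 * ?K * ?h i" if i: "i < m" for i
  proof -
    let ?b = "\<lambda>\<omega>. 2 * (A i \<omega> * g i (?d i \<omega>))\<^sup>2 + 2 * (C i \<omega> * ?d i \<omega>)\<^sup>2"
    have b: "has_bochner_integral M ?b (2 * ((w i)\<^sup>2 * exp (p\<^sup>2 * s i) * (exp (p\<^sup>2 * ?h i) - 1 - p\<^sup>2 * ?h i)) + 2 * ((\<integral>\<omega>. (C i \<omega>)\<^sup>2 \<partial>M) * ?h i))"
      by (intro has_bochner_integral_add has_bochner_integral_mult_right Ag Cd i)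
    have le: "(D i \<omega>)\<^sup>2 \<le> ?b \<omega>" for \<omega>
      unfolding D_eq using sum_squares_bound[of "A i \<omega> * g i (?d i \<omega>)" "C i \<omega> * ?d i \<omega>"] by (simp add: power2_sum)
    show Dsq: "integrable M (\<lambda>\<omega>. (D i \<omega>)\<^sup>2)"
    proof (rule integrable_nonneg_bound[OF _ _ _ le])
      show "integrable M ?b" using b by (simp add: has_bochner_integral_iff)
      show "(\<lambda>\<omega>. (D i \<omega>)\<^sup>2) \<in> borel_measurable M" using DM[OF i] by measurable
    qed simp
    have "(\<integral>\<omega>. (D i \<omega>)\<^sup>2 \<partial>M) \<le> (\<integral>\<omega>. ?b \<omega> \<partial>M)"
      using Dsq b le by (intro integral_mono) (auto simp: has_bochner_integral_iff)
    also have "\<dots> = 2 * ((w i)\<^sup>2 * exp (p\<^sup>2 * s i) * (exp (p\<^sup>2 * ?h i) - 1 - p\<^sup>2 * ?h i)) + 2 * ((\<integral>\<omega>. (C i \<omega>)\<^sup>2 \<partial>M) * ?h i)"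
      using b by (simp add: has_bochner_integral_iff)
    \<comment> \<open>One factor \<open>?h i\<close> is kept in each term so that the sum telescopes
      to at most t; everything else is made independent of i.\<close>
    also have "\<dots> \<le> 2 * (B\<^sup>2 * exp (p\<^sup>2 * t) * (p\<^sup>2 * ?h i * (exp (p\<^sup>2 * \<delta>) - 1))) + 2 * ((B\<^sup>2 * p\<^sup>2 * (exp (6 * p\<^sup>2 * t) / N\<^sup>2)) * ?h i)"
    proof (intro add_mono mult_left_mono mult_right_mono)
      have w2: "(w i)\<^sup>2 \<le> B\<^sup>2" using power_mono[OF w[OF i], of 2] by simp
      have h: "0 \<le> ?h i" "?h i \<le> \<delta>" using mono[OF i] mesh[OF i] by auto
      have e: "p\<^sup>2 * s i \<le> p\<^sup>2 * t" "p\<^sup>2 * ?h i \<le> p\<^sup>2 * \<delta>" using st[of i] i h by (auto intro: mult_left_mono)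
      have "exp (p\<^sup>2 * ?h i) - 1 - p\<^sup>2 * ?h i \<le> p\<^sup>2 * ?h i * (exp (p\<^sup>2 * ?h i) - 1)"
        using h by (intro exp_minus_1_minus_le) auto
      also have "\<dots> \<le> p\<^sup>2 * ?h i * (exp (p\<^sup>2 * \<delta>) - 1)" using h e by (intro mult_left_mono) auto
      finally have g: "exp (p\<^sup>2 * ?h i) - 1 - p\<^sup>2 * ?h i \<le> p\<^sup>2 * ?h i * (exp (p\<^sup>2 * \<delta>) - 1)" .
      have g0: "0 \<le> exp (p\<^sup>2 * ?h i) - 1 - p\<^sup>2 * ?h i" using exp_ge_add_one_self[of "p\<^sup>2 * ?h i"] by linarith
      show "(w i)\<^sup>2 * exp (p\<^sup>2 * s i) * (exp (p\<^sup>2 * ?h i) - 1 - p\<^sup>2 * ?h i)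
          \<le> B\<^sup>2 * exp (p\<^sup>2 * t) * (p\<^sup>2 * ?h i * (exp (p\<^sup>2 * \<delta>) - 1))"
        using w2 e g g0 by (intro mult_mono) auto
      have "(\<integral>\<omega>. (C i \<omega>)\<^sup>2 \<partial>M) \<le> (w i)\<^sup>2 * p\<^sup>2 * (exp (6 * p\<^sup>2 * s i) / N\<^sup>2)" using Cle[of i] i by simp
      also have "\<dots> \<le> B\<^sup>2 * p\<^sup>2 * (exp (6 * p\<^sup>2 * t) / N\<^sup>2)"
        using w2 e(1) by (intro mult_mono divide_right_mono) auto
      finally show "(\<integral>\<omega>. (C i \<omega>)\<^sup>2 \<partial>M) \<le> B\<^sup>2 * p\<^sup>2 * (exp (6 * p\<^sup>2 * t) / N\<^sup>2)" .
      show "0 \<le> ?h i" by (fact h)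
    qed auto
    also have "\<dots> = 2 * B\<^sup>2 * p\<^sup>2 * ?K * ?h i" by (simp add: algebra_simps)
    finally show "(\<integral>\<omega>. (D i \<omega>)\<^sup>2 \<partial>M) \<le> 2 * B\<^sup>2 * p\<^sup>2 * ?K * ?h i" .
  qed
  have "has_bochner_integral M (\<lambda>\<omega>. (\<Sum>i<m. D i \<omega>)\<^sup>2) (\<Sum>i<m. \<integral>\<omega>. (D i \<omega>)\<^sup>2 \<partial>M)"
  proof (rule has_bochner_integral_sum_orthogonal_square)
    fix i j assume ij: "i < j" "j < m"
    have si: "s (Suc i) \<le> s j" "s i \<le> s j" using sle[of "Suc i" j] sle[of i j] ij by auto
    have DF: "D i \<in> borel_measurable (F (s j))"
    proof -
      have "?E i \<in> borel_measurable (F (s j))" "?E (Suc i) \<in> borel_measurable (F (s j))"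
        "W (s i) \<in> borel_measurable (F (s j))" "W (s (Suc i)) \<in> borel_measurable (F (s j))"
        using si spos[of i] spos[of "Suc i"] ij
        by (auto intro!: measurable_F_mono[OF exp_mart_measurable_F] measurable_F_mono[OF W_measurable_F])
      then show ?thesis unfolding D_def[abs_def] by measurable
    qed
    have j: "0 \<le> s j" "s j \<le> s (Suc j)" using spos[of j] mono ij by auto
    have m: "(\<lambda>\<omega>. D i \<omega> * A j \<omega>) \<in> borel_measurable (F (s j))" "(\<lambda>\<omega>. D i \<omega> * C j \<omega>) \<in> borel_measurable (F (s j))"
      using DF AF[of j] CF[of j] ij by auto
    have int: "integrable M (\<lambda>\<omega>. D i \<omega> * A j \<omega>)" "integrable M (\<lambda>\<omega>. D i \<omega> * C j \<omega>)"
      using DM[of i] Dsq[of i] AM[of j] CM[of j] Asq[of j] Csq[of j] ij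
      by (auto intro!: integrable_mult_of_squares simp: has_bochner_integral_iff)
    \<comment> \<open>The remainder at j is centred and depends on an increment after all of D i, so
      this part of the mixed product has mean 0; the truncation part follows in the same
      way.\<close>
    have "has_bochner_integral M (\<lambda>\<omega>. D i \<omega> * A j \<omega> * g j (?d j \<omega>)) ((\<integral>\<omega>. D i \<omega> * A j \<omega> \<partial>M) * 0)"
      using increment_exp_remainder_mean[OF j, of p] m int
      by (intro has_bochner_integral_increment_mult j) (auto simp: has_bochner_integral_iff g_def)
    moreover have "has_bochner_integral M (\<lambda>\<omega>. D i \<omega> * C j \<omega> * (\<lambda>v. v) (?d j \<omega>)) ((\<integral>\<omega>. D i \<omega> * C j \<omega> \<partial>M) * 0)"
      using increment_mean_zero[OF j] m int
      by (intro has_bochner_integral_increment_mult j) (auto simp: has_bochner_integral_iff)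
    ultimately have "has_bochner_integral M (\<lambda>\<omega>. D i \<omega> * A j \<omega> * g j (?d j \<omega>) + D i \<omega> * C j \<omega> * ?d j \<omega>)
      ((\<integral>\<omega>. D i \<omega> * A j \<omega> \<partial>M) * 0 + (\<integral>\<omega>. D i \<omega> * C j \<omega> \<partial>M) * 0)"
      by (intro has_bochner_integral_add)
    moreover have "D i \<omega> * A j \<omega> * g j (?d j \<omega>) + D i \<omega> * C j \<omega> * ?d j \<omega> = D i \<omega> * D j \<omega>" for \<omega>
      unfolding D_eq[of j] by (simp only: distrib_left mult.assoc)
    ultimately have "has_bochner_integral M (\<lambda>\<omega>. D i \<omega> * D j \<omega>) 0" by (simp only: mult_zero_right add_0)
    then show "(\<integral>\<omega>. D i \<omega> * D j \<omega> \<partial>M) = 0" by (simp add: has_bochner_integral_iff)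
  qed (use DM Dsq in \<open>auto simp: has_bochner_integral_iff\<close>)
  then have "(\<integral>\<^sup>+\<omega>. ennreal ((\<Sum>i<m. D i \<omega>)\<^sup>2) \<partial>M) = ennreal (\<Sum>i<m. \<integral>\<omega>. (D i \<omega>)\<^sup>2 \<partial>M)"
    by (subst nn_integral_eq_integral) (auto simp: has_bochner_integral_iff)
  also have "\<dots> \<le> ennreal (2 * B\<^sup>2 * p\<^sup>2 * t * ?K)"
  proof (rule ennreal_leI)
    have "(\<Sum>i<m. \<integral>\<omega>. (D i \<omega>)\<^sup>2 \<partial>M) \<le> (\<Sum>i<m. 2 * B\<^sup>2 * p\<^sup>2 * ?K * ?h i)" by (intro sum_mono Dle) auto
    also have "\<dots> = 2 * B\<^sup>2 * p\<^sup>2 * ?K * (s m - s 0)"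
      by (simp only: sum_distrib_left[symmetric] sum_lessThan_telescope)
    also have "\<dots> \<le> 2 * B\<^sup>2 * p\<^sup>2 * ?K * t"
    proof -
      have "0 \<le> ?K" using \<delta> by (intro add_nonneg_nonneg mult_nonneg_nonneg) auto
      then show ?thesis using s0 t by (intro mult_left_mono) auto
    qed
    finally show "(\<Sum>i<m. \<integral>\<omega>. (D i \<omega>)\<^sup>2 \<partial>M) \<le> 2 * B\<^sup>2 * p\<^sup>2 * t * ?K" by (simp add: mult_ac)
  qed
  finally show ?thesis by (simp add: D_def)
qed

end

section \<open>Elementary exponential estimates and summation by parts\<close>

lemma abs_exp_minus_1_le: "\<bar>exp y - 1\<bar> \<le> exp \<bar>y\<bar> - (1 :: real)"
proof (cases "0 \<le> y")
  case False
  have "1 - exp y \<le> - y" using exp_ge_add_one_self[of y] by linarith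
  also have "\<dots> \<le> exp (- y) - 1" using exp_ge_add_one_self[of "- y"] by linarith
  finally show ?thesis using False by simp
qed simp

lemma exp_diff_le:
  fixes c u s \<delta> R :: real
  assumes "0 \<le> c" "u \<le> s" "s \<le> R" "s - u \<le> \<delta>"
  shows "exp (c * s) - exp (c * u) \<le> exp (c * R) * (exp (c * \<delta>) - 1)"
proof -
  have "exp (c * s) - exp (c * u) = exp (c * u) * (exp (c * (s - u)) - 1)"
    by (simp add: algebra_simps flip: exp_add)
  also have "\<dots> \<le> exp (c * R) * (exp (c * \<delta>) - 1)"
    using assms by (intro mult_mono) (auto intro: mult_left_mono)
  finally show ?thesis .
qed

lemma exp_mult_le_exp_abs: "0 \<le> u \<Longrightarrow> u \<le> R \<Longrightarrow> exp (b * u) \<le> exp (\<bar>b\<bar> * (R :: real))"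
  using mult_mono[of b "\<bar>b\<bar>" u R] by auto

lemma continuous_on_atLeast_0I:
  fixes f :: "real \<Rightarrow> real"
  assumes "\<And>T. 0 \<le> T \<Longrightarrow> continuous_on {0..T} f"
  shows "continuous_on {0..} f"
  unfolding continuous_on_eq_continuous_within
proof
  fix t :: real assume t: "t \<in> {0..}"
  have "continuous (at t within {0..t + 1}) f"
    using assms[of "t + 1"] t by (simp add: continuous_on_eq_continuous_within)
  moreover have "at t within {0..} = at t within {0..t + 1}"
    by (rule at_within_nhd[of t "{..<t + 1}"]) auto
  ultimately show "continuous (at t within {0..}) f" by simp
qed

text \<open>Summation by parts along the partition \<open>s\<close>.\<close>

lemma step_interpolation_identity:
  fixes s E :: "nat \<Rightarrow> real" and e Y :: "real \<Rightarrow> real"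
  assumes t: "0 \<le> t" and s: "s 0 = 0" "s m = t" and mono: "\<And>i. i < m \<Longrightarrow> s i \<le> s (Suc i)"
    and e: "continuous_on {0..t} e" and E: "\<And>i. i \<le> m \<Longrightarrow> E i = e (s i)"
    and Y: "\<And>u. Y u = (\<Sum>i<m. E (Suc i) * indicator {s i<..s (Suc i)} u)"
  shows "exp (b * t) * e t - e 0 - b * (LINT u:{0..t}|lborel. exp (b * u) * e u)
    = (\<Sum>i<m. exp (b * s i) * (E (Suc i) - E i)) + (LINT u:{0..t}|lborel. b * exp (b * u) * (Y u - e u))"
proof -
  have sle: "s i \<le> s j" if "i \<le> j" "j \<le> m" for i j
    by (rule partition_mono[of m s, OF mono that])
  \<comment> \<open>The fundamental theorem is stated for closed intervals; the left endpoint is a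
    null set.\<close>
  have piece: "has_bochner_integral lborel (\<lambda>u. indicator {s i<..s (Suc i)} u * (b * exp (b * u)))
      (exp (b * s (Suc i)) - exp (b * s i))" if "i < m" for i
  proof -
    have "has_bochner_integral lborel (\<lambda>u. (b * exp (b * u)) * indicator {s i..s (Suc i)} u)
      (exp (b * s (Suc i)) - exp (b * s i))"
      using mono[OF that]
      by (intro has_bochner_integral_FTC_Icc_real) (auto intro!: derivative_eq_intros continuous_intros)
    moreover have "AE u in lborel. (b * exp (b * u)) * indicator {s i..s (Suc i)} u
        = indicator {s i<..s (Suc i)} u * (b * exp (b * u))"
      using AE_lborel_singleton[of "s i"] by eventually_elim (auto simp: indicator_def)
    ultimately show ?thesis
      by (subst (asm) has_bochner_integral_cong_AE) auto
  qed
  have "has_bochner_integral lborel (\<lambda>u. \<Sum>i<m. E (Suc i) * (indicator {s i<..s (Suc i)} u * (b * exp (b * u))))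
      (\<Sum>i<m. E (Suc i) * (exp (b * s (Suc i)) - exp (b * s i)))"
    by (intro has_bochner_integral_sum has_bochner_integral_mult_right piece) auto
  moreover have "(\<Sum>i<m. E (Suc i) * (indicator {s i<..s (Suc i)} u * (b * exp (b * u))))
      = indicator {0..t} u *\<^sub>R (b * exp (b * u) * Y u)" for u
  proof -
    have "indicator {s i<..s (Suc i)} u = (indicator {0..t} u * indicator {s i<..s (Suc i)} u :: real)" if "i < m" for i
      using that sle[of 0 i] sle[of "Suc i" m] s by (auto simp: indicator_def)
    then have "E (Suc i) * (indicator {s i<..s (Suc i)} u * (b * exp (b * u)))
        = E (Suc i) * ((indicator {0..t} u * indicator {s i<..s (Suc i)} u) * (b * exp (b * u)))" if "i < m" for i
      using that by presburger
    then have "(\<Sum>i<m. E (Suc i) * (indicator {s i<..s (Suc i)} u * (b * exp (b * u))))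
      = (\<Sum>i<m. E (Suc i) * ((indicator {0..t} u * indicator {s i<..s (Suc i)} u) * (b * exp (b * u))))"
      by (intro sum.cong refl) (simp only: lessThan_iff)
    also have "\<dots> = (\<Sum>i<m. (indicator {0..t} u * (b * exp (b * u))) * (E (Suc i) * indicator {s i<..s (Suc i)} u))"
      by (simp only: mult_ac)
    finally have "(\<Sum>i<m. E (Suc i) * (indicator {s i<..s (Suc i)} u * (b * exp (b * u))))
      = (\<Sum>i<m. (indicator {0..t} u * (b * exp (b * u))) * (E (Suc i) * indicator {s i<..s (Suc i)} u))" .
    then show ?thesis unfolding Y by (simp only: sum_distrib_left[symmetric] real_scaleR_def mult.assoc)
  qed
  ultimately have bY: "has_bochner_integral lborel (\<lambda>u. indicator {0..t} u *\<^sub>R (b * exp (b * u) * Y u))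
      (\<Sum>i<m. E (Suc i) * (exp (b * s (Suc i)) - exp (b * s i)))" by simp
  have ie: "set_integrable lborel {0..t} (\<lambda>u. exp (b * u) * e u)"
    by (intro borel_integrable_atLeastAtMost' continuous_intros e)
  then have ibe: "set_integrable lborel {0..t} (\<lambda>u. b * (exp (b * u) * e u))" by simp
  have "(LINT u:{0..t}|lborel. b * exp (b * u) * (Y u - e u))
      = (LINT u:{0..t}|lborel. b * exp (b * u) * Y u - b * (exp (b * u) * e u))"
    by (simp add: algebra_simps)
  also have "\<dots> = (LINT u:{0..t}|lborel. b * exp (b * u) * Y u) - (LINT u:{0..t}|lborel. b * (exp (b * u) * e u))"
    using bY ibe by (intro set_integral_diff) (auto simp: set_integrable_def has_bochner_integral_iff)
  also have "(LINT u:{0..t}|lborel. b * exp (b * u) * Y u) = (\<Sum>i<m. E (Suc i) * (exp (b * s (Suc i)) - exp (b * s i)))"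
    using bY by (simp add: set_lebesgue_integral_def has_bochner_integral_iff)
  finally have "(LINT u:{0..t}|lborel. b * exp (b * u) * (Y u - e u))
      = (\<Sum>i<m. E (Suc i) * (exp (b * s (Suc i)) - exp (b * s i))) - b * (LINT u:{0..t}|lborel. exp (b * u) * e u)"
    by simp
  \<comment> \<open>Abel summation. The right endpoint value of E goes with the increments of e^(b
    s), so that the increments of E carry the left endpoint value, as a stochastic Riemann sum
    needs.\<close>
  moreover have "(\<Sum>i<m. E (Suc i) * (exp (b * s (Suc i)) - exp (b * s i))) + (\<Sum>i<m. exp (b * s i) * (E (Suc i) - E i))
      = exp (b * t) * e t - e 0"
  proof -
    have "(\<Sum>i<m. E (Suc i) * (exp (b * s (Suc i)) - exp (b * s i))) + (\<Sum>i<m. exp (b * s i) * (E (Suc i) - E i))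
        = (\<Sum>i<m. exp (b * s (Suc i)) * E (Suc i) - exp (b * s i) * E i)"
      by (simp add: sum.distrib[symmetric] algebra_simps)
    also have "\<dots> = exp (b * s m) * E m - exp (b * s 0) * E 0"
      by (rule sum_lessThan_telescope)
    finally show ?thesis using E[of 0] E[of m] s by simp
  qed
  ultimately show ?thesis by linarith
qed

section \<open>Geometric Brownian motion as integrand and as wealth\<close>

context continuous_brownian_motion
begin

lemma continuous_on_exp_mart: "continuous_on {0..} (\<lambda>t. exp_mart p t \<omega>)"
  unfolding exp_mart_def by (intro continuous_intros W_continuous) auto

text \<open>The solution of dX = b X dt + \<kappa> X dW started at x. The Ito correction sits inside
  \<open>exp_mart\<close>, so \<open>b\<close> is the drift and the mean is x e^(b t).\<close>

definition gbm :: "real \<Rightarrow> real \<Rightarrow> real \<Rightarrow> real \<Rightarrow> 'a \<Rightarrow> real" where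
  "gbm x b \<kappa> t \<omega> = x * exp (b * t) * exp_mart \<kappa> t \<omega>"

lemma continuous_on_gbm: "continuous_on {0..} (\<lambda>t. gbm x b \<kappa> t \<omega>)"
  unfolding gbm_def by (intro continuous_intros continuous_on_exp_mart)

lemma gbm_measurable_F: "0 \<le> t \<Longrightarrow> gbm x b \<kappa> t \<in> borel_measurable (F t)"
  unfolding gbm_def[abs_def] using exp_mart_measurable_F[of t \<kappa>] by measurable

lemma gbm_set_integrable: "set_integrable lborel {0..t} (\<lambda>s. gbm x b \<kappa> s \<omega>)"
  by (intro borel_integrable_atLeastAtMost' continuous_on_subset[OF continuous_on_gbm]) auto

lemma gbm_jointly_measurable:
  "(\<lambda>z. gbm x b \<kappa> (max 0 (snd z)) (fst z)) \<in> borel_measurable (M \<Otimes>\<^sub>M lborel)"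
  unfolding gbm_def using exp_mart_jointly_measurable[of \<kappa>] by measurable

lemma gbm_measurable_process: "measurable_process M (gbm x b \<kappa>)"
proof -
  have "(\<lambda>z. (fst z, snd z)) \<in> M \<Otimes>\<^sub>M restrict_space borel {0 :: real..} \<rightarrow>\<^sub>M M \<Otimes>\<^sub>M lborel"
    by (intro measurable_Pair measurable_fst)
       (auto intro!: measurable_compose[OF measurable_snd] measurable_restrict_space1)
  from measurable_compose[OF this gbm_jointly_measurable]
  have "(\<lambda>z. gbm x b \<kappa> (max 0 (snd z)) (fst z)) \<in> borel_measurable (M \<Otimes>\<^sub>M restrict_space borel {0..})"
    by simp
  moreover have "gbm x b \<kappa> (max 0 (snd z)) (fst z) = (case z of (\<omega>, t) \<Rightarrow> gbm x b \<kappa> t \<omega>)"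
    if "z \<in> space (M \<Otimes>\<^sub>M restrict_space borel {0..})" for z
    using that by (auto simp: space_pair_measure space_restrict_space)
  ultimately show ?thesis
    unfolding measurable_process_def by (subst measurable_cong[symmetric]) auto
qed

text \<open>Adaptedness of the time integral, available here because the paths are continuous: the
  process stopped at t is jointly measurable with respect to \<open>F t\<close> itself.\<close>

lemma gbm_integral_measurable_F:
  assumes t: "0 \<le> t"
  shows "(\<lambda>\<omega>. LINT s:{0..t}|lborel. gbm x b \<kappa> s \<omega>) \<in> borel_measurable (F t)"
proof -
  let ?X = "\<lambda>s. gbm x b \<kappa> (max 0 (min s t))"
  have [measurable]: "(\<lambda>z. ?X (snd z) (fst z)) \<in> borel_measurable (F t \<Otimes>\<^sub>M lborel)"
  proof (rule continuous_process_jointly_measurable)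
    show "?X s \<in> borel_measurable (F t)" for s
      using t by (intro measurable_F_mono[OF gbm_measurable_F]) auto
    show "continuous_on UNIV (\<lambda>s. ?X s \<omega>)" for \<omega>
      by (intro continuous_on_compose2[OF continuous_on_gbm] continuous_intros) auto
  qed
  have "(\<lambda>\<omega>. \<integral>s. indicator {0..t} s *\<^sub>R ?X (snd (\<omega>, s)) (fst (\<omega>, s)) \<partial>lborel) \<in> borel_measurable (F t)"
    by measurable
  moreover have "(\<integral>s. indicator {0..t} s *\<^sub>R ?X (snd (\<omega>, s)) (fst (\<omega>, s)) \<partial>lborel)
      = (LINT s:{0..t}|lborel. gbm x b \<kappa> s \<omega>)" for \<omega>
    unfolding set_lebesgue_integral_def by (intro Bochner_Integration.integral_cong) (auto simp: indicator_def)
  ultimately show ?thesis by (simp only:)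
qed

text \<open>The exponential is truncated at \<open>n\<close> because simple integrands are bounded; the \<open>n\<^sup>2\<close> steps of
  length \<open>1/n\<close> reach up to time \<open>n\<close>.\<close>

definition gbm_simple :: "real \<Rightarrow> real \<Rightarrow> real \<Rightarrow> nat \<Rightarrow> 'a simple_data" where
  "gbm_simple x b \<kappa> n = (n * n, \<lambda>i. real i / real n,
     \<lambda>i \<omega>. \<kappa> * (x * exp (b * (real i / real n)) * min (exp_mart \<kappa> (real i / real n) \<omega>) (real n)))"

lemma simple_integrand_gbm_simple:
  assumes n: "0 < n"
  shows "simple_integrand M F (gbm_simple x b \<kappa> n)"
  unfolding gbm_simple_def simple_integrand_def
proof (clarsimp, intro conjI allI impI)
  fix i assume "i < n * n"
  show "real i / real n < (1 + real i) / real n" using n by (simp add: divide_strict_right_mono)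
  have [measurable]: "exp_mart \<kappa> (real i / real n) \<in> borel_measurable (F (real i / real n))"
    by (rule exp_mart_measurable_F) simp
  show "(\<lambda>\<omega>. \<kappa> * (x * exp (b * real i / real n) * min (exp_mart \<kappa> (real i / real n) \<omega>) (real n)))
      \<in> borel_measurable (F (real i / real n))" by measurable
  show "\<exists>B. \<forall>\<omega>\<in>space M. \<bar>\<kappa> * (x * exp (b * real i / real n) * min (exp_mart \<kappa> (real i / real n) \<omega>) (real n))\<bar> \<le> B"
  proof (intro exI ballI)
    fix \<omega>
    have "\<bar>min (exp_mart \<kappa> (real i / real n) \<omega>) (real n)\<bar> \<le> real n"
      using exp_mart_pos[of \<kappa> "real i / real n" \<omega>] by (auto simp: min_def)
    then show "\<bar>\<kappa> * (x * exp (b * real i / real n) * min (exp_mart \<kappa> (real i / real n) \<omega>) (real n))\<bar>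
        \<le> \<bar>\<kappa>\<bar> * (\<bar>x\<bar> * exp (b * real i / real n) * real n)"
      by (auto simp: abs_mult intro!: mult_left_mono)
  qed
qed


text \<open>Tonelli's theorem and a uniform bound. Time 0 is left out of the assumption because a
  simple process lives on intervals open at the left and vanishes there, so it does not approximate
  its target at 0.\<close>

lemma nn_integral_process_square_le:
  assumes Z: "measurable_process M Z" and R: "0 \<le> R"
    and K: "\<And>u. 0 < u \<Longrightarrow> u \<le> R \<Longrightarrow> (\<integral>\<^sup>+\<omega>. ennreal ((Z u \<omega>)\<^sup>2) \<partial>M) \<le> ennreal K"
  shows "(\<integral>\<^sup>+\<omega>. (\<integral>\<^sup>+u\<in>{0..R}. ennreal ((Z u \<omega>)\<^sup>2) \<partial>lborel) \<partial>M) \<le> ennreal K * ennreal R"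
proof -
  interpret P: pair_sigma_finite M lborel by unfold_locales
  note [measurable] = measurable_process_max[OF Z]
  have "(\<integral>\<^sup>+\<omega>. (\<integral>\<^sup>+u\<in>{0..R}. ennreal ((Z u \<omega>)\<^sup>2) \<partial>lborel) \<partial>M)
      = (\<integral>\<^sup>+\<omega>. (\<integral>\<^sup>+u. ennreal ((Z (max 0 u) \<omega>)\<^sup>2) * indicator {0..R} u \<partial>lborel) \<partial>M)"
    by (subst set_nn_integral_max_0) simp
  also have "\<dots> = (\<integral>\<^sup>+u. (\<integral>\<^sup>+\<omega>. ennreal ((Z (max 0 u) \<omega>)\<^sup>2) * indicator {0..R} u \<partial>M) \<partial>lborel)"
  proof (rule P.Fubini'[symmetric])
    have "(\<lambda>z. ennreal ((Z (max 0 (snd z)) (fst z))\<^sup>2) * indicator {0..R} (snd z)) \<in> borel_measurable (M \<Otimes>\<^sub>M lborel)"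
      by measurable
    then show "(\<lambda>(\<omega>, u). ennreal ((Z (max 0 u) \<omega>)\<^sup>2) * indicator {0..R} u) \<in> borel_measurable (M \<Otimes>\<^sub>M lborel)"
      by (simp add: case_prod_beta')
  qed
  also have "\<dots> \<le> (\<integral>\<^sup>+u. ennreal K * indicator {0..R} u \<partial>lborel)"
  proof (rule nn_integral_mono_AE)
    show "AE u in lborel. (\<integral>\<^sup>+\<omega>. ennreal ((Z (max 0 u) \<omega>)\<^sup>2) * indicator {0..R} u \<partial>M) \<le> ennreal K * indicator {0..R} u"
      using AE_lborel_singleton[of 0]
    proof eventually_elim
      fix u :: real assume "u \<noteq> 0"
      then show "(\<integral>\<^sup>+\<omega>. ennreal ((Z (max 0 u) \<omega>)\<^sup>2) * indicator {0..R} u \<partial>M) \<le> ennreal K * indicator {0..R} u"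
        using K[of u] by (cases "u \<in> {0..R}") auto
    qed
  qed
  also have "\<dots> = ennreal K * ennreal R" using R by (subst nn_integral_cmult) auto
  finally show ?thesis .
qed

lemma gbm_second_moment:
  assumes "0 \<le> t"
  shows "(\<integral>\<^sup>+\<omega>. ennreal ((gbm x b \<kappa> t \<omega>)\<^sup>2) \<partial>M) = ennreal (x\<^sup>2 * (exp (b * t))\<^sup>2 * exp (\<kappa>\<^sup>2 * t))"
proof -
  have "has_bochner_integral M (\<lambda>\<omega>. (gbm x b \<kappa> t \<omega>)\<^sup>2) (x\<^sup>2 * (exp (b * t))\<^sup>2 * exp (\<kappa>\<^sup>2 * t))"
    unfolding gbm_def power_mult_distrib
    using exp_mart_power_moment[OF assms, of \<kappa> 2] by (intro has_bochner_integral_mult_right) simp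
  then show ?thesis
    by (subst nn_integral_eq_integral) (auto simp: has_bochner_integral_iff)
qed

lemma gbm_L2_loc: "gbm x b \<kappa> \<in> L2_loc M F"
proof -
  have "(\<integral>\<^sup>+\<omega>. (\<integral>\<^sup>+u\<in>{0..R}. ennreal ((gbm x b \<kappa> u \<omega>)\<^sup>2) \<partial>lborel) \<partial>M) < \<infinity>" if "0 < R" for R
  proof (rule le_less_trans[OF nn_integral_process_square_le[OF gbm_measurable_process]])
    show "(\<integral>\<^sup>+\<omega>. ennreal ((gbm x b \<kappa> u \<omega>)\<^sup>2) \<partial>M) \<le> ennreal (x\<^sup>2 * (exp (\<bar>b\<bar> * R))\<^sup>2 * exp (\<kappa>\<^sup>2 * R))"
      if "0 < u" "u \<le> R" for u
      using that exp_mult_le_exp_abs[of u R b]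
      by (subst gbm_second_moment) (auto intro!: ennreal_leI mult_mono power_mono mult_left_mono)
    show "ennreal (x\<^sup>2 * (exp (\<bar>b\<bar> * R))\<^sup>2 * exp (\<kappa>\<^sup>2 * R)) * ennreal R < \<infinity>"
      by (simp add: ennreal_mult_less_top)
  qed (use that in auto)
  then show ?thesis
    using gbm_measurable_process gbm_measurable_F by (auto simp: L2_loc_def adapted_def)
qed

lemma L2_loc_imp_L1_loc_nonneg:
  assumes Z: "Z \<in> L2_loc M F" and nonneg: "\<And>t \<omega>. 0 \<le> t \<Longrightarrow> \<omega> \<in> space M \<Longrightarrow> 0 \<le> Z t \<omega>"
  shows "Z \<in> L1_loc_nonneg M F"
proof -
  have "(\<integral>\<^sup>+\<omega>. (\<integral>\<^sup>+t\<in>{0..R}. ennreal \<bar>Z t \<omega>\<bar> \<partial>lborel) \<partial>M) < \<infinity>" if R: "0 < R" for R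
  proof -
    have "(\<integral>\<^sup>+t\<in>{0..R}. ennreal \<bar>Z t \<omega>\<bar> \<partial>lborel) \<le> ennreal R + (\<integral>\<^sup>+t\<in>{0..R}. ennreal ((Z t \<omega>)\<^sup>2) \<partial>lborel)"
      if \<omega>: "\<omega> \<in> space M" for \<omega>
    proof -
      note [measurable] = measurable_process_section[OF L2_locD(1)[OF Z] \<omega>]
      have "ennreal \<bar>y\<bar> \<le> 1 + ennreal (y\<^sup>2)" for y :: real
      proof -
        have "\<bar>y\<bar> \<le> 1 + y\<^sup>2" using sum_squares_bound[of "\<bar>y\<bar>" 1] abs_ge_zero[of y] by (simp add: power2_abs)
        then have "ennreal \<bar>y\<bar> \<le> ennreal (1 + y\<^sup>2)" by (rule ennreal_leI)
        then show ?thesis by (simp add: ennreal_plus)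
      qed
      then have "(\<integral>\<^sup>+t. ennreal \<bar>Z (max 0 t) \<omega>\<bar> * indicator {0..R} t \<partial>lborel)
          \<le> (\<integral>\<^sup>+t. indicator {0..R} t + ennreal ((Z (max 0 t) \<omega>)\<^sup>2) * indicator {0..R} t \<partial>lborel)"
        by (intro nn_integral_mono) (auto simp: indicator_def)
      also have "\<dots> = (\<integral>\<^sup>+t. indicator {0..R} t \<partial>lborel) + (\<integral>\<^sup>+t. ennreal ((Z (max 0 t) \<omega>)\<^sup>2) * indicator {0..R} t \<partial>lborel)"
        by (rule nn_integral_add) measurable
      also have "(\<integral>\<^sup>+t. indicator {0..R} t \<partial>lborel) = ennreal R" using R by simp
      finally show ?thesis by (subst set_nn_integral_max_0, subst (2) set_nn_integral_max_0)
    qed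
    then have "(\<integral>\<^sup>+\<omega>. (\<integral>\<^sup>+t\<in>{0..R}. ennreal \<bar>Z t \<omega>\<bar> \<partial>lborel) \<partial>M)
        \<le> (\<integral>\<^sup>+\<omega>. ennreal R + (\<integral>\<^sup>+t\<in>{0..R}. ennreal ((Z t \<omega>)\<^sup>2) \<partial>lborel) \<partial>M)"
      by (intro nn_integral_mono) auto
    also have "\<dots> = ennreal R + (\<integral>\<^sup>+\<omega>. (\<integral>\<^sup>+t\<in>{0..R}. ennreal ((Z t \<omega>)\<^sup>2) \<partial>lborel) \<partial>M)"
      using set_nn_integral_process_measurable[OF L2_locD(1)[OF Z], of "\<lambda>x. x\<^sup>2" R]
      by (subst nn_integral_add) (auto simp: emeasure_space_1)
    also have "\<dots> < \<infinity>" using L2_locD(3)[OF Z R] by simp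
    finally show ?thesis .
  qed
  then show ?thesis
    using L2_locD(1,2)[OF Z] nonneg by (auto simp: L1_loc_nonneg_def)
qed

text \<open>The three summands of the constant are the errors from truncating at n, from freezing
  e^(b u) at the left endpoint, and from freezing the exponential martingale there.\<close>

lemma gbm_simple_process_error:
  assumes n: "0 < n" and R: "0 \<le> R" "R \<le> real n"
  shows "(\<integral>\<^sup>+\<omega>. (\<integral>\<^sup>+u\<in>{0..R}. ennreal ((simple_process (gbm_simple x b \<kappa> n) u \<omega> - \<kappa> * gbm x b \<kappa> u \<omega>)\<^sup>2) \<partial>lborel) \<partial>M)
    \<le> ennreal (3 * (\<kappa> * x)\<^sup>2 * (exp (\<bar>b\<bar> * R))\<^sup>2 * (exp (6 * \<kappa>\<^sup>2 * R) * (1 / real n)\<^sup>2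
        + exp (\<kappa>\<^sup>2 * R) * (exp (\<bar>b\<bar> * (1 / real n)) - 1)\<^sup>2 + exp (\<kappa>\<^sup>2 * R) * (exp (\<kappa>\<^sup>2 * (1 / real n)) - 1))) * ennreal R"
    (is "_ \<le> ennreal ?K * _")
proof (rule nn_integral_process_square_le)
  show "measurable_process M (\<lambda>u \<omega>. simple_process (gbm_simple x b \<kappa> n) u \<omega> - \<kappa> * gbm x b \<kappa> u \<omega>)"
    by (intro measurable_process_diff measurable_process_simple_process simple_integrand_gbm_simple n
        L2_locD(1)[OF L2_loc_cmult[OF gbm_L2_loc]])
next
  fix s assume s: "0 < s" "s \<le> R"
  let ?\<tau> = "\<lambda>i. real i / real n" and ?\<delta> = "1 / real n"
  have "s \<le> ?\<tau> (n * n)" using s R n by simp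
  then obtain i where i: "i < n * n" "s \<in> {?\<tau> i<..?\<tau> (Suc i)}"
    using partition_locate[of ?\<tau> s "n * n"] s by auto
  define u where "u = ?\<tau> i"
  have u: "0 \<le> u" "u \<le> s" "s - u \<le> ?\<delta>" "u \<le> R"
    using i s by (auto simp: u_def add_divide_distrib)
  let ?E = "exp_mart \<kappa>"
  have sp: "simple_process (gbm_simple x b \<kappa> n) s \<omega> = \<kappa> * (x * exp (b * u) * min (?E u \<omega>) (real n))" for \<omega>
    unfolding simple_process_def gbm_simple_def prod.case u_def
    by (rule partition_sum_indicator[of "n * n" ?\<tau>]) (use i in \<open>auto intro: divide_right_mono\<close>)
  let ?q = "\<lambda>\<omega>. 3 * (\<kappa> * x)\<^sup>2 * ((exp (b * u))\<^sup>2 * (?E u \<omega> - min (?E u \<omega>) (real n))\<^sup>2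
      + (exp (b * u) - exp (b * s))\<^sup>2 * (?E u \<omega>)\<^sup>2 + (exp (b * s))\<^sup>2 * (?E s \<omega> - ?E u \<omega>)\<^sup>2)"
  have le: "(simple_process (gbm_simple x b \<kappa> n) s \<omega> - \<kappa> * gbm x b \<kappa> s \<omega>)\<^sup>2 \<le> ?q \<omega>" for \<omega>
  proof -
    let ?a1 = "exp (b * u) * (?E u \<omega> - min (?E u \<omega>) (real n))"
    let ?a2 = "(exp (b * u) - exp (b * s)) * ?E u \<omega>" and ?a3 = "exp (b * s) * (?E s \<omega> - ?E u \<omega>)"
    \<comment> \<open>The intermediate products are e^(b u) E_u and e^(b s) E_u; each difference
      then pairs a deterministic factor with one random error whose second moment is known.\<close>
    have eq: "simple_process (gbm_simple x b \<kappa> n) s \<omega> - \<kappa> * gbm x b \<kappa> s \<omega> = (\<kappa> * x) * (?a2 - ?a1 - ?a3)"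
      unfolding sp gbm_def by (simp add: algebra_simps)
    have "(a2 - a1 - a3)\<^sup>2 \<le> 3 * (a1\<^sup>2 + a2\<^sup>2 + a3\<^sup>2)" for a1 a2 a3 :: real
    proof -
      have "0 \<le> (a2 + a1)\<^sup>2 + (a2 + a3)\<^sup>2 + (a1 - a3)\<^sup>2" by simp
      then show ?thesis by (simp add: power2_eq_square algebra_simps)
    qed
    then have "(\<kappa> * x)\<^sup>2 * (?a2 - ?a1 - ?a3)\<^sup>2 \<le> (\<kappa> * x)\<^sup>2 * (3 * (?a1\<^sup>2 + ?a2\<^sup>2 + ?a3\<^sup>2))"
      by (intro mult_left_mono) auto
    then show ?thesis unfolding eq by (simp only: power_mult_distrib mult_ac)
  qed
  have E2: "has_bochner_integral M (\<lambda>\<omega>. (?E u \<omega>)\<^sup>2) (exp (\<kappa>\<^sup>2 * u))"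
    using exp_mart_power_moment[OF u(1), of \<kappa> 2] by simp
  have tr: "has_bochner_integral M (\<lambda>\<omega>. (?E u \<omega> - min (?E u \<omega>) (real n))\<^sup>2)
      (\<integral>\<omega>. (?E u \<omega> - min (?E u \<omega>) (real n))\<^sup>2 \<partial>M)"
    using exp_mart_truncation_second_moment(1)[OF u(1), of "real n" \<kappa>] n by (simp add: has_bochner_integral_iff)
  have q: "has_bochner_integral M ?q (3 * (\<kappa> * x)\<^sup>2 * ((exp (b * u))\<^sup>2 * (\<integral>\<omega>. (?E u \<omega> - min (?E u \<omega>) (real n))\<^sup>2 \<partial>M)
      + (exp (b * u) - exp (b * s))\<^sup>2 * exp (\<kappa>\<^sup>2 * u) + (exp (b * s))\<^sup>2 * (exp (\<kappa>\<^sup>2 * s) - exp (\<kappa>\<^sup>2 * u))))"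
    by (intro has_bochner_integral_mult_right has_bochner_integral_add tr E2 exp_mart_diff_second_moment u)
  have "(\<integral>\<^sup>+\<omega>. ennreal ((simple_process (gbm_simple x b \<kappa> n) s \<omega> - \<kappa> * gbm x b \<kappa> s \<omega>)\<^sup>2) \<partial>M) \<le> (\<integral>\<^sup>+\<omega>. ennreal (?q \<omega>) \<partial>M)"
    by (intro nn_integral_mono ennreal_leI le)
  also have "\<dots> = ennreal (\<integral>\<omega>. ?q \<omega> \<partial>M)"
    using q by (intro nn_integral_eq_integral) (auto simp: has_bochner_integral_iff)
  also have "(\<integral>\<omega>. ?q \<omega> \<partial>M) = (3 * (\<kappa> * x)\<^sup>2 * ((exp (b * u))\<^sup>2 * (\<integral>\<omega>. (?E u \<omega> - min (?E u \<omega>) (real n))\<^sup>2 \<partial>M)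
      + (exp (b * u) - exp (b * s))\<^sup>2 * exp (\<kappa>\<^sup>2 * u) + (exp (b * s))\<^sup>2 * (exp (\<kappa>\<^sup>2 * s) - exp (\<kappa>\<^sup>2 * u))))"
    using q by (rule has_bochner_integral_integral_eq)
  also have "ennreal \<dots> \<le> ennreal ?K"
  proof (rule ennreal_leI)
    let ?B = "(exp (\<bar>b\<bar> * R))\<^sup>2"
    have eu: "(exp (b * u))\<^sup>2 \<le> ?B" "(exp (b * s))\<^sup>2 \<le> ?B"
      using exp_mult_le_exp_abs[of u R b] exp_mult_le_exp_abs[of s R b] u s by (auto intro!: power_mono)
    have k: "\<kappa>\<^sup>2 * u \<le> \<kappa>\<^sup>2 * R" using u by (intro mult_left_mono) auto
    have "(exp (b * u))\<^sup>2 * (\<integral>\<omega>. (?E u \<omega> - min (?E u \<omega>) (real n))\<^sup>2 \<partial>M) \<le> ?B * (exp (6 * \<kappa>\<^sup>2 * R) * ?\<delta>\<^sup>2)"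
    proof (intro mult_mono eu)
      have "(\<integral>\<omega>. (?E u \<omega> - min (?E u \<omega>) (real n))\<^sup>2 \<partial>M) \<le> exp (6 * \<kappa>\<^sup>2 * u) / (real n)\<^sup>2"
        using n by (intro exp_mart_truncation_second_moment u) auto
      also have "\<dots> \<le> exp (6 * \<kappa>\<^sup>2 * R) / (real n)\<^sup>2" using k by (intro divide_right_mono) auto
      finally show "(\<integral>\<omega>. (?E u \<omega> - min (?E u \<omega>) (real n))\<^sup>2 \<partial>M) \<le> exp (6 * \<kappa>\<^sup>2 * R) * ?\<delta>\<^sup>2"
        by (simp add: power_divide)
    qed auto
    moreover have "(exp (b * u) - exp (b * s))\<^sup>2 * exp (\<kappa>\<^sup>2 * u) \<le> ?B * (exp (\<kappa>\<^sup>2 * R) * (exp (\<bar>b\<bar> * ?\<delta>) - 1)\<^sup>2)"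
    proof -
      have "exp (b * s) = exp (b * u) * exp (b * (s - u))" by (simp add: algebra_simps flip: exp_add)
      then have "(exp (b * u) - exp (b * s))\<^sup>2 = (exp (b * u))\<^sup>2 * \<bar>exp (b * (s - u)) - 1\<bar>\<^sup>2"
        by (simp add: power2_eq_square algebra_simps)
      also have "\<dots> \<le> ?B * (exp (\<bar>b\<bar> * ?\<delta>) - 1)\<^sup>2"
      proof (intro mult_mono eu power_mono)
        have "\<bar>exp (b * (s - u)) - 1\<bar> \<le> exp \<bar>b * (s - u)\<bar> - 1" by (rule abs_exp_minus_1_le)
        also have "\<dots> \<le> exp (\<bar>b\<bar> * ?\<delta>) - 1"
          using u mult_left_mono[OF u(3), of "\<bar>b\<bar>"] by (simp add: abs_mult)
        finally show "\<bar>exp (b * (s - u)) - 1\<bar> \<le> exp (\<bar>b\<bar> * ?\<delta>) - 1" .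
      qed auto
      finally have "(exp (b * u) - exp (b * s))\<^sup>2 * exp (\<kappa>\<^sup>2 * u) \<le> ?B * (exp (\<bar>b\<bar> * ?\<delta>) - 1)\<^sup>2 * exp (\<kappa>\<^sup>2 * R)"
        using k by (intro mult_mono) auto
      then show ?thesis by (simp only: mult_ac)
    qed
    moreover have "(exp (b * s))\<^sup>2 * (exp (\<kappa>\<^sup>2 * s) - exp (\<kappa>\<^sup>2 * u)) \<le> ?B * (exp (\<kappa>\<^sup>2 * R) * (exp (\<kappa>\<^sup>2 * ?\<delta>) - 1))"
      using u s by (intro mult_mono eu exp_diff_le) (auto intro: mult_left_mono)
    ultimately have "(exp (b * u))\<^sup>2 * (\<integral>\<omega>. (?E u \<omega> - min (?E u \<omega>) (real n))\<^sup>2 \<partial>M)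
      + (exp (b * u) - exp (b * s))\<^sup>2 * exp (\<kappa>\<^sup>2 * u) + (exp (b * s))\<^sup>2 * (exp (\<kappa>\<^sup>2 * s) - exp (\<kappa>\<^sup>2 * u))
      \<le> ?B * (exp (6 * \<kappa>\<^sup>2 * R) * ?\<delta>\<^sup>2 + exp (\<kappa>\<^sup>2 * R) * (exp (\<bar>b\<bar> * ?\<delta>) - 1)\<^sup>2 + exp (\<kappa>\<^sup>2 * R) * (exp (\<kappa>\<^sup>2 * ?\<delta>) - 1))"
      unfolding distrib_left by (intro add_mono)
    then show "3 * (\<kappa> * x)\<^sup>2 * ((exp (b * u))\<^sup>2 * (\<integral>\<omega>. (?E u \<omega> - min (?E u \<omega>) (real n))\<^sup>2 \<partial>M)
      + (exp (b * u) - exp (b * s))\<^sup>2 * exp (\<kappa>\<^sup>2 * u) + (exp (b * s))\<^sup>2 * (exp (\<kappa>\<^sup>2 * s) - exp (\<kappa>\<^sup>2 * u))) \<le> ?K"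
      unfolding mult.assoc[of _ ?B] by (intro mult_left_mono) auto
  qed
  finally show "(\<integral>\<^sup>+\<omega>. ennreal ((simple_process (gbm_simple x b \<kappa> n) s \<omega> - \<kappa> * gbm x b \<kappa> s \<omega>)\<^sup>2) \<partial>M) \<le> ennreal ?K" .
qed (use R in auto)


text \<open>Summation by parts expresses the candidate integral through increments of the
  exponential martingale. The error is then the Riemann sum error \<open>D\<close> plus the time
  integral \<open>G\<close> caused by replacing the martingale with a step function.\<close>

lemma gbm_simple_integral_error:
  assumes n: "0 < n" and t: "0 \<le> t" "t \<le> real n"
  shows "(\<integral>\<^sup>+\<omega>. ennreal ((simple_integral W (gbm_simple x b \<kappa> n) t \<omega>
        - (gbm x b \<kappa> t \<omega> - x - b * (LINT s:{0..t}|lborel. gbm x b \<kappa> s \<omega>)))\<^sup>2) \<partial>M)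
    \<le> ennreal (x\<^sup>2) * (2 * ennreal (2 * (exp (\<bar>b\<bar> * t))\<^sup>2 * \<kappa>\<^sup>2 * t *
          (exp (\<kappa>\<^sup>2 * t) * (exp (\<kappa>\<^sup>2 * (1 / real n)) - 1) + exp (6 * \<kappa>\<^sup>2 * t) * (1 / real n)\<^sup>2))
        + 2 * (ennreal t * (ennreal (b\<^sup>2 * (exp (\<bar>b\<bar> * t))\<^sup>2 * (exp (\<kappa>\<^sup>2 * t) * (exp (\<kappa>\<^sup>2 * (1 / real n)) - 1))) * ennreal t)))"
proof -
  let ?\<tau> = "\<lambda>i. real i / real n" and ?m = "n * n" and ?\<delta> = "1 / real n" and ?E = "exp_mart \<kappa>"
  define s where "s i = min t (?\<tau> i)" for i
  have \<tau>mono: "?\<tau> i \<le> ?\<tau> (Suc i)" and \<tau>mesh: "?\<tau> (Suc i) - ?\<tau> i = ?\<delta>" for i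
    by (auto intro: divide_right_mono simp: add_divide_distrib)
  have s0: "s 0 = 0" and sm: "s ?m = t" using t n by (auto simp: s_def)
  have mono: "s i \<le> s (Suc i)" for i using \<tau>mono[of i] by (auto simp: s_def min_def)
  have mesh: "s (Suc i) - s i \<le> ?\<delta>" for i using \<tau>mesh[of i] \<tau>mono[of i] by (auto simp: s_def min_def)
  have spos: "0 \<le> s i" "s i \<le> t" for i using t by (auto simp: s_def)
  \<comment> \<open>The step function takes right endpoint values, as the summation by parts
    dictates. It looks ahead in time, which is harmless because it is integrated only against
    du.\<close>
  define Y where "Y u \<omega> = (\<Sum>i<?m. ?E (s (Suc i)) \<omega> * indicator {s i<..s (Suc i)} u)" for u \<omega>
  define G where "G u \<omega> = b * exp (b * u) * (Y u \<omega> - ?E u \<omega>)" for u \<omega>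
  define D where "D \<omega> = (\<Sum>i<?m. exp (b * s i) * (?E (s (Suc i)) \<omega> - ?E (s i) \<omega>
        - \<kappa> * min (?E (s i) \<omega>) (real n) * (W (s (Suc i)) \<omega> - W (s i) \<omega>)))" for \<omega>
  let ?L = "\<lambda>\<omega>. LINT u:{0..t}|lborel. G u \<omega>"
  have SI: "simple_integral W (gbm_simple x b \<kappa> n) t \<omega>
      = x * (\<Sum>i<?m. exp (b * s i) * (\<kappa> * min (?E (s i) \<omega>) (real n) * (W (s (Suc i)) \<omega> - W (s i) \<omega>)))" for \<omega>
  proof -
    have "\<kappa> * (x * exp (b * ?\<tau> i) * min (?E (?\<tau> i) \<omega>) (real n)) * (W (s (Suc i)) \<omega> - W (s i) \<omega>)
        = x * (exp (b * s i) * (\<kappa> * min (?E (s i) \<omega>) (real n) * (W (s (Suc i)) \<omega> - W (s i) \<omega>)))" for i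
    proof (cases "?\<tau> i \<le> t")
      case True
      then have "s i = ?\<tau> i" by (simp add: s_def)
      then show ?thesis by (simp only: mult_ac)
    next
      \<comment> \<open>After t the truncated increment of W is 0, so it does not matter that the
        coefficients of the original and the stopped partition differ.\<close>
      case False
      then have "s i = t" "s (Suc i) = t" using \<tau>mono[of i] by (auto simp: s_def)
      then show ?thesis by simp
    qed
    then show ?thesis
      unfolding simple_integral_def gbm_simple_def prod.case sum_distrib_left s_def by (intro sum.cong refl) simp
  qed
  have path: "simple_integral W (gbm_simple x b \<kappa> n) t \<omega>
        - (gbm x b \<kappa> t \<omega> - x - b * (LINT s:{0..t}|lborel. gbm x b \<kappa> s \<omega>)) = (- x) * (D \<omega> + ?L \<omega>)" for \<omega>
  proof -
    have E0: "?E 0 \<omega> = 1" by (simp add: exp_mart_def W_zero)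
    have p1: "exp (b * t) * ?E t \<omega> - ?E 0 \<omega> - b * (LINT u:{0..t}|lborel. exp (b * u) * ?E u \<omega>)
      = (\<Sum>i<?m. exp (b * s i) * (?E (s (Suc i)) \<omega> - ?E (s i) \<omega>)) + ?L \<omega>"
      unfolding G_def
      by (rule step_interpolation_identity[OF t(1) s0 sm mono])
         (auto simp: Y_def intro: continuous_on_subset[OF continuous_on_exp_mart])
    have p2: "gbm x b \<kappa> t \<omega> - x - b * (LINT s:{0..t}|lborel. gbm x b \<kappa> s \<omega>)
        = x * (exp (b * t) * ?E t \<omega> - ?E 0 \<omega> - b * (LINT u:{0..t}|lborel. exp (b * u) * ?E u \<omega>))"
    proof -
      have "(LINT s:{0..t}|lborel. gbm x b \<kappa> s \<omega>) = x * (LINT u:{0..t}|lborel. exp (b * u) * ?E u \<omega>)"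
        unfolding gbm_def mult.assoc by simp
      then show ?thesis unfolding E0 by (simp add: gbm_def algebra_simps)
    qed
    have p3: "D \<omega> = (\<Sum>i<?m. exp (b * s i) * (?E (s (Suc i)) \<omega> - ?E (s i) \<omega>))
       - (\<Sum>i<?m. exp (b * s i) * (\<kappa> * min (?E (s i) \<omega>) (real n) * (W (s (Suc i)) \<omega> - W (s i) \<omega>)))"
      unfolding D_def sum_subtractf[symmetric] by (simp only: right_diff_distrib)
    have "x * q - x * (p + l) = (- x) * ((p - q) + l)" for p q l :: real
      by (simp add: algebra_simps)
    then show ?thesis unfolding SI p2 p1 p3 .
  qed
  have Ym: "measurable_process M Y"
  proof -
    have "(\<lambda>z. \<Sum>i<?m. ?E (s (Suc i)) (fst z) * indicator {s i<..s (Suc i)} (snd z))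
        \<in> borel_measurable (M \<Otimes>\<^sub>M restrict_space borel {0 :: real..})"
      using spos
      by (intro borel_measurable_sum borel_measurable_times)
        (auto intro!: measurable_compose[OF measurable_fst] measurable_compose[OF measurable_snd]
          measurable_restrict_space1[of "indicator _" borel])
    then show ?thesis
      unfolding measurable_process_def Y_def by (simp add: case_prod_beta')
  qed
  have Gm: "measurable_process M G"
  proof -
    have "measurable_process M (\<lambda>u \<omega>. Y u \<omega> - ?E u \<omega>)"
      using measurable_process_diff[OF Ym gbm_measurable_process[of 1 0 \<kappa>]] by (simp add: gbm_def)
    note 1 = this[unfolded measurable_process_def]
    have "(\<lambda>z. b * exp (b * snd z)) \<in> borel_measurable (M \<Otimes>\<^sub>M restrict_space borel {0 :: real..})"
      by (intro measurable_compose[OF measurable_snd] measurable_restrict_space1) measurable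
    from borel_measurable_times[OF this 1] show ?thesis
      unfolding measurable_process_def G_def by (simp add: case_prod_beta')
  qed
  have [measurable]: "D \<in> borel_measurable M"
    unfolding D_def[abs_def] using spos by measurable
  note [measurable] = set_integral_process_measurable[OF Gm, of t]
  have "(\<integral>\<^sup>+\<omega>. ennreal ((D \<omega>)\<^sup>2) \<partial>M)
     \<le> ennreal (2 * (exp (\<bar>b\<bar> * t))\<^sup>2 * \<kappa>\<^sup>2 * t * (exp (\<kappa>\<^sup>2 * t) * (exp (\<kappa>\<^sup>2 * ?\<delta>) - 1) + exp (6 * \<kappa>\<^sup>2 * t) / (real n)\<^sup>2))"
  proof -
    have "\<bar>exp (b * s i)\<bar> \<le> exp (\<bar>b\<bar> * t)" for i using exp_mult_le_exp_abs[OF spos] by simp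
    then show ?thesis
      unfolding D_def using n s0 sm by (intro exp_mart_riemann_sum_error mono mesh) auto
  qed
  then have Dle: "(\<integral>\<^sup>+\<omega>. ennreal ((D \<omega>)\<^sup>2) \<partial>M)
     \<le> ennreal (2 * (exp (\<bar>b\<bar> * t))\<^sup>2 * \<kappa>\<^sup>2 * t * (exp (\<kappa>\<^sup>2 * t) * (exp (\<kappa>\<^sup>2 * ?\<delta>) - 1) + exp (6 * \<kappa>\<^sup>2 * t) * ?\<delta>\<^sup>2))"
    by (simp add: power_divide)
  have "(\<integral>\<^sup>+\<omega>. (\<integral>\<^sup>+u\<in>{0..t}. ennreal ((G u \<omega>)\<^sup>2) \<partial>lborel) \<partial>M)
      \<le> ennreal (b\<^sup>2 * (exp (\<bar>b\<bar> * t))\<^sup>2 * (exp (\<kappa>\<^sup>2 * t) * (exp (\<kappa>\<^sup>2 * ?\<delta>) - 1))) * ennreal t"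
  proof (rule nn_integral_process_square_le[OF Gm t(1)])
    fix u assume u: "0 < u" "u \<le> t"
    then obtain i where i: "i < ?m" "u \<in> {s i<..s (Suc i)}"
      using partition_locate[of s u ?m] s0 sm by auto
    have "Y u \<omega> = ?E (s (Suc i)) \<omega>" for \<omega>
      unfolding Y_def by (rule partition_sum_indicator[OF mono i])
    then have G: "(G u \<omega>)\<^sup>2 = b\<^sup>2 * (exp (b * u))\<^sup>2 * (?E (s (Suc i)) \<omega> - ?E u \<omega>)\<^sup>2" for \<omega>
      by (simp add: G_def power_mult_distrib)
    have "has_bochner_integral M (\<lambda>\<omega>. (G u \<omega>)\<^sup>2)
        (b\<^sup>2 * (exp (b * u))\<^sup>2 * (exp (\<kappa>\<^sup>2 * s (Suc i)) - exp (\<kappa>\<^sup>2 * u)))"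
      unfolding G using i u by (intro has_bochner_integral_mult_right exp_mart_diff_second_moment) auto
    then have "(\<integral>\<^sup>+\<omega>. ennreal ((G u \<omega>)\<^sup>2) \<partial>M) = ennreal (b\<^sup>2 * (exp (b * u))\<^sup>2 * (exp (\<kappa>\<^sup>2 * s (Suc i)) - exp (\<kappa>\<^sup>2 * u)))"
      by (subst nn_integral_eq_integral) (auto simp: has_bochner_integral_iff)
    also have "\<dots> \<le> ennreal (b\<^sup>2 * (exp (\<bar>b\<bar> * t))\<^sup>2 * (exp (\<kappa>\<^sup>2 * t) * (exp (\<kappa>\<^sup>2 * ?\<delta>) - 1)))"
    proof -
      have e: "(exp (b * u))\<^sup>2 \<le> (exp (\<bar>b\<bar> * t))\<^sup>2"
        using u by (intro power_mono exp_mult_le_exp_abs) auto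
      have d: "exp (\<kappa>\<^sup>2 * s (Suc i)) - exp (\<kappa>\<^sup>2 * u) \<le> exp (\<kappa>\<^sup>2 * t) * (exp (\<kappa>\<^sup>2 * ?\<delta>) - 1)"
        using i mesh[of i] spos by (intro exp_diff_le) auto
      show ?thesis
        using i by (intro ennreal_leI mult_mono[OF mult_left_mono[OF e] d]) (auto intro: mult_left_mono)
    qed
    finally show "(\<integral>\<^sup>+\<omega>. ennreal ((G u \<omega>)\<^sup>2) \<partial>M)
      \<le> ennreal (b\<^sup>2 * (exp (\<bar>b\<bar> * t))\<^sup>2 * (exp (\<kappa>\<^sup>2 * t) * (exp (\<kappa>\<^sup>2 * ?\<delta>) - 1)))" .
  qed
  then have Lle: "(\<integral>\<^sup>+\<omega>. ennreal ((?L \<omega>)\<^sup>2) \<partial>M)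
      \<le> ennreal t * (ennreal (b\<^sup>2 * (exp (\<bar>b\<bar> * t))\<^sup>2 * (exp (\<kappa>\<^sup>2 * t) * (exp (\<kappa>\<^sup>2 * ?\<delta>) - 1))) * ennreal t)"
    by (intro order_trans[OF set_integral_process_second_moment_le[OF Gm t(1)]] mult_left_mono) auto
  have "(\<integral>\<^sup>+\<omega>. ennreal ((simple_integral W (gbm_simple x b \<kappa> n) t \<omega>
        - (gbm x b \<kappa> t \<omega> - x - b * (LINT s:{0..t}|lborel. gbm x b \<kappa> s \<omega>)))\<^sup>2) \<partial>M)
      = (\<integral>\<^sup>+\<omega>. ennreal (x\<^sup>2) * ennreal ((D \<omega> + ?L \<omega>)\<^sup>2) \<partial>M)"
    unfolding path by (simp add: power_mult_distrib ennreal_mult)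
  also have "\<dots> = ennreal (x\<^sup>2) * (\<integral>\<^sup>+\<omega>. ennreal ((D \<omega> + ?L \<omega>)\<^sup>2) \<partial>M)"
    by (rule nn_integral_cmult) measurable
  also have "(\<integral>\<^sup>+\<omega>. ennreal ((D \<omega> + ?L \<omega>)\<^sup>2) \<partial>M)
      \<le> 2 * (\<integral>\<^sup>+\<omega>. ennreal ((D \<omega>)\<^sup>2) \<partial>M) + 2 * (\<integral>\<^sup>+\<omega>. ennreal ((?L \<omega>)\<^sup>2) \<partial>M)"
    by (rule nn_integral_square_add_le) measurable
  also note Dle
  also note Lle
  finally show ?thesis by (simp add: mult_left_mono add_mono)
qed


text \<open>The equation dX = b X dt + \<kappa> X dW, solved for its stochastic integral, names the
  candidate; the two error estimates then verify the definition.\<close>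

lemma ito_integral_gbm:
  "ito_integral M F W (\<lambda>t \<omega>. \<kappa> * gbm x b \<kappa> t \<omega>)
    (\<lambda>t \<omega>. gbm x b \<kappa> t \<omega> - x - b * (LINT s:{0..t}|lborel. gbm x b \<kappa> s \<omega>))"
  (is "ito_integral M F W ?Z ?I")
  unfolding ito_integral_def
proof (intro conjI exI[of _ "\<lambda>k. gbm_simple x b \<kappa> (Suc k)"] allI impI)
  show "adapted F ?I"
    unfolding adapted_def
    by (intro allI impI borel_measurable_diff borel_measurable_times borel_measurable_const
        gbm_integral_measurable_F gbm_measurable_F)
  have "continuous_on {0..} (\<lambda>t. LINT s:{0..t}|lborel. gbm x b \<kappa> s \<omega>)" for \<omega>
    by (intro continuous_on_atLeast_0I continuous_on_set_integral gbm_set_integrable)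
  then show "AE \<omega> in M. continuous_on {0..} (\<lambda>t. ?I t \<omega>)"
    by (intro AE_I2 continuous_intros continuous_on_gbm)
  show "simple_integrand M F (gbm_simple x b \<kappa> (Suc k))" for k
    by (rule simple_integrand_gbm_simple) simp
  have inv: "(\<lambda>k. 1 / real (Suc k)) \<longlonglongrightarrow> 0"
    using LIMSEQ_inverse_real_of_nat by (simp add: inverse_eq_divide)
  \<comment> \<open>The error estimates hold once the partition reaches the horizon, hence
    eventually. \<open>Suc k\<close> is used throughout because the mesh is its reciprocal.\<close>
  have large: "\<forall>\<^sub>F k in sequentially. R \<le> real (Suc k)" for R
    using filterlim_compose[OF filterlim_real_sequentially filterlim_Suc]
    by (auto simp: filterlim_at_top)
  \<comment> \<open>Both error bounds are continuous functions of the mesh that vanish at 0; this is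
    why they were written in terms of 1/n.\<close>
  have lim: "(\<lambda>k. ennreal (f (1 / real (Suc k)))) \<longlonglongrightarrow> 0" if "isCont f 0" "f 0 = 0" for f :: "real \<Rightarrow> real"
    using tendsto_ennrealI[OF isCont_tendsto_compose[OF that(1) inv]] that(2) by simp
  show "(\<lambda>k. \<integral>\<^sup>+\<omega>. (\<integral>\<^sup>+t\<in>{0..R}. ennreal (\<bar>simple_process (gbm_simple x b \<kappa> (Suc k)) t \<omega> - ?Z t \<omega>\<bar>\<^sup>2) \<partial>lborel) \<partial>M)
      \<longlonglongrightarrow> 0" if R: "0 < R" for R
  proof (rule tendsto_sandwich[OF _ _ tendsto_const])
    let ?f = "\<lambda>d. 3 * (\<kappa> * x)\<^sup>2 * (exp (\<bar>b\<bar> * R))\<^sup>2 * (exp (6 * \<kappa>\<^sup>2 * R) * d\<^sup>2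
        + exp (\<kappa>\<^sup>2 * R) * (exp (\<bar>b\<bar> * d) - 1)\<^sup>2 + exp (\<kappa>\<^sup>2 * R) * (exp (\<kappa>\<^sup>2 * d) - 1))"
    show "\<forall>\<^sub>F k in sequentially.
       (\<integral>\<^sup>+\<omega>. (\<integral>\<^sup>+t\<in>{0..R}. ennreal (\<bar>simple_process (gbm_simple x b \<kappa> (Suc k)) t \<omega> - ?Z t \<omega>\<bar>\<^sup>2) \<partial>lborel) \<partial>M)
       \<le> ennreal (?f (1 / real (Suc k))) * ennreal R"
      using large[of R]
    proof eventually_elim
      fix k assume "R \<le> real (Suc k)"
      with R show "(\<integral>\<^sup>+\<omega>. (\<integral>\<^sup>+t\<in>{0..R}. ennreal (\<bar>simple_process (gbm_simple x b \<kappa> (Suc k)) t \<omega> - ?Z t \<omega>\<bar>\<^sup>2) \<partial>lborel) \<partial>M)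
       \<le> ennreal (?f (1 / real (Suc k))) * ennreal R"
        unfolding power2_abs by (intro gbm_simple_process_error) auto
    qed
    have "(\<lambda>k. ennreal R * ennreal (?f (1 / real (Suc k)))) \<longlonglongrightarrow> ennreal R * 0"
      by (intro ennreal_tendsto_cmult lim continuous_intros) auto
    then show "(\<lambda>k. ennreal (?f (1 / real (Suc k))) * ennreal R) \<longlonglongrightarrow> 0" by (simp only: mult.commute mult_zero_right mult_zero_left)
  qed simp
  show "(\<lambda>k. \<integral>\<^sup>+\<omega>. ennreal (\<bar>simple_integral W (gbm_simple x b \<kappa> (Suc k)) t \<omega> - ?I t \<omega>\<bar>\<^sup>2) \<partial>M) \<longlonglongrightarrow> 0"
    if t: "0 \<le> t" for t
  proof (rule tendsto_sandwich[OF _ _ tendsto_const])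
    let ?f = "\<lambda>d. 2 * (exp (\<bar>b\<bar> * t))\<^sup>2 * \<kappa>\<^sup>2 * t * (exp (\<kappa>\<^sup>2 * t) * (exp (\<kappa>\<^sup>2 * d) - 1) + exp (6 * \<kappa>\<^sup>2 * t) * d\<^sup>2)"
    let ?g = "\<lambda>d. b\<^sup>2 * (exp (\<bar>b\<bar> * t))\<^sup>2 * (exp (\<kappa>\<^sup>2 * t) * (exp (\<kappa>\<^sup>2 * d) - 1))"
    show "\<forall>\<^sub>F k in sequentially. (\<integral>\<^sup>+\<omega>. ennreal (\<bar>simple_integral W (gbm_simple x b \<kappa> (Suc k)) t \<omega> - ?I t \<omega>\<bar>\<^sup>2) \<partial>M)
       \<le> ennreal (x\<^sup>2) * (2 * ennreal (?f (1 / real (Suc k))) + 2 * (ennreal t * (ennreal (?g (1 / real (Suc k))) * ennreal t)))"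
      using large[of t]
    proof eventually_elim
      fix k assume "t \<le> real (Suc k)"
      with t show "(\<integral>\<^sup>+\<omega>. ennreal (\<bar>simple_integral W (gbm_simple x b \<kappa> (Suc k)) t \<omega> - ?I t \<omega>\<bar>\<^sup>2) \<partial>M)
       \<le> ennreal (x\<^sup>2) * (2 * ennreal (?f (1 / real (Suc k))) + 2 * (ennreal t * (ennreal (?g (1 / real (Suc k))) * ennreal t)))"
        unfolding power2_abs by (intro gbm_simple_integral_error) auto
    qed
    have "(\<lambda>k. ennreal (x\<^sup>2) * (2 * ennreal (?f (1 / real (Suc k))) + 2 * (ennreal t * (ennreal t * ennreal (?g (1 / real (Suc k)))))))
      \<longlonglongrightarrow> ennreal (x\<^sup>2) * (2 * 0 + 2 * (ennreal t * (ennreal t * 0)))"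
      by (intro ennreal_tendsto_cmult tendsto_add lim continuous_intros) auto
    then show "(\<lambda>k. ennreal (x\<^sup>2) * (2 * ennreal (?f (1 / real (Suc k))) + 2 * (ennreal t * (ennreal (?g (1 / real (Suc k))) * ennreal t))))
      \<longlonglongrightarrow> 0" by (simp only: mult.commute[of "ennreal (?g _)"] mult_zero_right add_0)
  qed simp
qed

section \<open>The value function\<close>

text \<open>With c = a X and \<sigma> \<pi> = \<kappa> X the wealth equation becomes linear in X
  with drift r + lam \<kappa> - a, so the drift of the geometric Brownian motion is forced.\<close>

lemma gbm_admissible:
  assumes \<sigma>: "\<sigma> \<noteq> 0" and x: "0 < x" and a: "0 \<le> a" and b: "b = r + lam * \<kappa> - a"
  shows "((\<lambda>t \<omega>. a * gbm x b \<kappa> t \<omega>), (\<lambda>t \<omega>. \<kappa> / \<sigma> * gbm x b \<kappa> t \<omega>)) \<in> admissible M F W r \<sigma> lam x"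
proof -
  let ?X = "gbm x b \<kappa>"
  have nonneg: "0 \<le> ?X t \<omega>" for t \<omega>
    using x exp_mart_pos[of \<kappa> t \<omega>] by (simp add: gbm_def)
  have "(\<lambda>t \<omega>. a * ?X t \<omega>) \<in> L1_loc_nonneg M F"
    using nonneg a by (intro L2_loc_imp_L1_loc_nonneg L2_loc_cmult gbm_L2_loc) auto
  moreover have "(\<lambda>t \<omega>. \<kappa> / \<sigma> * ?X t \<omega>) \<in> L2_loc M F"
    by (intro L2_loc_cmult gbm_L2_loc)
  moreover have "wealth_process M F W r \<sigma> lam x (\<lambda>t \<omega>. a * ?X t \<omega>) (\<lambda>t \<omega>. \<kappa> / \<sigma> * ?X t \<omega>) ?X"
    unfolding wealth_process_def
  proof (intro conjI exI)
    show "adapted F ?X" using gbm_measurable_F by (auto simp: adapted_def)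
    show "AE \<omega> in M. continuous_on {0..} (\<lambda>t. ?X t \<omega>)" by (intro AE_I2 continuous_on_gbm)
    have "(\<lambda>t \<omega>. \<sigma> * (\<kappa> / \<sigma> * ?X t \<omega>)) = (\<lambda>t \<omega>. \<kappa> * ?X t \<omega>)" using \<sigma> by simp
    then show "ito_integral M F W (\<lambda>t \<omega>. \<sigma> * (\<kappa> / \<sigma> * ?X t \<omega>))
        (\<lambda>t \<omega>. ?X t \<omega> - x - b * (LINT s:{0..t}|lborel. ?X s \<omega>))"
      using ito_integral_gbm by (simp only:)
    show "AE \<omega> in M. \<forall>t\<ge>0. ?X t \<omega> = x + (LINT s:{0..t}|lborel. r * ?X s \<omega> + \<sigma> * lam * (\<kappa> / \<sigma> * ?X s \<omega>))
        + (?X t \<omega> - x - b * (LINT s:{0..t}|lborel. ?X s \<omega>)) - (LINT s:{0..t}|lborel. a * ?X s \<omega>)"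
    proof (intro AE_I2 allI impI)
      fix \<omega> t
      have "(\<lambda>s. r * ?X s \<omega> + \<sigma> * lam * (\<kappa> / \<sigma> * ?X s \<omega>)) = (\<lambda>s. (r + lam * \<kappa>) * ?X s \<omega>)"
        using \<sigma> by (auto simp: field_simps)
      then have "(LINT s:{0..t}|lborel. r * ?X s \<omega> + \<sigma> * lam * (\<kappa> / \<sigma> * ?X s \<omega>))
          = (r + lam * \<kappa>) * (LINT s:{0..t}|lborel. ?X s \<omega>)" by simp
      then show "?X t \<omega> = x + (LINT s:{0..t}|lborel. r * ?X s \<omega> + \<sigma> * lam * (\<kappa> / \<sigma> * ?X s \<omega>))
        + (?X t \<omega> - x - b * (LINT s:{0..t}|lborel. ?X s \<omega>)) - (LINT s:{0..t}|lborel. a * ?X s \<omega>)"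
        unfolding b by (simp add: algebra_simps)
    qed
  qed
  ultimately show ?thesis
    using nonneg by (auto simp: admissible_def)
qed

text \<open>For \<kappa> = lam / \<gamma> the expected discounted disutility at time s is K e^(-a
  s), with the same rate as in the dual bound; its integral K / a is the claimed value up to
  sign.\<close>

lemma objective_gbm:
  fixes r \<rho> lam \<gamma> x a b \<kappa> :: real
  assumes \<gamma>: "\<gamma> > 1" and x: "x > 0"
    and a: "a = (\<rho> - (1 - \<gamma>) * (r + lam\<^sup>2 / (2 * \<gamma>))) / \<gamma>" "a > 0"
    and \<kappa>: "\<kappa> = lam / \<gamma>" and b: "b = r + lam * \<kappa> - a"
  shows "objective M \<rho> \<gamma> (\<lambda>t \<omega>. a * gbm x b \<kappa> t \<omega>) = ereal (a powr (- \<gamma>) * x powr (1 - \<gamma>) / (1 - \<gamma>))"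
proof -
  interpret P: pair_sigma_finite M lborel by unfold_locales
  define K where "K = (a * x) powr (1 - \<gamma>) / (\<gamma> - 1)"
  have K: "0 \<le> K" using \<gamma> by (simp add: K_def)
  define U where "U s \<omega> = K * exp ((- \<rho> + (1 - \<gamma>) * b) * s) * exp_mart \<kappa> (max 0 s) \<omega> powr (1 - \<gamma>)" for s \<omega>
  note [measurable] = exp_mart_jointly_measurable[of \<kappa>]
  have U: "e2ennreal (- (ereal (exp (- \<rho> * s)) * crra_utility \<gamma> (a * gbm x b \<kappa> s \<omega>))) = ennreal (U s \<omega>)"
    if s: "0 \<le> s" for s \<omega>
  proof -
    define E where "E = exp_mart \<kappa> s \<omega>"
    have E: "0 < E" by (simp add: E_def exp_mart_pos)
    define z where "z = (a * x) * exp (b * s) * E"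
    have g: "a * gbm x b \<kappa> s \<omega> = z" by (simp add: gbm_def E_def z_def)
    have pos: "0 < z" using a(2) x E by (simp add: z_def)
    have "z powr (1 - \<gamma>) = (a * x) powr (1 - \<gamma>) * exp (b * s) powr (1 - \<gamma>) * E powr (1 - \<gamma>)"
      using a(2) x E by (simp add: z_def powr_mult)
    also have "exp (b * s) powr (1 - \<gamma>) = exp ((1 - \<gamma>) * b * s)" by (simp add: powr_def mult.assoc)
    finally have pw: "z powr (1 - \<gamma>) = (a * x) powr (1 - \<gamma>) * exp ((1 - \<gamma>) * b * s) * E powr (1 - \<gamma>)" .
    have ex: "exp (- \<rho> * s) * exp ((1 - \<gamma>) * b * s) = exp ((- \<rho> + (1 - \<gamma>) * b) * s)"
      by (simp only: distrib_right exp_add)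
    have "- (ereal (exp (- \<rho> * s)) * crra_utility \<gamma> z)
        = ereal (exp (- \<rho> * s) * (z powr (1 - \<gamma>) / (\<gamma> - 1)))"
      using pos \<gamma> by (simp add: crra_utility_def minus_divide_right)
    also have "exp (- \<rho> * s) * (z powr (1 - \<gamma>) / (\<gamma> - 1))
        = K * (exp (- \<rho> * s) * exp ((1 - \<gamma>) * b * s)) * E powr (1 - \<gamma>)"
      unfolding pw K_def by simp
    also have "\<dots> = U s \<omega>" unfolding ex using s by (simp add: U_def E_def)
    finally show ?thesis unfolding g by (simp add: e2ennreal_ereal)
  qed
  have mean: "(\<integral>\<^sup>+\<omega>. ennreal (U s \<omega>) \<partial>M) = ennreal (K * exp (- a * s))" if s: "0 \<le> s" for s
  proof -
    have [measurable]: "exp_mart \<kappa> s \<in> borel_measurable M" using s by simp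
    have "(\<integral>\<^sup>+\<omega>. ennreal (U s \<omega>) \<partial>M)
        = (\<integral>\<^sup>+\<omega>. ennreal (K * exp ((- \<rho> + (1 - \<gamma>) * b) * s)) * ennreal (exp_mart \<kappa> s \<omega> powr (1 - \<gamma>)) \<partial>M)"
      using s K by (intro nn_integral_cong) (simp add: U_def ennreal_mult)
    also have "\<dots> = ennreal (K * exp ((- \<rho> + (1 - \<gamma>) * b) * s)) * ennreal (exp (((1 - \<gamma>)\<^sup>2 - (1 - \<gamma>)) * \<kappa>\<^sup>2 * s / 2))"
      using s by (subst nn_integral_cmult) (auto simp: exp_mart_powr_nn_integral)
    also have "\<dots> = ennreal (K * (exp ((- \<rho> + (1 - \<gamma>) * b) * s) * exp (((1 - \<gamma>)\<^sup>2 - (1 - \<gamma>)) * \<kappa>\<^sup>2 * s / 2)))"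
      using K by (simp add: ennreal_mult mult.assoc)
    also have "exp ((- \<rho> + (1 - \<gamma>) * b) * s) * exp (((1 - \<gamma>)\<^sup>2 - (1 - \<gamma>)) * \<kappa>\<^sup>2 * s / 2) = exp (- a * s)"
    proof -
      have \<rho>: "\<rho> = \<gamma> * a + (1 - \<gamma>) * (r + lam\<^sup>2 / (2 * \<gamma>))" using \<gamma> by (simp add: a(1))
      \<comment> \<open>Discounting, the drift of wealth and the moment of order 1 - \<gamma> of the
        exponential martingale combine to the rate - a.\<close>
      have "- \<rho> + (1 - \<gamma>) * b + ((1 - \<gamma>)\<^sup>2 - (1 - \<gamma>)) * \<kappa>\<^sup>2 / 2 = - a"
        unfolding \<rho> b \<kappa> using \<gamma> by (simp add: field_simps power2_eq_square)
      then have "(- \<rho> + (1 - \<gamma>) * b + ((1 - \<gamma>)\<^sup>2 - (1 - \<gamma>)) * \<kappa>\<^sup>2 / 2) * s = - a * s" by simp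
      then have "(- \<rho> + (1 - \<gamma>) * b) * s + ((1 - \<gamma>)\<^sup>2 - (1 - \<gamma>)) * \<kappa>\<^sup>2 * s / 2 = - a * s"
        unfolding distrib_right[of _ _ s] by simp
      then show ?thesis by (metis exp_add)
    qed
    finally show ?thesis .
  qed
  have "(\<integral>\<^sup>+\<omega>. (\<integral>\<^sup>+s\<in>{0..}. e2ennreal (- (ereal (exp (- \<rho> * s)) * crra_utility \<gamma> (a * gbm x b \<kappa> s \<omega>))) \<partial>lborel) \<partial>M)
      = (\<integral>\<^sup>+\<omega>. (\<integral>\<^sup>+s. ennreal (U s \<omega>) * indicator {0..} s \<partial>lborel) \<partial>M)"
  proof (intro nn_integral_cong)
    fix \<omega> s
    show "e2ennreal (- (ereal (exp (- \<rho> * s)) * crra_utility \<gamma> (a * gbm x b \<kappa> s \<omega>))) * indicator {0..} s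
        = ennreal (U s \<omega>) * indicator {0..} s"
    proof (cases "0 \<le> s")
      case True
      show ?thesis unfolding U[OF True] ..
    qed simp
  qed
  also have "\<dots> = (\<integral>\<^sup>+s. (\<integral>\<^sup>+\<omega>. ennreal (U s \<omega>) * indicator {0..} s \<partial>M) \<partial>lborel)"
  proof (rule P.Fubini'[symmetric])
    have "(\<lambda>z. ennreal (U (snd z) (fst z)) * indicator {0..} (snd z)) \<in> borel_measurable (M \<Otimes>\<^sub>M lborel)"
      unfolding U_def by measurable
    then show "(\<lambda>(\<omega>, s). ennreal (U s \<omega>) * indicator {0..} s) \<in> borel_measurable (M \<Otimes>\<^sub>M lborel)"
      by (simp add: case_prod_beta')
  qed
  also have "\<dots> = (\<integral>\<^sup>+s. ennreal (K * exp (- a * s)) * indicator {0..} s \<partial>lborel)"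
    using mean by (intro nn_integral_cong) (auto simp: indicator_def)
  also have "\<dots> = ennreal (0 - - (K / a) * exp (- a * 0))"
  proof (rule nn_integral_FTC_atLeast)
    have "filterlim (\<lambda>s. - a * s) at_bot at_top"
      using a(2) by (intro filterlim_tendsto_neg_mult_at_bot[OF tendsto_const _ filterlim_ident]) simp
    then have "((\<lambda>s. exp (- a * s)) \<longlongrightarrow> 0) at_top"
      by (rule filterlim_compose[OF exp_at_bot])
    from tendsto_mult[OF tendsto_const this, of "- (K / a)"]
    show "((\<lambda>s. - (K / a) * exp (- a * s)) \<longlongrightarrow> 0) at_top" by simp
    show "((\<lambda>s. - (K / a) * exp (- a * s)) has_real_derivative K * exp (- a * s)) (at s)" for s
      using less_imp_neq[OF a(2)] by (auto intro!: derivative_eq_intros)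
  qed (use K in auto)
  also have "0 - - (K / a) * exp (- a * 0) = a powr (- \<gamma>) * x powr (1 - \<gamma>) / (\<gamma> - 1)"
  proof -
    have "(a * x) powr (1 - \<gamma>) = a powr (1 + - \<gamma>) * x powr (1 - \<gamma>)" using a(2) x by (simp add: powr_mult)
    also have "a powr (1 + - \<gamma>) = a * a powr (- \<gamma>)" using a(2) by (simp add: powr_add del: add_uminus_conv_diff)
    finally show ?thesis using less_imp_neq[OF a(2)] by (simp add: K_def)
  qed
  finally have "objective M \<rho> \<gamma> (\<lambda>t \<omega>. a * gbm x b \<kappa> t \<omega>)
      = - enn2ereal (ennreal (a powr (- \<gamma>) * x powr (1 - \<gamma>) / (\<gamma> - 1)))"
    unfolding objective_def by simp
  also have "\<dots> = ereal (a powr (- \<gamma>) * x powr (1 - \<gamma>) / (1 - \<gamma>))"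
    using \<gamma> minus_divide_right[of "a powr (- \<gamma>) * x powr (1 - \<gamma>)" "\<gamma> - 1"] by (simp add: enn2ereal_ennreal)
  finally show ?thesis .
qed

lemma value_function_eq:
  fixes r \<rho> \<sigma> lam \<gamma> x a :: real
  assumes \<gamma>: "\<gamma> > 1" and x: "x > 0" and \<sigma>: "\<sigma> \<noteq> 0"
    and a: "a = (\<rho> - (1 - \<gamma>) * (r + lam\<^sup>2 / (2 * \<gamma>))) / \<gamma>" "a > 0"
  shows "value_function M F W r \<sigma> lam \<rho> \<gamma> x = ereal (a powr (- \<gamma>) * x powr (1 - \<gamma>) / (1 - \<gamma>))"
proof (rule antisym)
  show "value_function M F W r \<sigma> lam \<rho> \<gamma> x \<le> ereal (a powr (- \<gamma>) * x powr (1 - \<gamma>) / (1 - \<gamma>))"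
    unfolding value_function_def by (rule SUP_least) (auto intro: objective_le[OF \<gamma> x a])
  define b where "b = r + lam * (lam / \<gamma>) - a"
  let ?c = "\<lambda>t \<omega>. a * gbm x b (lam / \<gamma>) t \<omega>" and ?\<pi> = "\<lambda>t \<omega>. lam / \<gamma> / \<sigma> * gbm x b (lam / \<gamma>) t \<omega>"
  have "(?c, ?\<pi>) \<in> admissible M F W r \<sigma> lam x"
    using a(2) by (intro gbm_admissible \<sigma> x b_def) simp
  then have "objective M \<rho> \<gamma> ?c \<le> value_function M F W r \<sigma> lam \<rho> \<gamma> x"
    unfolding value_function_def by (rule SUP_upper2) simp
  then show "ereal (a powr (- \<gamma>) * x powr (1 - \<gamma>) / (1 - \<gamma>)) \<le> value_function M F W r \<sigma> lam \<rho> \<gamma> x"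
    unfolding objective_gbm[OF \<gamma> x a refl b_def] .
qed

end

section \<open>From an arbitrary Brownian motion to one with all paths continuous\<close>

lemma ito_integral_cong_AE:
  assumes "AE \<omega> in M. \<forall>t\<ge>0. W t \<omega> = W' t \<omega>"
  shows "ito_integral M F W Z I \<longleftrightarrow> ito_integral M F W' Z I"
proof -
  have "(\<integral>\<^sup>+\<omega>. ennreal (\<bar>simple_integral W S t \<omega> - I t \<omega>\<bar>\<^sup>2) \<partial>M)
      = (\<integral>\<^sup>+\<omega>. ennreal (\<bar>simple_integral W' S t \<omega> - I t \<omega>\<bar>\<^sup>2) \<partial>M)"
    if S: "simple_integrand M F S" and t: "0 \<le> t" for S t
  proof (rule nn_integral_cong_AE)
    obtain n \<tau> \<xi> where S_eq: "S = (n, \<tau>, \<xi>)" by (cases S)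
    show "AE \<omega> in M. ennreal (\<bar>simple_integral W S t \<omega> - I t \<omega>\<bar>\<^sup>2) = ennreal (\<bar>simple_integral W' S t \<omega> - I t \<omega>\<bar>\<^sup>2)"
      using assms
    proof eventually_elim
      fix \<omega> assume W: "\<forall>t\<ge>0. W t \<omega> = W' t \<omega>"
      have "simple_integral W S t \<omega> = simple_integral W' S t \<omega>"
        unfolding S_eq simple_integral_def prod.case
      proof (intro sum.cong refl)
        fix i assume "i \<in> {..<n}"
        then have "0 \<le> \<tau> i" "\<tau> i < \<tau> (Suc i)" using simple_integrandD[OF S[unfolded S_eq], of i] by auto
        then show "\<xi> i \<omega> * (W (min t (\<tau> (Suc i))) \<omega> - W (min t (\<tau> i)) \<omega>)
            = \<xi> i \<omega> * (W' (min t (\<tau> (Suc i))) \<omega> - W' (min t (\<tau> i)) \<omega>)"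
          using W t by simp
      qed
      then show "ennreal (\<bar>simple_integral W S t \<omega> - I t \<omega>\<bar>\<^sup>2) = ennreal (\<bar>simple_integral W' S t \<omega> - I t \<omega>\<bar>\<^sup>2)"
        by simp
    qed
  qed
  then show ?thesis
    unfolding ito_integral_def by (intro conj_cong refl ex_cong1) simp
qed

lemma value_function_cong_AE:
  assumes "AE \<omega> in M. \<forall>t\<ge>0. W t \<omega> = W' t \<omega>"
  shows "value_function M F W = value_function M F W'"
  unfolding value_function_def[abs_def] admissible_def wealth_process_def ito_integral_cong_AE[OF assms] ..

text \<open>Changing W on a null set alters neither the laws nor the independence of increments, and
  adaptedness survives because the usual conditions put all null sets into
  \<open>F 0\<close>.\<close>

lemma obtain_continuous_brownian_motion:
  assumes usual: "usual_filtration M F" and W: "brownian_motion M F W"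
  obtains W' where "continuous_brownian_motion M F W'" "AE \<omega> in M. \<forall>t\<ge>0. W t \<omega> = W' t \<omega>"
proof -
  have "prob_space M" using usual unfolding usual_filtration_def by (elim conjE)
  have sub: "\<forall>t\<ge>0. subalgebra M (F t)" using usual unfolding usual_filtration_def by (elim conjE)
  have mono: "\<forall>s\<ge>0. \<forall>t\<ge>s. sets (F s) \<subseteq> sets (F t)"
    using usual unfolding usual_filtration_def by (elim conjE)
  have null: "null_sets M \<subseteq> sets (F 0)" using usual unfolding usual_filtration_def by (elim conjE)
  interpret prob_space M by fact
  have ad: "adapted F W" and W0: "AE \<omega> in M. W 0 \<omega> = 0" and cont: "AE \<omega> in M. continuous_on {0..} (\<lambda>t. W t \<omega>)"
    and incr: "\<forall>s\<ge>0. \<forall>t>s.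
        distributed M lborel (\<lambda>\<omega>. W t \<omega> - W s \<omega>) (normal_density 0 (sqrt (t - s))) \<and>
        indep_set (sets (F s)) {(\<lambda>\<omega>. W t \<omega> - W s \<omega>) -` B \<inter> space M | B. B \<in> sets borel}"
    using W unfolding brownian_motion_def by blast+
  obtain A where A: "A \<in> null_sets M"
    and good: "\<And>\<omega>. \<omega> \<in> space M \<Longrightarrow> \<omega> \<notin> A \<Longrightarrow> W 0 \<omega> = 0 \<and> continuous_on {0..} (\<lambda>t. W t \<omega>)"
    using AE_conjI[OF W0 cont] by (rule AE_obtain_null) blast
  \<comment> \<open>The zero path is also used outside \<open>space M\<close>, because the locale
    asks for continuity at every \<open>\<omega>\<close> of the type.\<close>
  define W' where "W' t \<omega> = (if \<omega> \<in> space M - A then W t \<omega> else 0)" for t \<omega>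
  have eq: "AE \<omega> in M. \<forall>t\<ge>0. W t \<omega> = W' t \<omega>"
    using AE_not_in[OF A] AE_space by eventually_elim (auto simp: W'_def)
  have AF: "A \<in> sets (F t)" and sp: "space (F t) = space M" if "0 \<le> t" for t
    using A null mono sub that by (auto simp: subalgebra_def)
  have W'm: "W' t \<in> borel_measurable (F t)" if "0 \<le> t" for t
  proof -
    have [measurable]: "W t \<in> borel_measurable (F t)" "A \<in> sets (F t)"
      using ad AF that by (auto simp: adapted_def)
    have "(\<lambda>\<omega>. if \<omega> \<in> A then 0 else W t \<omega>) \<in> borel_measurable (F t)" by measurable
    then show ?thesis
      by (rule measurable_cong[THEN iffD1, rotated]) (auto simp: W'_def sp[OF that])
  qed
  have M_meas: "f \<in> borel_measurable M" if "f \<in> borel_measurable (F t)" "0 \<le> t" for f :: "'a \<Rightarrow> real" and t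
    using measurable_from_subalg[of M "F t" f borel] sub that by auto
  have "continuous_brownian_motion M F W'"
  proof (unfold_locales)
    show "usual_filtration M F" by fact
    show W'c: "continuous_on {0..} (\<lambda>t. W' t \<omega>)" for \<omega>
      using good[of \<omega>] by (cases "\<omega> \<in> space M - A") (auto simp: W'_def)
    show W'0: "W' 0 \<omega> = 0" for \<omega> using good[of \<omega>] by (auto simp: W'_def)
    show "brownian_motion M F W'"
      unfolding brownian_motion_def
    proof (intro conjI allI impI)
      show "adapted F W'" using W'm by (auto simp: adapted_def)
      show "AE \<omega> in M. W' 0 \<omega> = 0" using W'0 by simp
      show "AE \<omega> in M. continuous_on {0..} (\<lambda>t. W' t \<omega>)"
        using W'c by (intro AE_I2)
    next
      fix s t :: real assume st: "0 \<le> s" "s < t"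
      let ?d = "\<lambda>\<omega>. W t \<omega> - W s \<omega>" and ?d' = "\<lambda>\<omega>. W' t \<omega> - W' s \<omega>"
      have dist: "distributed M lborel ?d (normal_density 0 (sqrt (t - s)))"
        and ind: "indep_set (sets (F s)) {?d -` B \<inter> space M | B. B \<in> sets borel}"
        using incr st by blast+
      have dm: "?d \<in> borel_measurable M" and d'm: "?d' \<in> borel_measurable M"
        using M_meas[of "W t" t] M_meas[of "W s" s] M_meas[OF W'm[of t]] M_meas[OF W'm[of s]] ad st
        by (auto simp: adapted_def)
      have deq: "AE \<omega> in M. ?d \<omega> = ?d' \<omega>"
        using eq st by (auto elim!: eventually_mono)
      have "distr M lborel ?d' = distr M lborel ?d"
        using deq dm d'm by (intro distr_cong_AE) auto
      then show "distributed M lborel ?d' (normal_density 0 (sqrt (t - s)))"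
        using dist d'm by (simp add: distributed_def)
      \<comment> \<open>Almost surely equal increments have events of equal probability, also inside
        any event a, so the product formula carries over.\<close>
      have pe: "prob (a \<inter> (?d' -` B \<inter> space M)) = prob (a \<inter> (?d -` B \<inter> space M))"
        if "a \<in> events" "B \<in> sets borel" for a B
      proof (rule measure_eq_AE)
        show "AE \<omega> in M. \<omega> \<in> a \<inter> (?d' -` B \<inter> space M) \<longleftrightarrow> \<omega> \<in> a \<inter> (?d -` B \<inter> space M)"
          using deq by eventually_elim auto
      qed (use that dm d'm measurable_sets in auto)
      have prod: "prob (a \<inter> (?d' -` B \<inter> space M)) = prob a * prob (?d' -` B \<inter> space M)"
        if a: "a \<in> sets (F s)" and B: "B \<in> sets borel" for a B
      proof -
        have aM: "a \<in> events" using a sub st by (auto simp: subalgebra_def)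
        have "prob (a \<inter> (?d -` B \<inter> space M)) = prob a * prob (?d -` B \<inter> space M)"
          using ind a B unfolding indep_sets2_eq by blast
        moreover have "prob (?d' -` B \<inter> space M) = prob (?d -` B \<inter> space M)"
          using pe[OF sets.top B] by (simp add: Int_absorb1)
        ultimately show ?thesis using pe[OF aM B] by simp
      qed
      show "indep_set (sets (F s)) {?d' -` B \<inter> space M | B. B \<in> sets borel}"
        unfolding indep_sets2_eq
      proof (intro conjI ballI)
        show "sets (F s) \<subseteq> events" using sub st by (simp add: subalgebra_def)
        show "{?d' -` B \<inter> space M | B. B \<in> sets borel} \<subseteq> events"
          using measurable_sets[OF d'm] by blast
        fix a b assume a: "a \<in> sets (F s)" and "b \<in> {?d' -` B \<inter> space M | B. B \<in> sets borel}"
        then obtain B where B: "B \<in> sets borel" and b: "b = ?d' -` B \<inter> space M" by blast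
        show "prob (a \<inter> b) = prob a * prob b" unfolding b by (rule prod[OF a B])
      qed
    qed
  qed
  then show thesis using eq by (rule that)
qed

theorem proposition3p3:
  fixes M :: "'a measure" and F :: "real \<Rightarrow> 'a measure" and W :: "real \<Rightarrow> 'a \<Rightarrow> real"
    and r \<mu> \<rho> \<sigma> lam \<gamma> :: real and V :: "real \<Rightarrow> ereal"
  assumes "usual_filtration M F"
    and "brownian_motion M F W"
    and "\<sigma> > 0"
    and "lam = (\<mu> - r) / \<sigma>"
    and "\<gamma> > 1"
    and "\<rho> > (1 - \<gamma>) * (r + lam\<^sup>2 / (2 * \<gamma>))"
    and "V = value_function M F W r \<sigma> lam \<rho> \<gamma>"
  shows "\<exists>v v' v'' :: real \<Rightarrow> real.
      (\<forall>x>0. V x = ereal (v x)) \<and>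
      (\<forall>x>0. (v has_real_derivative v' x) (at x)) \<and>
      (\<forall>x>0. (v' has_real_derivative v'' x) (at x)) \<and>
      continuous_on {0<..} v'' \<and>
      (\<forall>x>0. v' x > 0 \<and> v'' x < 0 \<and>
         \<rho> * v x = r * x * v' x - lam\<^sup>2 / 2 * ((v' x)\<^sup>2 / v'' x)
                    + \<gamma> / (1 - \<gamma>) * v' x powr ((\<gamma> - 1) / \<gamma>))"
proof -
  \<comment> \<open>The assumption on \<rho> says exactly that this number is positive.\<close>
  define a where "a = (\<rho> - (1 - \<gamma>) * (r + lam\<^sup>2 / (2 * \<gamma>))) / \<gamma>"
  have \<gamma>: "1 < \<gamma>" by fact
  have a: "0 < a" using assms(5,6) by (simp add: a_def)
  obtain W' where W': "continuous_brownian_motion M F W'" and eq: "AE \<omega> in M. \<forall>t\<ge>0. W t \<omega> = W' t \<omega>"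
    using obtain_continuous_brownian_motion[OF assms(1,2)] .
  interpret continuous_brownian_motion M F W' by fact
  define K where "K = a powr (- \<gamma>)"
  have K: "0 < K" using a by (simp add: K_def)
  define v where "v x = K * x powr (1 - \<gamma>) / (1 - \<gamma>)" for x
  define v' where "v' x = K * x powr (- \<gamma>)" for x
  define v'' where "v'' x = - (\<gamma> * K) * x powr (- \<gamma> - 1)" for x
  have "V x = ereal (v x)" if "0 < x" for x
    using value_function_eq[OF \<gamma> that _ a_def a, of \<sigma>] assms(3,7) value_function_cong_AE[OF eq, of F]
    by (simp add: v_def K_def)
  moreover have "(v has_real_derivative v' x) (at x)" if "0 < x" for x
    unfolding v_def v'_def using that \<gamma> by (auto intro!: derivative_eq_intros)
  moreover have "(v' has_real_derivative v'' x) (at x)" if "0 < x" for x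
    unfolding v'_def v''_def using that by (auto intro!: derivative_eq_intros)
  moreover have "continuous_on {0<..} v''"
    unfolding v''_def by (intro continuous_intros) auto
  moreover have "v' x > 0 \<and> v'' x < 0 \<and>
         \<rho> * v x = r * x * v' x - lam\<^sup>2 / 2 * ((v' x)\<^sup>2 / v'' x)
                    + \<gamma> / (1 - \<gamma>) * v' x powr ((\<gamma> - 1) / \<gamma>)" if x: "0 < x" for x
  proof (intro conjI)
    \<comment> \<open>Every term of the equation is a multiple of Q, and the equation reduces to the
      definition of \<open>a\<close> solved for \<rho>.\<close>
    define Q where "Q = K * x powr (1 - \<gamma>)"
    show "v' x > 0" "v'' x < 0" using K x \<gamma> by (auto simp: v'_def v''_def)
    have 1: "x * v' x = Q"
      using x powr_mult_base[of x "- \<gamma>"] by (simp add: v'_def Q_def)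
    have 2: "(v' x)\<^sup>2 / v'' x = - Q / \<gamma>"
    proof -
      have v'': "v'' x = - \<gamma> * v' x / x"
        using x by (simp add: v''_def v'_def powr_diff)
      have "(v' x)\<^sup>2 / v'' x = - (x * v' x) / \<gamma>"
        unfolding v'' using \<open>v' x > 0\<close> by (simp add: power2_eq_square)
      then show ?thesis using 1 by simp
    qed
    \<comment> \<open>This is where K = a^(-\<gamma>) is used: the power turns K into a^(\<gamma> -
      1 + (1 - \<gamma>)) times a^(1-\<gamma>), that is, a K.\<close>
    have 3: "v' x powr ((\<gamma> - 1) / \<gamma>) = a * Q"
    proof -
      have "v' x powr ((\<gamma> - 1) / \<gamma>) = a powr (- \<gamma> * ((\<gamma> - 1) / \<gamma>)) * x powr (- \<gamma> * ((\<gamma> - 1) / \<gamma>))"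
        using a x by (simp add: v'_def K_def powr_mult powr_powr)
      also have "- \<gamma> * ((\<gamma> - 1) / \<gamma>) = 1 - \<gamma>" using \<gamma> by simp
      also have "a powr (1 - \<gamma>) = a * K"
        using a powr_mult_base[of a "- \<gamma>"] by (simp add: K_def)
      finally show ?thesis by (simp add: Q_def)
    qed
    have \<rho>: "\<rho> = \<gamma> * a + (1 - \<gamma>) * (r + lam\<^sup>2 / (2 * \<gamma>))" using \<gamma> by (simp add: a_def)
    have v: "v x = Q / (1 - \<gamma>)" by (simp add: v_def Q_def)
    have rx: "r * x * v' x = r * Q" using 1 by simp
    show "\<rho> * v x = r * x * v' x - lam\<^sup>2 / 2 * ((v' x)\<^sup>2 / v'' x) + \<gamma> / (1 - \<gamma>) * v' x powr ((\<gamma> - 1) / \<gamma>)"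
      unfolding v rx 2 3 \<rho> using \<gamma> by (simp add: field_simps)
  qed
  ultimately show ?thesis by blast
qed

end
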